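(* Let $n>k>1$ with $n-k$ odd, and let $\alpha,\beta\colon S^{n-k}\to\widetilde{V}_k(\mathbb{R}^n)$ be continuous. If $\alpha$ and $\beta$ are homotopic (i.e. $[\alpha]=[\beta]$ in $\pi_{n-k}\widetilde{V}_k(\mathbb{R}^n)$), then $$\Lambda(\alpha)=\Lambda(\beta).$$
   Context: $S^{n-k}$ and $\overline{B}^{n-k+1}$ are the unit sphere and the closed unit ball (centered at $0$) in $\mathbb{R}^{n-k+1}$. $M_k(\mathbb{R}^n)$ is the space of $k$-tuples of vectors in $\mathbb{R}^n$ (real $n\times k$ matrices), and $\widetilde{V}_k(\mathbb{R}^n)\subset M_k(\mathbb{R}^n)$ is the set of all $k$-frames (linearly independent $k$-tuples). For $a=(a_1,\ldots,a_k)\colon\overline{B}^{n-k+1}\to M_k(\mathbb{R}^n)$ define $\widetilde{a}\colon S^{k-1}\times\overline{B}^{n-k+1}\to\mathbb{R}^n$ by $\widetilde{a}(\gamma,x)=\gamma_1a_1(x)+\ldots+\gamma_ka_k(x)$. Then $\widetilde{a}(-\gamma,x)=-\widetilde{a}(\gamma,x)$. Definition of $\Lambda$ for continuous $\alpha$: choose any smooth $a\colon\overline{B}^{n-k+1}\to M_k(\mathbb{R}^n)$ such that $a(S^{n-k})\subset\widetilde{V}_k(\mathbb{R}^n)$, $a|S^{n-k}$ is homotopic to $\alpha$ as a map into $\widetilde{V}_k(\mathbb{R}^n)$, and $\widetilde{a}^{-1}(0)$ is finite (such $a$ exists). Then $$\Lambda(\alpha)=\sum_{(\gamma,x)}\deg_{(\gamma,x)}\widetilde{a}\mod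 2,$$ where the sum is over half of the zeros of $\widetilde{a}$: exactly one point is chosen from each pair $(\gamma,x),(-\gamma,x)\in\widetilde{a}^{-1}(0)$. The claimed equality is for any admissible choices made for $\alpha$ and for $\beta$. Here $\deg_p$ denotes the local topological degree at an isolated zero $p$: for a compact $n$-dimensional neighbourhood $N$ of $p$ with boundary, containing no other zeros and none on $\partial N$, $\deg_p f$ is the topological degree of $\partial N\ni x\mapsto f(x)/|f(x)|\in S^{n-1}$. *)

theory Defs
  imports "HOL-Analysis.Analysis" "HOL-Homology.Homology"
begin

section \<open>Smooth maps\<close>

primrec C_on :: "nat \<Rightarrow> ('a::real_normed_vector \<Rightarrow> 'b::real_normed_vector) \<Rightarrow> 'a set \<Rightarrow> bool" where
  "C_on 0 f U \<longleftrightarrow> continuous_on U f"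
| "C_on (Suc r) f U \<longleftrightarrow>
     (\<forall>x\<in>U. f differentiable (at x)) \<and> (\<forall>v. C_on r (\<lambda>x. frechet_derivative f (at x) v) U)"

text \<open>On a set that need not be open, smoothness means having a smooth extension to an open
  neighbourhood.\<close>

definition smooth_map_on :: "('a::real_normed_vector \<Rightarrow> 'b::real_normed_vector) \<Rightarrow> 'a set \<Rightarrow> bool" where
  "smooth_map_on f S \<longleftrightarrow>
     (\<exists>U g. open U \<and> S \<subseteq> U \<and> (\<forall>r. C_on r g U) \<and> (\<forall>x\<in>S. g x = f x))"

section \<open>Frames\<close>

text \<open>A \<open>k\<close>-tuple of vectors in \<open>\<real>\<^sup>n\<close> is the \<open>n \<times> k\<close> matrix having these vectors as columns.
  Injectivity excludes tuples with a repeated vector, whose set of columns may be independent.\<close>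

definition frames :: "(real^'k^'n) set" where
  "frames = {A. inj (\<lambda>i. column i A) \<and> independent (columns A)}"

definition tilde :: "(real^'m \<Rightarrow> real^'k^'n) \<Rightarrow> (real^'k) \<times> (real^'m) \<Rightarrow> real^'n" where
  "tilde a = (\<lambda>(\<gamma>, x). \<Sum>i\<in>UNIV. (\<gamma> $ i) *\<^sub>R column i (a x))"

definition tilde_zeros :: "(real^'m \<Rightarrow> real^'k^'n) \<Rightarrow> ((real^'k) \<times> (real^'m)) set" where
  "tilde_zeros a = {p \<in> sphere 0 1 \<times> cball 0 1. tilde a p = 0}"

section \<open>Topological degree of self-maps of the unit sphere of \<open>\<real>\<^sup>n\<close>\<close>

text \<open>\<^const>\<open>Brouwer_degree2\<close> is about \<^const>\<open>nsphere\<close>, the unit sphere in finitely supported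
  sequences, so the coordinates of \<open>real^'n\<close> are enumerated. The degree does not depend on the
  enumeration, since domain and codomain are identified in the same way.\<close>

definition vec_of_seq :: "(nat \<Rightarrow> real) \<Rightarrow> real^'n" where
  "vec_of_seq s = (\<chi> i. s (to_nat_on UNIV i))"

definition seq_of_vec :: "real^'n \<Rightarrow> nat \<Rightarrow> real" where
  "seq_of_vec v = (\<lambda>j. if j < CARD('n) then v $ from_nat_into UNIV j else 0)"

definition sphere_degree :: "(real^'n \<Rightarrow> real^'n) \<Rightarrow> int" where
  "sphere_degree g = Brouwer_degree2 (CARD('n) - 1) (\<lambda>s. seq_of_vec (g (vec_of_seq s)))"

section \<open>Local degree on \<open>S\<^sup>k\<^sup>-\<^sup>1 \<times> \<real>\<^sup>m\<close>, where \<open>n + 1 = k + m\<close>\<close>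

text \<open>The square matrix of a linear map from \<open>\<real>\<^sup>n\<close> to \<open>\<real>\<^sup>k \<times> \<real>\<^sup>m\<close>, bordered on the left by the
  outward normal \<open>(\<gamma>, 0)\<close> of \<open>S\<^sup>k\<^sup>-\<^sup>1 \<times> \<real>\<^sup>m\<close>. The coordinates are enumerated by
  \<^const>\<open>to_nat_on\<close>, those of \<open>\<real>\<^sup>k\<close> preceding those of \<open>\<real>\<^sup>m\<close>. Another enumeration can only
  reverse the orientation of \<open>S\<^sup>k\<^sup>-\<^sup>1 \<times> \<real>\<^sup>m\<close>, changing the sign of all local degrees
  simultaneously.\<close>

definition coord_number :: "'k::finite + 'm::finite \<Rightarrow> nat" where
  "coord_number s =
     (case s of Inl i \<Rightarrow> to_nat_on UNIV i | Inr j \<Rightarrow> CARD('k) + to_nat_on UNIV j)"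

definition pair_coord :: "(real^'k) \<times> (real^'m) \<Rightarrow> 'k + 'm \<Rightarrow> real" where
  "pair_coord p s = (case s of Inl i \<Rightarrow> fst p $ i | Inr j \<Rightarrow> snd p $ j)"

definition bordered_matrix ::
    "real^'k \<Rightarrow> (real^'n \<Rightarrow> (real^'k) \<times> (real^'m)) \<Rightarrow> real^('k + 'm)^('k + 'm)" where
  "bordered_matrix \<gamma> L =
     (\<chi> r c. pair_coord
        (if coord_number c = 0 then (\<gamma>, 0)
         else L (axis (from_nat_into UNIV (coord_number c - 1)) 1)) r)"

definition oriented_tangent_iso ::
    "real^'k \<Rightarrow> (real^'n \<Rightarrow> (real^'k) \<times> (real^'m)) \<Rightarrow> bool" where
  "oriented_tangent_iso \<gamma> L \<longleftrightarrow>
     linear L \<and> (\<forall>u. \<gamma> \<bullet> fst (L u) = 0) \<and> det (bordered_matrix \<gamma> L) > 0"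

text \<open>An orientation preserving parametrisation of a neighbourhood of \<open>p\<close> in
  \<open>S\<^sup>k\<^sup>-\<^sup>1 \<times> \<real>\<^sup>m\<close>: the tangent space at \<open>p\<close> is projected centrally to the sphere in the first
  factor. The image of the closed unit ball is a compact neighbourhood \<open>N\<close> of \<open>p\<close>, and the image
  of the unit sphere is the boundary of \<open>N\<close>.\<close>

definition disc_chart ::
    "(real^'k) \<times> (real^'m) \<Rightarrow> (real^'n \<Rightarrow> (real^'k) \<times> (real^'m)) \<Rightarrow> real
      \<Rightarrow> real^'n \<Rightarrow> (real^'k) \<times> (real^'m)" where
  "disc_chart p L r u =
     (sgn (fst p + r *\<^sub>R fst (L u)), snd p + r *\<^sub>R snd (L u))"

text \<open>The choice below is immaterial at an isolated zero \<open>p\<close> of \<open>f\<close> lying in the interior of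
  the domain \<open>S\<^sup>k\<^sup>-\<^sup>1 \<times> cball 0 1\<close>: admissible \<open>L\<close> and \<open>r\<close> exist, and the degree is
  the same for all of them.\<close>

definition local_degree ::
    "((real^'k) \<times> (real^'m) \<Rightarrow> real^'n) \<Rightarrow> (real^'k) \<times> (real^'m) \<Rightarrow> int" where
  "local_degree f p =
     (SOME d. \<exists>L r. oriented_tangent_iso (fst p) L \<and> r > 0 \<and>
        disc_chart p L r ` cball 0 1 \<subseteq> sphere 0 1 \<times> cball 0 1 \<and>
        (\<forall>u\<in>cball 0 1. f (disc_chart p L r u) = 0 \<longrightarrow> u = 0) \<and>
        d = sphere_degree (\<lambda>u. f (disc_chart p L r u) /\<^sub>R norm (f (disc_chart p L r u))))"

section \<open>The invariant \<open>\<Lambda>\<close>\<close>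

definition admissible :: "(real^'m \<Rightarrow> real^'k^'n) \<Rightarrow> (real^'m \<Rightarrow> real^'k^'n) \<Rightarrow> bool" where
  "admissible \<alpha> a \<longleftrightarrow>
     smooth_map_on a (cball 0 1) \<and>
     a ` sphere 0 1 \<subseteq> frames \<and>
     homotopic_with_canon (\<lambda>_. True) (sphere 0 1) frames a \<alpha> \<and>
     finite (tilde_zeros a)"

definition half_of_zeros ::
    "(real^'m \<Rightarrow> real^'k^'n) \<Rightarrow> ((real^'k) \<times> (real^'m)) set \<Rightarrow> bool" where
  "half_of_zeros a Z \<longleftrightarrow>
     Z \<subseteq> tilde_zeros a \<and>
     (\<forall>(\<gamma>, x)\<in>tilde_zeros a. ((\<gamma>, x) \<in> Z) \<noteq> ((- \<gamma>, x) \<in> Z))"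

text \<open>\<open>\<Lambda>\<close> as a relation: \<open>l \<in> {0, 1}\<close> is a value obtained from some admissible choice of \<open>a\<close>
  and of a half of the zeros. That the value does not depend on the choices is not built in.\<close>

definition is_Lambda :: "(real^'m \<Rightarrow> real^'k^'n) \<Rightarrow> int \<Rightarrow> bool" where
  "is_Lambda \<alpha> l \<longleftrightarrow>
     (\<exists>a Z. admissible \<alpha> a \<and> half_of_zeros a Z \<and>
            l = (\<Sum>p\<in>Z. local_degree (tilde a) p) mod 2)"

end

theory Submission
  imports Defs
begin

text \<open>
  Only parities matter. The map \<open>(\<gamma>, x) \<mapsto> (\<gamma>, x) / |(\<gamma>, x)|\<close> embeds \<open>S\<^sup>k\<^sup>-\<^sup>1 \<times> \<real>\<^sup>m\<close> as an open
  subset of the unit sphere \<open>S\<^sup>n\<close> of \<open>\<real>\<^sup>k \<times> \<real>\<^sup>m\<close>. For \<open>f : U \<rightarrow> \<real>\<^sup>n\<close> with \<open>U\<close> open in \<open>S\<^sup>n\<close> and zeros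
  in a closed set \<open>K \<subseteq> U\<close>, a degree modulo 2 is read off from the image of a generator of \<open>H\<^sub>n(S\<^sup>n)\<close>
  under \<open>H\<^sub>n(S\<^sup>n) \<rightarrow> H\<^sub>n(S\<^sup>n, S\<^sup>n - K) \<cong> H\<^sub>n(U, U - K) \<rightarrow> H\<^sub>n(\<real>\<^sup>n, \<real>\<^sup>n - 0)\<close>. It is additive and homotopy
  invariant, and at an isolated zero it is the parity of the local degree.

  If \<open>a(x)\<close> is injective on the hyperplane orthogonal to \<open>e\<close> for every \<open>x\<close>, the degree \<open>N\<^sub>e(a)\<close> of
  \<open>(\<gamma>, x) \<mapsto> a(x)\<gamma>\<close> over the half space \<open>\<gamma> \<bullet> e > 0\<close> is defined. When there are finitely many zeros,
  almost every \<open>e\<close> qualifies and \<open>N\<^sub>e(a)\<close> is the parity of the sum of the local degrees over half of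
  the zeros. Two half spaces differ by two antipodal lunes, which contribute equally as the map is
  odd in \<open>\<gamma>\<close>; hence \<open>N\<^sub>e(a)\<close> does not depend on \<open>e\<close>.

  A homotopy between the boundary maps extends to a family \<open>a\<^sub>t\<close> over the ball. After a polynomial
  approximation and a generic constant perturbation, of two orthogonal directions \<open>e\<close> and \<open>e'\<close> at
  least one is admissible for each \<open>t\<close>, so the common value of \<open>N\<^sub>e(a\<^sub>t)\<close> and \<open>N\<^sub>e\<^sub>'(a\<^sub>t)\<close> is locally
  constant in \<open>t\<close>.
\<close>

section \<open>Parity in infinite cyclic groups and excision\<close>

text \<open>A single direction \<open>e\<close> cannot serve along the whole homotopy. Zeros with
  \<open>\<gamma>\<close> orthogonal to \<open>e\<close> depend on \<open>t\<close>, on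
  \<open>x\<close> and on a line in a hyperplane of \<open>\<real>\<^sup>k\<close>, which makes 1 +
  m + (k - 2) = n parameters against n equations; generically they occur at isolated times, and
  there a zero crosses the boundary of the half space. Asking for this in two directions at the same
  time leaves one parameter too few. Independence of the direction is what permits switching between
  the two.

  Half spaces replace an arbitrary half of the zeros by an open set, to which a degree of domains
  applies. Passing from the product to \<open>S\<^sup>n\<close> supplies one global class that
  restricts to a local generator at every point, so that no local orientations have to be compared.
  Parity makes every sign disappear: an isomorphism with the integers is determined only up to sign,
  and neither the antipodal map in \<open>\<gamma>\<close> nor the negation of
  \<open>\<real>\<^sup>n\<close> need preserve orientation.\<close>

definition even_in :: "('a,'b) monoid_scheme \<Rightarrow> 'a \<Rightarrow> bool" where
  "even_in G x \<longleftrightarrow> (\<exists>y\<in>carrier G. x = y \<otimes>\<^bsub>G\<^esub> y)"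

lemma even_in_hom:
  assumes "h \<in> hom G H" "even_in G x"
  shows "even_in H (h x)"
  using assms unfolding even_in_def by (metis hom_mult hom_in_carrier)

text \<open>Both the isomorphism and its inverse preserve squares. Since an automorphism of the
  integers can at most change signs, evenness is all that is needed and no generator is ever
  fixed.\<close>

lemma even_in_iso:
  assumes "h \<in> iso G H" "group G" "x \<in> carrier G"
  shows "even_in H (h x) \<longleftrightarrow> even_in G x"
proof -
  interpret group G by fact
  obtain g where g: "group_isomorphisms G H h g"
    using assms iso_iff_group_isomorphisms by blast
  then have "h \<in> hom G H" "g \<in> hom H G" "g (h x) = x"
    using assms by (auto simp: group_isomorphisms_def)
  then show ?thesis
    using even_in_hom by metis
qed

lemma even_in_integer_group: "even_in integer_group x \<longleftrightarrow> even x"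
  by (force simp: even_in_def elim!: evenE)

lemma even_in_mult:
  assumes "G \<cong> integer_group" "group G" "x \<in> carrier G" "y \<in> carrier G"
  shows "even_in G (x \<otimes>\<^bsub>G\<^esub> y) \<longleftrightarrow> (even_in G x \<longleftrightarrow> even_in G y)"
proof -
  interpret group G by fact
  obtain h where h: "h \<in> iso G integer_group"
    using assms by (auto simp: is_iso_def)
  then have "h (x \<otimes>\<^bsub>G\<^esub> y) = h x + h y"
    using assms hom_mult[of h G integer_group x y] by (simp add: iso_imp_homomorphism)
  then show ?thesis
    using even_in_iso[OF h] assms by (metis m_closed even_in_integer_group even_add)
qed

text \<open>The form in which a Brouwer degree enters: a self-map of a sphere acts on top homology
  by raising to the power of its degree.\<close>

lemma even_in_int_pow:
  assumes "G \<cong> integer_group" "group G" "x \<in> carrier G" "\<not> even_in G x"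
  shows "even_in G (x [^]\<^bsub>G\<^esub> (d::int)) \<longleftrightarrow> even d"
proof -
  interpret group G by fact
  obtain h where h: "h \<in> iso G integer_group"
    using assms by (auto simp: is_iso_def)
  then have "h (x [^]\<^bsub>G\<^esub> d) = d * h x"
    using assms hom_int_pow[of h G integer_group x d] by (simp add: iso_imp_homomorphism)
  then show ?thesis
    using even_in_iso[OF h] assms by (metis int_pow_closed even_in_integer_group even_mult_iff)
qed

lemma ex_odd_in:
  assumes "G \<cong> integer_group" "group G"
  obtains x where "x \<in> carrier G" "\<not> even_in G x"
proof -
  interpret group G by fact
  obtain h where h: "h \<in> iso G integer_group"
    using assms by (auto simp: is_iso_def)
  then obtain x where "x \<in> carrier G" "h x = 1"
    using iso_iff[of h] by (metis UNIV_I carrier_integer_group group_integer_group image_iff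
        group_hom.iso_iff group_hom_axioms.intro group_hom_def is_group iso_imp_homomorphism)
  then show ?thesis
    using that even_in_iso[OF h] assms even_in_integer_group by (metis odd_one)
qed

lemma is_iso_integer_group_transfer:
  assumes "h \<in> iso G H" "group G" "group H"
  shows "G \<cong> integer_group \<longleftrightarrow> H \<cong> integer_group"
  using assms by (metis group.iso_sym group_integer_group iso_trans is_isoI)

lemma iso_obtain_preimage:
  assumes "h \<in> iso G H" "y \<in> carrier H"
  obtains x where "x \<in> carrier G" "h x = y"
proof -
  have "h ` carrier G = carrier H"
    using assms(1) by (simp add: Group.iso_def bij_betw_def)
  then show ?thesis
    using assms(2) that by (metis imageE)
qed

lemma iso_cancel:
  assumes "h \<in> iso G H" "x \<in> carrier G" "y \<in> carrier G" "h x = h y"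
  shows "x = y"
proof -
  have "inj_on h (carrier G)"
    using assms(1) by (simp add: Group.iso_def bij_betw_def)
  then show ?thesis
    using assms by (metis inj_onD)
qed

text \<open>The excised set is the complement of \<open>U\<close>. It is closed and lies in the open
  complement of \<open>K\<close>, which is exactly the hypothesis of the excision axiom.\<close>

lemma iso_inclusion_excision:
  assumes U: "openin X U" and K: "closedin X K" and "K \<subseteq> U"
  shows "hom_induced p (subtopology X U) (U - K) X (topspace X - K) id
         \<in> iso (relative_homology_group p (subtopology X U) (U - K))
               (relative_homology_group p X (topspace X - K))"
proof -
  have UX: "U \<subseteq> topspace X" by (rule openin_subset[OF U])
  have "X closure_of (topspace X - U) = topspace X - U"
    using U by (intro closure_of_closedin) blast
  moreover have "X interior_of (topspace X - K) = topspace X - K"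
    using K by (simp add: interior_of_openin openin_diff)
  ultimately have *: "X closure_of (topspace X - U) \<subseteq> X interior_of (topspace X - K)"
    using assms by auto
  have "topspace X - (topspace X - U) = U" "topspace X - K - (topspace X - U) = U - K"
    using UX by auto
  then show ?thesis
    using homology_excision_axiom[OF *, of "topspace X" p] by simp
qed

lemma exact_seq_kernel:
  "exact_seq ([G, H, K], [g, h]) \<Longrightarrow> kernel H G g = h ` carrier K"
  by simp

text \<open>Excision at \<open>K1\<close> yields a class \<open>w1\<close> with the same restriction
  to \<open>K1\<close> as \<open>x\<close>. The quotient of \<open>x\<close> by \<open>w1\<close>
  dies in the homology relative to the complement of \<open>K1\<close>; by exactness of the triple
  it comes from that complement, where excision at \<open>K2\<close> moves it into
  \<open>U2\<close>.\<close>

lemma disjoint_zeros_decomposition: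
  assumes U: "openin X U1" "openin X U2" "U1 \<inter> U2 = {}"
    and K: "closedin X K1" "closedin X K2" "K1 \<subseteq> U1" "K2 \<subseteq> U2"
    and x: "x \<in> carrier (relative_homology_group p X (topspace X - (K1 \<union> K2)))"
  obtains w1 w2 where
    "w1 \<in> carrier (relative_homology_group p (subtopology X U1) (U1 - K1))"
    "w2 \<in> carrier (relative_homology_group p (subtopology X U2) (U2 - K2))"
    "x = hom_induced p (subtopology X U1) (U1 - K1) X (topspace X - (K1 \<union> K2)) id w1
         \<otimes>\<^bsub>relative_homology_group p X (topspace X - (K1 \<union> K2))\<^esub>
         hom_induced p (subtopology X U2) (U2 - K2) X (topspace X - (K1 \<union> K2)) id w2"
proof -
  let ?T = "topspace X"
  let ?K = "K1 \<union> K2"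
  let ?G = "relative_homology_group p X (?T - ?K)"
  let ?G1 = "relative_homology_group p X (?T - K1)"
  let ?A = "?T - K1"
  interpret G: comm_group ?G by simp
  let ?r = "hom_induced p X (?T - ?K) X (?T - K1) id"
  let ?j1 = "hom_induced p (subtopology X U1) (U1 - K1) X (?T - ?K) id"
  let ?j2 = "hom_induced p (subtopology X U2) (U2 - K2) X (?T - ?K) id"
  have UT: "U1 \<subseteq> ?T" "U2 \<subseteq> ?T" using U openin_subset by auto
  obtain w1 where w1: "w1 \<in> carrier (relative_homology_group p (subtopology X U1) (U1 - K1))"
    and w1x: "hom_induced p (subtopology X U1) (U1 - K1) X (?T - K1) id w1 = ?r x"
    using iso_obtain_preimage[OF iso_inclusion_excision[OF U(1) K(1,3), of p]] hom_induced_carrier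
    by metis
  have j1: "?j1 w1 \<in> carrier ?G" by (rule hom_induced_carrier)
  have rj: "?r (?j1 w1) = ?r x"
    unfolding w1x[symmetric]
    by (subst hom_induced_compose') (use U K UT in \<open>auto simp: continuous_map_from_subtopology\<close>)
  define y where "y = x \<otimes>\<^bsub>?G\<^esub> inv\<^bsub>?G\<^esub> (?j1 w1)"
  have y: "y \<in> carrier ?G" using x j1 by (simp add: y_def)
  interpret r: group_hom ?G ?G1 ?r
    by (simp add: group_hom_def group_hom_axioms_def hom_induced_hom)
  have "?r y = \<one>\<^bsub>?G1\<^esub>"
    unfolding y_def using x j1 rj by simp
  then have yk: "y \<in> kernel ?G ?G1 ?r"
    using y by (simp add: kernel_def)
  have "exact_seq ([?G1, ?G, relative_homology_group p (subtopology X ?A) (?T - ?K)],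
                    [?r, hom_induced p (subtopology X ?A) (?T - ?K) X (?T - ?K) id])"
    by (rule homology_exactness_triple_3) auto
  then have "hom_induced p (subtopology X ?A) (?T - ?K) X (?T - ?K) id `
      carrier (relative_homology_group p (subtopology X ?A) (?T - ?K)) = kernel ?G ?G1 ?r"
    by (rule exact_seq_kernel [symmetric])
  then obtain z where z: "z \<in> carrier (relative_homology_group p (subtopology X ?A) (?T - ?K))"
    and zy: "y = hom_induced p (subtopology X ?A) (?T - ?K) X (?T - ?K) id z"
    using yk by auto
  have U2A: "U2 \<subseteq> ?A" using U K UT by auto
  have opA: "openin X ?A" using K by blast
  \<comment> \<open>Excision takes place inside the open subspace \<open>?A\<close>, where
    \<open>U2\<close> is still open and \<open>K2\<close> still closed.\<close>
  have ex: "hom_induced p (subtopology (subtopology X ?A) U2) (U2 - K2) (subtopology X ?A)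
          (topspace (subtopology X ?A) - K2) id
         \<in> iso (relative_homology_group p (subtopology (subtopology X ?A) U2) (U2 - K2))
               (relative_homology_group p (subtopology X ?A) (topspace (subtopology X ?A) - K2))"
  proof (rule iso_inclusion_excision)
    show "openin (subtopology X ?A) U2"
      using U(2) U2A by (meson openin_open_subtopology opA)
    show "closedin (subtopology X ?A) K2"
      using K(2,4) U2A by (metis closedin_subset_topspace order.trans)
  qed fact
  have eq: "subtopology (subtopology X ?A) U2 = subtopology X U2"
       "topspace (subtopology X ?A) - K2 = ?T - ?K"
    using U2A by (auto simp: subtopology_subtopology inf_absorb2)
  obtain w2 where w2: "w2 \<in> carrier (relative_homology_group p (subtopology X U2) (U2 - K2))"
    and w2z: "hom_induced p (subtopology X U2) (U2 - K2) (subtopology X ?A) (?T - ?K) id w2 = z"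
    using iso_obtain_preimage[OF ex[unfolded eq] z] by blast
  have "y = ?j2 w2"
    unfolding zy w2z[symmetric]
    by (subst hom_induced_compose')
       (use U K UT U2A in \<open>auto simp: continuous_map_from_subtopology continuous_map_in_subtopology\<close>)
  moreover have "x = ?j1 w1 \<otimes>\<^bsub>?G\<^esub> y"
    unfolding y_def using x j1 by (simp add: G.m_lcomm)
  ultimately show ?thesis
    using w1 w2 that by blast
qed

section \<open>Homology of spheres and punctured balls\<close>

text \<open>The standard basis spans everything, so \<open>nsphere n\<close> is homeomorphic to the
  unit sphere. Positivity of \<open>n\<close> excludes the degree in which reduced and unreduced
  homology differ.\<close>

lemma homology_group_sphere:
  assumes "DIM('a::euclidean_space) = Suc n" "n > 0"
  shows "homology_group (int n) (top_of_set (sphere (0::'a) 1)) \<cong> integer_group"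
proof -
  obtain f :: "(nat \<Rightarrow> real) \<Rightarrow> 'a" and g
    where "homeomorphic_maps (nsphere (DIM('a) - 1)) (top_of_set (sphere 0 1 \<inter> span Basis)) f g"
    using homeomorphic_maps_nsphere_euclidean_sphere[OF independent_Basis orthogonal_Basis refl _ norm_Basis]
    by (metis assms(1) nat.distinct(1))
  then have "nsphere n homeomorphic_space top_of_set (sphere (0::'a) 1)"
    unfolding homeomorphic_space_def using assms by auto
  from homeomorphic_space_imp_isomorphic_homology_groups[OF this, of "int n"]
  have "homology_group (int n) (top_of_set (sphere (0::'a) 1)) \<cong> homology_group (int n) (nsphere n)"
    by (metis group.iso_sym group_relative_homology_group)
  then show ?thesis
    using reduced_homology_group_nsphere(1)[of n] un_reduced_homology_group[of "int n" "nsphere n"] assms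
    by (metis iso_trans of_nat_0_eq_iff less_numeral_extra(3))
qed

text \<open>Normalisation is a homotopy inverse: the segment from a vector to its normalisation
  consists of positive multiples of the vector and stays in \<open>D\<close> by convexity. The ball
  and the whole space are the two instances needed.\<close>

lemma iso_sphere_inclusion_punctured:
  fixes D :: "'a::euclidean_space set"
  assumes "convex D" "sphere 0 1 \<subseteq> D"
  shows "hom_induced p (top_of_set (sphere 0 1)) {} (top_of_set (D - {0})) {} id
         \<in> iso (homology_group p (top_of_set (sphere 0 1))) (homology_group p (top_of_set (D - {0})))"
proof (rule homotopy_equivalence_homology_group_isomorphism)
  let ?g = "\<lambda>y::'a. y /\<^sub>R norm y"
  show "continuous_map (top_of_set (sphere 0 1)) (top_of_set (D - {0})) id"
    using assms by auto
  have cont: "continuous_on (D - {0}) ?g"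
    by (intro continuous_intros) auto
  show "continuous_map (top_of_set (D - {0})) (top_of_set (sphere 0 1)) ?g"
    using cont by auto
  have im: "?g y \<in> D - {0}" if "y \<in> D - {0}" for y
    using that assms by (auto intro!: subsetD[OF assms(2)])
  have "homotopic_with_canon (\<lambda>_. True) (D - {0}) (D - {0}) ?g id"
  proof (rule homotopic_with_linear)
    show "closed_segment (?g y) (id y) \<subseteq> D - {0}" if y: "y \<in> D - {0}" for y
    proof
      fix z assume z: "z \<in> closed_segment (?g y) (id y)"
      then have "z \<in> D"
        using im[OF y] y assms(1) by (metis DiffD1 closed_segment_subset id_apply subsetD)
      moreover obtain u where u: "0 \<le> u" "u \<le> 1" "z = (1 - u) *\<^sub>R ?g y + u *\<^sub>R y"
        using z by (auto simp: in_segment)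
      then have "z = ((1 - u) / norm y + u) *\<^sub>R y"
        by (simp add: algebra_simps divide_inverse)
      moreover have "(1 - u) / norm y + u > 0"
      proof (cases "u = 1")
        case False
        then have "(1 - u) / norm y > 0" using u y by auto
        then show ?thesis using u by linarith
      qed auto
      ultimately show "z \<in> D - {0}"
        using y by auto
    qed
  qed (use cont in auto)
  then show "homotopic_with (\<lambda>_. True) (top_of_set (D - {0})) (top_of_set (D - {0})) (id \<circ> ?g) id"
    by simp
  show "homotopic_with (\<lambda>_. True) (top_of_set (sphere 0 1)) (top_of_set (sphere 0 1)) (?g \<circ> id) id"
    by (rule homotopic_with_equal) (auto intro!: continuous_intros)
qed

text \<open>The convex set \<open>D\<close> is contractible, so the boundary map is an isomorphism
  onto reduced homology. For \<open>p = 1\<close> the target would have degree 0, where reduced and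
  unreduced groups differ.\<close>

lemma iso_boundary_punctured:
  fixes D :: "'a::euclidean_space set"
  assumes "convex D" "sphere 0 1 \<subseteq> D" "p \<noteq> 1"
  shows "hom_boundary p (top_of_set D) (D - {0})
         \<in> iso (relative_homology_group p (top_of_set D) (D - {0})) (homology_group (p - 1) (top_of_set (D - {0})))"
proof -
  obtain b :: 'a where "b \<in> Basis" using nonempty_Basis by blast
  then have "b \<in> D - {0}" using assms(2) by auto
  moreover have "contractible_space (top_of_set D)"
    using assms(1) by (simp add: contractible_space_top_of_set convex_imp_contractible)
  ultimately have "hom_boundary p (top_of_set D) (D - {0})
      \<in> iso (relative_homology_group p (top_of_set D) (D - {0}))
            (reduced_homology_group (p - 1) (subtopology (top_of_set D) (D - {0})))"
    by (intro iso_relative_homology_of_contractible) auto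
  then show ?thesis
    using assms(3) by (simp add: un_reduced_homology_group subtopology_subtopology inf_absorb2)
qed

lemma relative_homology_group_punctured:
  fixes D :: "'a::euclidean_space set"
  assumes "convex D" "sphere 0 1 \<subseteq> D" "DIM('a) \<ge> 2"
  shows "relative_homology_group (int DIM('a)) (top_of_set D) (D - {0}) \<cong> integer_group"
proof -
  let ?p = "int DIM('a)"
  have p: "?p - 1 = int (DIM('a) - 1)" using assms by auto
  have "homology_group (?p - 1) (top_of_set (sphere (0::'a) 1)) \<cong> integer_group"
    unfolding p using assms by (intro homology_group_sphere) auto
  then have "homology_group (?p - 1) (top_of_set (D - {0})) \<cong> integer_group"
    using is_iso_integer_group_transfer[OF iso_sphere_inclusion_punctured[OF assms(1,2), of "?p - 1"]]
    by simp
  then show ?thesis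
    using is_iso_integer_group_transfer[OF iso_boundary_punctured[OF assms(1,2), of ?p]] assms
    by simp
qed

text \<open>The sphere without \<open>q\<close> is homeomorphic to a hyperplane, hence contractible.
  Consequently an odd class of the sphere restricts to an odd local class at every point.\<close>

lemma iso_sphere_relative_point:
  fixes q :: "'a::euclidean_space"
  assumes "q \<in> sphere 0 1" "p \<noteq> 0" "DIM('a) \<ge> 2"
  shows "hom_induced p (top_of_set (sphere 0 1)) {} (top_of_set (sphere 0 1)) (sphere 0 1 - {q}) id
         \<in> iso (homology_group p (top_of_set (sphere 0 1)))
               (relative_homology_group p (top_of_set (sphere 0 1)) (sphere 0 1 - {q}))"
proof -
  have "q \<noteq> 0" using assms(1) by auto
  then have "- q \<noteq> q"
    by (metis add_eq_0_iff scaleR_2 scaleR_eq_0_iff zero_neq_numeral)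
  then have nq: "- q \<in> sphere 0 1 - {q}" using assms(1) by auto
  have "(sphere 0 1 - {q}) homeomorphic {x. q \<bullet> x = 0}"
    using assms \<open>q \<noteq> 0\<close> by (intro homeomorphic_punctured_sphere_hyperplane) auto
  then have "contractible (sphere 0 1 - {q})"
    using homeomorphic_contractible_eq convex_imp_contractible convex_hyperplane by blast
  then have "contractible_space (subtopology (top_of_set (sphere 0 1)) (sphere 0 1 - {q}))"
    by (simp add: contractible_space_top_of_set subtopology_subtopology inf_absorb2)
  moreover have "topspace (top_of_set (sphere 0 1)) \<inter> (sphere 0 1 - {q}) \<noteq> {}"
    using nq by (metis Int_iff empty_iff topspace_euclidean_subtopology DiffD1)
  ultimately have "hom_induced p (top_of_set (sphere 0 1)) {} (top_of_set (sphere 0 1)) (sphere 0 1 - {q}) id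
         \<in> iso (reduced_homology_group p (top_of_set (sphere 0 1)))
               (relative_homology_group p (top_of_set (sphere 0 1)) (sphere 0 1 - {q}))"
    by (rule iso_reduced_homology_by_contractible)
  then show ?thesis
    using assms(2) by (simp add: un_reduced_homology_group)
qed

section \<open>Comparison of homology classes with the numerical degree of sphere maps\<close>

lemma homeomorphic_maps_vec_of_seq:
  "homeomorphic_maps (nsphere (CARD('n) - 1)) (top_of_set (sphere 0 1))
     (vec_of_seq :: _ \<Rightarrow> real^'n) seq_of_vec"
proof -
  \<comment> \<open>\<open>nsphere p\<close> sums the squares over indices up to and including
    \<open>p\<close>; with \<open>p = CARD('n) - 1\<close> these are the \<open>CARD('n)\<close>
    values of the enumeration.\<close>
  have sum_eq: "(\<Sum>i\<le>CARD('n) - Suc 0. g i) = (\<Sum>i\<in>(UNIV::'n set). g (to_nat_on UNIV i))" for g :: "nat \<Rightarrow> real"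
  proof -
    have "bij_betw (to_nat_on (UNIV::'n set)) UNIV {..<CARD('n)}"
      by (rule to_nat_on_finite) simp
    then have "(\<Sum>i\<in>(UNIV::'n set). g (to_nat_on UNIV i)) = (\<Sum>i<CARD('n). g i)"
      by (rule sum.reindex_bij_betw)
    moreover have "{..CARD('n) - 1} = {..<CARD('n)}"
      using lessThan_Suc_atMost[of "CARD('n) - 1"] by simp
    ultimately show ?thesis by simp
  qed
  have lt: "to_nat_on UNIV i < CARD('n)" for i :: 'n
    using bij_betwE[OF to_nat_on_finite[of "UNIV::'n set"]] by auto
  have vs: "vec_of_seq (seq_of_vec v) = v" for v :: "real^'n"
    using lt by (simp add: vec_of_seq_def seq_of_vec_def vec_eq_iff)
  have norm1: "norm v = 1 \<longleftrightarrow> (\<Sum>i\<in>UNIV. (v $ i)\<^sup>2) = 1" for v :: "real^'n"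
    by (simp add: norm_vec_def L2_set_def real_sqrt_eq_1_iff)
  have "continuous_map (powertop_real UNIV) euclidean (vec_of_seq :: _ \<Rightarrow> real^'n)"
  proof -
    have "continuous_on UNIV (vec_of_seq :: _ \<Rightarrow> real^'n)"
      unfolding vec_of_seq_def
      by (intro continuous_on_vec_lambda continuous_on_product_coordinates)
    then show ?thesis
      by (simp add: euclidean_product_topology)
  qed
  then have "continuous_map (nsphere (CARD('n) - 1)) (top_of_set (sphere 0 1)) (vec_of_seq :: _ \<Rightarrow> real^'n)"
    unfolding nsphere continuous_map_in_subtopology
    by (auto simp: norm1 vec_of_seq_def sum_eq intro: continuous_map_from_subtopology)
  moreover have "continuous_map (top_of_set (sphere 0 1)) (nsphere (CARD('n) - 1)) (seq_of_vec :: real^'n \<Rightarrow> _)"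
  proof -
    have "continuous_map (top_of_set (sphere 0 1)) euclideanreal (\<lambda>v::real^'n. seq_of_vec v j)" for j
      by (auto simp: seq_of_vec_def intro!: continuous_intros)
    then show ?thesis
      unfolding nsphere continuous_map_in_subtopology continuous_map_componentwise_UNIV
      using lt by (auto simp: norm1 seq_of_vec_def sum_eq Pi_iff)
  qed
  moreover have "seq_of_vec (vec_of_seq s :: real^'n) = s" if "s \<in> topspace (nsphere (CARD('n) - 1))" for s
  proof
    fix j
    show "seq_of_vec (vec_of_seq s :: real^'n) j = s j"
    proof (cases "j < CARD('n)")
      case True
      moreover have "to_nat_on (UNIV::'n set) ` UNIV = {..<CARD('n)}"
        using to_nat_on_finite[of "UNIV::'n set"] by (simp add: bij_betw_def)
      ultimately have "to_nat_on UNIV (from_nat_into (UNIV::'n set) j) = j"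
        by (intro to_nat_on_from_nat_into) auto
      then show ?thesis using True by (simp add: vec_of_seq_def seq_of_vec_def)
    next
      case False
      then have "j > CARD('n) - 1"
        using zero_less_card_finite[where 'a='n] by linarith
      then show ?thesis
        using that False by (simp add: nsphere seq_of_vec_def)
    qed
  qed
  ultimately show ?thesis
    using vs by (auto simp: homeomorphic_maps_def)
qed

text \<open>Conjugation by the enumeration of coordinates turns \<open>N\<close> into a self-map of
  \<open>nsphere\<close>, on whose homology the Brouwer degree acts as a power. The conjugating
  isomorphism preserves parity.\<close>

lemma even_in_sphere_map:
  fixes N :: "real^'n \<Rightarrow> real^'n"
  assumes N: "continuous_on (sphere 0 1) N" "N ` sphere 0 1 \<subseteq> sphere 0 1" and "CARD('n) \<ge> 2"
    and c: "c \<in> carrier (homology_group (int CARD('n) - 1) (top_of_set (sphere 0 1)))"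
    and odd: "\<not> even_in (homology_group (int CARD('n) - 1) (top_of_set (sphere 0 1))) c"
  shows "even_in (homology_group (int CARD('n) - 1) (top_of_set (sphere 0 1)))
           (hom_induced (int CARD('n) - 1) (top_of_set (sphere 0 1)) {} (top_of_set (sphere 0 1)) {} N c)
         \<longleftrightarrow> even (sphere_degree N)"
proof -
  let ?S = "top_of_set (sphere (0::real^'n) 1)"
  let ?p = "CARD('n) - 1"
  let ?h = "hom_induced (int ?p) (nsphere ?p) {} ?S {} vec_of_seq"
  let ?N = "\<lambda>s. seq_of_vec (N (vec_of_seq s))"
  have p: "int CARD('n) - 1 = int ?p" using assms(3) by auto
  note hm = homeomorphic_maps_vec_of_seq[where 'n='n]
  have cm: "continuous_map (nsphere ?p) ?S vec_of_seq" "continuous_map ?S (nsphere ?p) seq_of_vec"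
    using hm by (auto simp: homeomorphic_maps_def)
  have Nc: "continuous_map ?S ?S N" using N by auto
  have iso: "?h \<in> iso (homology_group (int ?p) (nsphere ?p)) (homology_group (int ?p) ?S)"
    using hm homeomorphic_map_homology_iso homeomorphic_map_maps by blast
  obtain c' where c': "c' \<in> carrier (homology_group (int ?p) (nsphere ?p))" and cc: "?h c' = c"
    using iso_obtain_preimage[OF iso] c unfolding p by metis
  have "reduced_homology_group (int ?p) (nsphere ?p) = homology_group (int ?p) (nsphere ?p)"
    using assms(3) by (intro un_reduced_homology_group) auto
  note red = this
  have Z: "homology_group (int ?p) (nsphere ?p) \<cong> integer_group"
    using reduced_homology_group_nsphere(1)[of ?p] red by simp
  have odd': "\<not> even_in (homology_group (int ?p) (nsphere ?p)) c'"
    using even_in_iso[OF iso group_relative_homology_group c'] odd[unfolded p] unfolding cc by blast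
  have cNN: "continuous_map (nsphere ?p) (nsphere ?p) ?N"
    using continuous_map_compose[OF continuous_map_compose[OF cm(1) Nc] cm(2)] by (simp add: o_def)
  have e1: "hom_induced (int ?p) ?S {} ?S {} N c = hom_induced (int ?p) (nsphere ?p) {} ?S {} (N \<circ> vec_of_seq) c'"
    unfolding cc[symmetric] by (rule hom_induced_compose') (use cm Nc in auto)
  have e2: "hom_induced (int ?p) (nsphere ?p) {} ?S {} (N \<circ> vec_of_seq)
      = hom_induced (int ?p) (nsphere ?p) {} ?S {} (vec_of_seq \<circ> ?N)"
  proof (rule hom_induced_eq)
    fix s assume "s \<in> topspace (nsphere ?p)"
    then have "vec_of_seq s \<in> topspace ?S"
      using cm(1) continuous_map_funspace by blast
    then have "N (vec_of_seq s) \<in> topspace ?S"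
      using Nc continuous_map_funspace by blast
    then have "vec_of_seq (seq_of_vec (N (vec_of_seq s))) = N (vec_of_seq s)"
      using hm unfolding homeomorphic_maps_def by blast
    then show "(N \<circ> vec_of_seq) s = (vec_of_seq \<circ> ?N) s"
      by (simp only: comp_apply)
  qed
  have e3: "hom_induced (int ?p) (nsphere ?p) {} ?S {} (vec_of_seq \<circ> ?N) c'
      = ?h (hom_induced (int ?p) (nsphere ?p) {} (nsphere ?p) {} ?N c')"
    by (rule hom_induced_compose'[symmetric]) (use cm cNN in auto)
  have e4: "hom_induced (int ?p) (nsphere ?p) {} (nsphere ?p) {} ?N c'
      = c' [^]\<^bsub>homology_group (int ?p) (nsphere ?p)\<^esub> sphere_degree N"
    using Brouwer_degree2[of c' ?p ?N] c' unfolding red sphere_degree_def by blast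
  have eq: "hom_induced (int ?p) ?S {} ?S {} N c
      = ?h (c' [^]\<^bsub>homology_group (int ?p) (nsphere ?p)\<^esub> sphere_degree N)"
    unfolding e1 e2 e3 e4 ..
  have "even_in (homology_group (int ?p) ?S) (hom_induced (int ?p) ?S {} ?S {} N c)
      \<longleftrightarrow> even_in (homology_group (int ?p) (nsphere ?p))
             (c' [^]\<^bsub>homology_group (int ?p) (nsphere ?p)\<^esub> sphere_degree N)"
    unfolding eq using c' by (intro even_in_iso[OF iso] group.int_pow_closed) auto
  also have "\<dots> \<longleftrightarrow> even (sphere_degree N)"
    by (rule even_in_int_pow[OF Z _ c' odd']) (rule group_relative_homology_group)
  finally show ?thesis
    unfolding p .
qed

text \<open>The boundary of \<open>w\<close> is carried by a class \<open>c\<close> on the unit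
  sphere, odd because \<open>w\<close> is. Naturality of the boundary reduces the action of
  \<open>h\<close> to its action on \<open>c\<close>, and on the sphere \<open>h\<close> is joined
  to its normalisation by segments that avoid 0.\<close>

lemma even_in_normalised_map:
  fixes h :: "real^'n \<Rightarrow> real^'n"
  assumes h: "continuous_on (cball 0 1) h" "\<And>u. u \<in> cball 0 1 \<Longrightarrow> h u = 0 \<Longrightarrow> u = 0" and n: "CARD('n) \<ge> 2"
    and w: "w \<in> carrier (relative_homology_group (int CARD('n)) (top_of_set (cball 0 1)) (cball 0 1 - {0}))"
    and odd: "\<not> even_in (relative_homology_group (int CARD('n)) (top_of_set (cball 0 1)) (cball 0 1 - {0})) w"
  shows "even_in (relative_homology_group (int CARD('n)) euclidean (- {0}))
           (hom_induced (int CARD('n)) (top_of_set (cball 0 1)) (cball 0 1 - {0}) euclidean (- {0}) h w)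
         \<longleftrightarrow> even (sphere_degree (\<lambda>u. h u /\<^sub>R norm (h u)))"
proof -
  let ?n = "int CARD('n)"
  let ?S = "top_of_set (sphere (0::real^'n) 1)"
  let ?B = "cball (0::real^'n) 1"
  let ?P = "top_of_set (- {0::real^'n})"
  let ?PB = "top_of_set (?B - {0})"
  let ?N = "\<lambda>u. h u /\<^sub>R norm (h u)"
  let ?j = "hom_induced (?n - 1) ?S {} ?PB {} id"
  let ?i = "hom_induced (?n - 1) ?S {} ?P {} id"
  let ?h = "hom_induced ?n (top_of_set ?B) (?B - {0}) euclidean (- {0}) h"
  have isoB: "hom_boundary ?n (top_of_set ?B) (?B - {0})
         \<in> iso (relative_homology_group ?n (top_of_set ?B) (?B - {0})) (homology_group (?n - 1) ?PB)"
    using n by (intro iso_boundary_punctured) auto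
  have isoR: "hom_boundary ?n euclidean (- {0})
         \<in> iso (relative_homology_group ?n euclidean (- {0})) (homology_group (?n - 1) ?P)"
    using iso_boundary_punctured[of "UNIV :: (real^'n) set" ?n] n by (simp add: Compl_eq_Diff_UNIV)
  have isoj: "?j \<in> iso (homology_group (?n - 1) ?S) (homology_group (?n - 1) ?PB)"
    by (rule iso_sphere_inclusion_punctured) auto
  have isoi: "?i \<in> iso (homology_group (?n - 1) ?S) (homology_group (?n - 1) ?P)"
    using iso_sphere_inclusion_punctured[of UNIV] by (simp add: Compl_eq_Diff_UNIV)
  obtain c where c: "c \<in> carrier (homology_group (?n - 1) ?S)"
    and jc: "?j c = hom_boundary ?n (top_of_set ?B) (?B - {0}) w"
    using iso_obtain_preimage[OF isoj hom_in_carrier[OF iso_imp_homomorphism[OF isoB] w]] by blast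
  have oddc: "\<not> even_in (homology_group (?n - 1) ?S) c"
    using even_in_iso[OF isoj _ c] even_in_iso[OF isoB _ w] odd jc by simp
  have nz: "h u \<noteq> 0" if "norm u = 1" for u
    using h(2)[of u] that by auto
  have hB: "continuous_map (top_of_set ?B) euclidean h" "h \<in> (?B - {0}) \<rightarrow> - {0}"
    using h by auto
  have hS: "continuous_on (sphere 0 1) h"
    using h(1) by (rule continuous_on_subset) auto
  have Ncont: "continuous_on (sphere 0 1) ?N"
    using hS nz by (intro continuous_intros) auto
  have Nim: "?N ` sphere 0 1 \<subseteq> sphere 0 1"
    using nz by auto
  have hPB: "continuous_map ?PB ?P h"
    using hB by (auto intro: continuous_on_subset)
  have "hom_boundary ?n euclidean (- {0}) (?h w)
      = hom_induced (?n - 1) (subtopology (top_of_set ?B) (?B - {0})) {} (subtopology euclidean (- {0})) {} h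
          (hom_boundary ?n (top_of_set ?B) (?B - {0}) w)"
    using naturality_hom_induced[OF hB, of ?n] by (metis comp_apply)
  also have "subtopology (top_of_set ?B) (?B - {0}) = ?PB"
    by (simp add: subtopology_subtopology inf_absorb2)
  also have "hom_induced (?n - 1) ?PB {} ?P {} h (hom_boundary ?n (top_of_set ?B) (?B - {0}) w)
      = hom_induced (?n - 1) ?S {} ?P {} (h \<circ> id) c"
    unfolding jc[symmetric] by (rule hom_induced_compose') (use hPB in auto)
  also have "hom_induced (?n - 1) ?S {} ?P {} (h \<circ> id) = hom_induced (?n - 1) ?S {} ?P {} (id \<circ> ?N)"
  proof (rule homology_homotopy_empty)
    show "homotopic_with (\<lambda>h. True) ?S ?P (h \<circ> id) (id \<circ> ?N)"
      unfolding o_id id_o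
    proof (rule homotopic_with_linear)
      fix u :: "real^'n" assume "u \<in> sphere 0 1"
      then have u: "h u \<noteq> 0" using nz by auto
      show "closed_segment (h u) (?N u) \<subseteq> - {0}"
      proof
        fix z assume "z \<in> closed_segment (h u) (?N u)"
        then obtain s where s: "0 \<le> s" "s \<le> 1" "z = (1 - s) *\<^sub>R h u + s *\<^sub>R ?N u"
          by (auto simp: in_segment)
        then have "z = ((1 - s) + s / norm (h u)) *\<^sub>R h u"
          by (simp add: algebra_simps divide_inverse)
        moreover have "(1 - s) + s / norm (h u) > 0"
          using s u by (cases "s = 0") (auto intro: add_nonneg_pos)
        ultimately show "z \<in> - {0}" using u by auto
      qed
    qed (use hS Ncont in auto)
  qed
  also have "hom_induced (?n - 1) ?S {} ?P {} (id \<circ> ?N) c = ?i (hom_induced (?n - 1) ?S {} ?S {} ?N c)"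
    by (rule hom_induced_compose'[symmetric]) (use Ncont Nim in auto)
  finally have eq: "hom_boundary ?n euclidean (- {0}) (?h w)
      = ?i (hom_induced (?n - 1) ?S {} ?S {} ?N c)" .
  have "even_in (relative_homology_group ?n euclidean (- {0})) (?h w)
      \<longleftrightarrow> even_in (homology_group (?n - 1) ?P) (hom_boundary ?n euclidean (- {0}) (?h w))"
    by (rule even_in_iso[OF isoR _ hom_induced_carrier, symmetric]) (rule group_relative_homology_group)
  also have "\<dots> \<longleftrightarrow> even_in (homology_group (?n - 1) ?S) (hom_induced (?n - 1) ?S {} ?S {} ?N c)"
    unfolding eq
    by (rule even_in_iso[OF isoi _ hom_induced_carrier]) (rule group_relative_homology_group)
  also have "\<dots> \<longleftrightarrow> even (sphere_degree ?N)"
    by (rule even_in_sphere_map[OF Ncont Nim n c oddc])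
  finally show ?thesis .
qed

section \<open>Degree modulo 2 of maps from open subsets of a sphere\<close>

text \<open>The class \<open>c\<close> stands for the fundamental class modulo 2, and
  \<open>w\<close> is its image in \<open>(U, U - K)\<close> under inverse excision. The existential
  quantifier avoids fixing a generator; any odd \<open>c\<close> gives the same answer. The intended
  dimensions are \<open>DIM('a) = Suc DIM('b)\<close>, so that \<open>DIM('b)\<close> is the
  dimension of the sphere.\<close>

definition odd_degree :: "('a::euclidean_space \<Rightarrow> 'b::euclidean_space) \<Rightarrow> 'a set \<Rightarrow> 'a set \<Rightarrow> bool" where
  "odd_degree f U K \<longleftrightarrow>
     (\<exists>c w. c \<in> carrier (homology_group (int DIM('b)) (top_of_set (sphere 0 1))) \<and>
        \<not> even_in (homology_group (int DIM('b)) (top_of_set (sphere 0 1))) c \<and>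
        w \<in> carrier (relative_homology_group (int DIM('b)) (top_of_set U) (U - K)) \<and>
        hom_induced (int DIM('b)) (top_of_set U) (U - K) (top_of_set (sphere 0 1)) (sphere 0 1 - K) id w
          = hom_induced (int DIM('b)) (top_of_set (sphere 0 1)) {} (top_of_set (sphere 0 1)) (sphere 0 1 - K) id c \<and>
        \<not> even_in (relative_homology_group (int DIM('b)) euclidean (- {0::'b}))
            (hom_induced (int DIM('b)) (top_of_set U) (U - K) euclidean (- {0}) f w))"

text \<open>\<open>K\<close> may be larger than the zero set. This freedom lets one fixed
  \<open>K\<close> contain the zeros of all stages of a homotopy.\<close>

definition isolates_zeros :: "('a::euclidean_space \<Rightarrow> 'b::euclidean_space) \<Rightarrow> 'a set \<Rightarrow> 'a set \<Rightarrow> bool" where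
  "isolates_zeros f U K \<longleftrightarrow> openin (top_of_set (sphere 0 1)) U \<and> closed K \<and> K \<subseteq> U \<and>
     continuous_on U f \<and> (\<forall>y\<in>U - K. f y \<noteq> 0)"

lemma isolates_zerosD:
  assumes "isolates_zeros f U K"
  shows "openin (top_of_set (sphere 0 1)) U" "closed K" "K \<subseteq> U" "U \<subseteq> sphere 0 1"
    "continuous_on U f" "\<And>y. y \<in> U \<Longrightarrow> f y = 0 \<Longrightarrow> y \<in> K"
    "continuous_map (top_of_set U) euclidean f" "f \<in> U - K \<rightarrow> - {0}"
proof -
  show "U \<subseteq> sphere 0 1"
    using assms openin_imp_subset unfolding isolates_zeros_def by blast
qed (use assms in \<open>auto simp: isolates_zeros_def\<close>)

section \<open>Well-definedness, excision and additivity of the degree\<close>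

lemma iso_inclusion_sphere:
  fixes U K :: "'a::euclidean_space set"
  assumes "openin (top_of_set (sphere 0 1)) U" "closed K" "K \<subseteq> U"
  shows "hom_induced p (top_of_set U) (U - K) (top_of_set (sphere 0 1)) (sphere 0 1 - K) id
    \<in> iso (relative_homology_group p (top_of_set U) (U - K))
          (relative_homology_group p (top_of_set (sphere 0 1)) (sphere 0 1 - K))"
proof -
  have U: "U \<subseteq> sphere 0 1" using assms(1) openin_imp_subset by blast
  have "closedin (top_of_set (sphere 0 1)) K"
    using assms U by (metis closed_subset order.trans)
  from iso_inclusion_excision[OF assms(1) this assms(3), of p] U show ?thesis
    by (simp add: subtopology_subtopology inf_absorb2)
qed

lemma hom_induced_id_compose:
  assumes "continuous_map X Y id" "S \<subseteq> T" "continuous_map Y Z g" "g \<in> T \<rightarrow> U"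
  shows "hom_induced p Y T Z U g (hom_induced p X S Y T id x) = hom_induced p X S Z U g x"
proof -
  have "id \<in> S \<rightarrow> T" using assms(2) by auto
  then show ?thesis
    using hom_induced_compose'[OF assms(1) _ assms(3,4), of S p x] by (simp only: o_id)
qed

lemma mult_hom_induced:
  assumes "x \<in> carrier (relative_homology_group p X S)" "y \<in> carrier (relative_homology_group p X S)"
  shows "hom_induced p X S Y T f (x \<otimes>\<^bsub>relative_homology_group p X S\<^esub> y)
    = hom_induced p X S Y T f x \<otimes>\<^bsub>relative_homology_group p Y T\<^esub> hom_induced p X S Y T f y"
  by (rule hom_mult[OF hom_induced_hom assms])

lemma m_closed_relative_homology_group:
  assumes "x \<in> carrier (relative_homology_group p X S)" "y \<in> carrier (relative_homology_group p X S)"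
  shows "x \<otimes>\<^bsub>relative_homology_group p X S\<^esub> y \<in> carrier (relative_homology_group p X S)"
  using assms by (simp add: group.is_monoid monoid.m_closed)

lemma relative_homology_group_punctured_UNIV:
  assumes "DIM('b::euclidean_space) \<ge> 2"
  shows "relative_homology_group (int DIM('b)) euclidean (- {0::'b}) \<cong> integer_group"
  using relative_homology_group_punctured[of "UNIV :: 'b set"] assms by (simp add: Compl_eq_Diff_UNIV)

text \<open>The product of two odd classes is a square. The excision isomorphism transports this
  square root to \<open>U\<close>, so the product of \<open>w\<close> and \<open>w'\<close> is a
  square as well, and their images under \<open>f\<close> have the same parity.\<close>

lemma odd_degree_eq:
  fixes f :: "'a::euclidean_space \<Rightarrow> 'b::euclidean_space"
  defines "S \<equiv> top_of_set (sphere (0::'a) 1)" and "p \<equiv> int DIM('b)"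
  assumes dim: "DIM('a) = Suc DIM('b)" "DIM('b) \<ge> 2" and iz: "isolates_zeros f U K"
    and c: "c \<in> carrier (homology_group p S)" "\<not> even_in (homology_group p S) c"
    and w: "w \<in> carrier (relative_homology_group p (top_of_set U) (U - K))"
    and wc: "hom_induced p (top_of_set U) (U - K) S (sphere 0 1 - K) id w
          = hom_induced p S {} S (sphere 0 1 - K) id c"
  shows "odd_degree f U K \<longleftrightarrow>
    \<not> even_in (relative_homology_group p euclidean (- {0::'b}))
        (hom_induced p (top_of_set U) (U - K) euclidean (- {0}) f w)" (is "_ = (\<not> even_in ?T (?f w))")
proof
  show "odd_degree f U K" if "\<not> even_in ?T (?f w)"
    unfolding odd_degree_def using that c w wc unfolding S_def p_def by blast
next
  assume "odd_degree f U K"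
  then obtain c' w' where c': "c' \<in> carrier (homology_group p S)" "\<not> even_in (homology_group p S) c'"
    and w': "w' \<in> carrier (relative_homology_group p (top_of_set U) (U - K))"
    and wc': "hom_induced p (top_of_set U) (U - K) S (sphere 0 1 - K) id w'
          = hom_induced p S {} S (sphere 0 1 - K) id c'" and fw': "\<not> even_in ?T (?f w')"
    unfolding odd_degree_def S_def p_def by blast
  let ?U = "relative_homology_group p (top_of_set U) (U - K)"
  let ?H = "homology_group p S"
  let ?R = "relative_homology_group p S (sphere 0 1 - K)"
  let ?i = "hom_induced p (top_of_set U) (U - K) S (sphere 0 1 - K) id"
  let ?r = "hom_induced p S {} S (sphere 0 1 - K) id"
  have i: "?i \<in> iso ?U ?R"
    unfolding S_def using isolates_zerosD[OF iz] by (intro iso_inclusion_sphere)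
  have HZ: "?H \<cong> integer_group"
    unfolding S_def p_def by (rule homology_group_sphere) (use dim in auto)
  have "even_in ?H (c \<otimes>\<^bsub>?H\<^esub> c')"
    using even_in_mult[OF HZ group_relative_homology_group c(1) c'(1)] c c' by blast
  then obtain y where y: "y \<in> carrier ?H" "c \<otimes>\<^bsub>?H\<^esub> c' = y \<otimes>\<^bsub>?H\<^esub> y"
    unfolding even_in_def by blast
  obtain v where v: "v \<in> carrier ?U" "?i v = ?r y"
    using iso_obtain_preimage[OF i hom_induced_carrier] by metis
  have "?i (w \<otimes>\<^bsub>?U\<^esub> w') = ?r (c \<otimes>\<^bsub>?H\<^esub> c')"
    by (simp only: mult_hom_induced[OF w w'] mult_hom_induced[OF c(1) c'(1)] wc wc')
  also have "\<dots> = ?i (v \<otimes>\<^bsub>?U\<^esub> v)"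
    by (simp only: y(2) mult_hom_induced[OF v(1) v(1)] mult_hom_induced[OF y(1) y(1)] v(2))
  finally have "w \<otimes>\<^bsub>?U\<^esub> w' = v \<otimes>\<^bsub>?U\<^esub> v"
    using iso_cancel[OF i m_closed_relative_homology_group[OF w w'] m_closed_relative_homology_group[OF v(1) v(1)]]
    by blast
  then have "?f w \<otimes>\<^bsub>?T\<^esub> ?f w' = ?f v \<otimes>\<^bsub>?T\<^esub> ?f v"
    by (metis mult_hom_induced w w' v(1))
  then have "even_in ?T (?f w \<otimes>\<^bsub>?T\<^esub> ?f w')"
    unfolding even_in_def using hom_induced_carrier by metis
  moreover have "?T \<cong> integer_group"
    unfolding p_def by (rule relative_homology_group_punctured_UNIV[OF dim(2)])
  ultimately show "\<not> even_in ?T (?f w)"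
    using even_in_mult[of ?T "?f w" "?f w'"] fw' group_relative_homology_group hom_induced_carrier
    by metis
qed

lemma odd_degree_representative:
  fixes f :: "'a::euclidean_space \<Rightarrow> 'b::euclidean_space"
  assumes dim: "DIM('a) = Suc DIM('b)" "DIM('b) \<ge> 2" and iz: "isolates_zeros f U K"
  obtains c w where "c \<in> carrier (homology_group (int DIM('b)) (top_of_set (sphere (0::'a) 1)))"
    "\<not> even_in (homology_group (int DIM('b)) (top_of_set (sphere 0 1))) c"
    "w \<in> carrier (relative_homology_group (int DIM('b)) (top_of_set U) (U - K))"
    "hom_induced (int DIM('b)) (top_of_set U) (U - K) (top_of_set (sphere 0 1)) (sphere 0 1 - K) id w
          = hom_induced (int DIM('b)) (top_of_set (sphere 0 1)) {} (top_of_set (sphere 0 1)) (sphere 0 1 - K) id c"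
proof -
  have "homology_group (int DIM('b)) (top_of_set (sphere (0::'a) 1)) \<cong> integer_group"
    by (rule homology_group_sphere) (use dim in auto)
  from ex_odd_in[OF this group_relative_homology_group] obtain c
    where c: "c \<in> carrier (homology_group (int DIM('b)) (top_of_set (sphere (0::'a) 1)))"
    "\<not> even_in (homology_group (int DIM('b)) (top_of_set (sphere 0 1))) c" by blast
  show ?thesis
    using iso_obtain_preimage[OF iso_inclusion_sphere[OF isolates_zerosD(1-3)[OF iz], of "int DIM('b)"]
        hom_induced_carrier] c that by metis
qed

text \<open>Domain and isolating set are changed one at a time, with \<open>(U', K)\<close> in
  between. Both changes are naturality of inclusions: the class \<open>c\<close> is kept and
  \<open>w\<close> is pushed forward. That all zeros lie in the smaller \<open>K\<close> keeps the
  intermediate pair legitimate.\<close>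

lemma odd_degree_subset:
  fixes f :: "'a::euclidean_space \<Rightarrow> 'b::euclidean_space"
  assumes dim: "DIM('a) = Suc DIM('b)" "DIM('b) \<ge> 2" and iz: "isolates_zeros f U' K'"
    and sub: "isolates_zeros f U K" "U \<subseteq> U'" "K \<subseteq> K'"
    and zeros: "\<And>y. y \<in> U' \<Longrightarrow> f y = 0 \<Longrightarrow> y \<in> K"
  shows "odd_degree f U K = odd_degree f U' K'"
proof -
  let ?p = "int DIM('b)"
  let ?S = "top_of_set (sphere (0::'a) 1)"
  let ?T = "relative_homology_group ?p euclidean (- {0::'b})"
  have iz2: "isolates_zeros f U' K"
    using iz sub zeros unfolding isolates_zeros_def by auto
  note D = isolates_zerosD[OF iz] and D' = isolates_zerosD[OF sub(1)] and D2 = isolates_zerosD[OF iz2]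
  have A: "odd_degree f U' K = odd_degree f U' K'"
  proof -
    obtain c w where c: "c \<in> carrier (homology_group ?p ?S)" "\<not> even_in (homology_group ?p ?S) c"
      and w: "w \<in> carrier (relative_homology_group ?p (top_of_set U') (U' - K'))"
      and wc: "hom_induced ?p (top_of_set U') (U' - K') ?S (sphere 0 1 - K') id w
          = hom_induced ?p ?S {} ?S (sphere 0 1 - K') id c"
      using odd_degree_representative[OF dim iz] by blast
    let ?w = "hom_induced ?p (top_of_set U') (U' - K') (top_of_set U') (U' - K) id w"
    have "hom_induced ?p (top_of_set U') (U' - K) ?S (sphere 0 1 - K) id ?w
        = hom_induced ?p (top_of_set U') (U' - K') ?S (sphere 0 1 - K) (id \<circ> id) w"
      by (rule hom_induced_compose') (use sub D in auto)
    also have "\<dots> = hom_induced ?p ?S (sphere 0 1 - K') ?S (sphere 0 1 - K) id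
        (hom_induced ?p (top_of_set U') (U' - K') ?S (sphere 0 1 - K') id w)"
      by (rule hom_induced_compose'[symmetric]) (use sub D in auto)
    also have "\<dots> = hom_induced ?p ?S {} ?S (sphere 0 1 - K) (id \<circ> id) c"
      unfolding wc by (rule hom_induced_compose') (use sub in auto)
    finally have wc2: "hom_induced ?p (top_of_set U') (U' - K) ?S (sphere 0 1 - K) id ?w
        = hom_induced ?p ?S {} ?S (sphere 0 1 - K) id c" by simp
    have "hom_induced ?p (top_of_set U') (U' - K) euclidean (- {0}) f ?w
        = hom_induced ?p (top_of_set U') (U' - K') euclidean (- {0}) (f \<circ> id) w"
      by (rule hom_induced_compose') (use sub D D2 in auto)
    then show ?thesis
      using odd_degree_eq[OF dim iz c w wc] odd_degree_eq[OF dim iz2 c hom_induced_carrier wc2] by simp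
  qed
  have B: "odd_degree f U K = odd_degree f U' K"
  proof -
    obtain c w where c: "c \<in> carrier (homology_group ?p ?S)" "\<not> even_in (homology_group ?p ?S) c"
      and w: "w \<in> carrier (relative_homology_group ?p (top_of_set U) (U - K))"
      and wc: "hom_induced ?p (top_of_set U) (U - K) ?S (sphere 0 1 - K) id w
          = hom_induced ?p ?S {} ?S (sphere 0 1 - K) id c"
      using odd_degree_representative[OF dim sub(1)] by blast
    let ?w = "hom_induced ?p (top_of_set U) (U - K) (top_of_set U') (U' - K) id w"
    have "hom_induced ?p (top_of_set U') (U' - K) ?S (sphere 0 1 - K) id ?w
        = hom_induced ?p (top_of_set U) (U - K) ?S (sphere 0 1 - K) (id \<circ> id) w"
      by (rule hom_induced_compose') (use sub D in auto)
    also have "\<dots> = hom_induced ?p ?S {} ?S (sphere 0 1 - K) id c"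
      using wc by simp
    finally have wc2: "hom_induced ?p (top_of_set U') (U' - K) ?S (sphere 0 1 - K) id ?w
        = hom_induced ?p ?S {} ?S (sphere 0 1 - K) id c" .
    have "hom_induced ?p (top_of_set U') (U' - K) euclidean (- {0}) f ?w
        = hom_induced ?p (top_of_set U) (U - K) euclidean (- {0}) (f \<circ> id) w"
      by (rule hom_induced_compose') (use sub D2 in auto)
    then show ?thesis
      using odd_degree_eq[OF dim sub(1) c w wc] odd_degree_eq[OF dim iz2 c hom_induced_carrier wc2] by simp
  qed
  show ?thesis using A B by simp
qed

text \<open>After restriction to the complement of \<open>L\<close> alone, the contribution of
  \<open>V'\<close> factors through the homology of \<open>V'\<close> relative to itself, which is
  trivial.\<close>

lemma restrict_class_to_part:
  fixes V V' :: "'a::euclidean_space set"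
  assumes V: "V \<inter> V' = {}" "L \<subseteq> V" "L' \<subseteq> V'" "V' \<subseteq> sphere 0 1" and K: "K = L \<union> L'"
    and VS: "V \<subseteq> sphere 0 1"
    and x: "hom_induced p (top_of_set (sphere 0 1)) {} (top_of_set (sphere 0 1)) (sphere 0 1 - K) id c
       = hom_induced p (top_of_set V) (V - L) (top_of_set (sphere 0 1)) (sphere 0 1 - K) id v
         \<otimes>\<^bsub>relative_homology_group p (top_of_set (sphere 0 1)) (sphere 0 1 - K)\<^esub>
         hom_induced p (top_of_set V') (V' - L') (top_of_set (sphere 0 1)) (sphere 0 1 - K) id v'"
  shows "hom_induced p (top_of_set V) (V - L) (top_of_set (sphere 0 1)) (sphere 0 1 - L) id v
       = hom_induced p (top_of_set (sphere 0 1)) {} (top_of_set (sphere 0 1)) (sphere 0 1 - L) id c"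
proof -
  let ?Sp = "sphere (0::'a) 1"
  let ?S = "top_of_set ?Sp"
  let ?r = "hom_induced p ?S (?Sp - K) ?S (?Sp - L) id"
  let ?RL = "relative_homology_group p ?S (?Sp - L)"
  have KL: "id \<in> ?Sp - K \<rightarrow> ?Sp - L" using K by auto
  have cont: "continuous_map ?S ?S id" "continuous_map (top_of_set V) ?S id" "continuous_map (top_of_set V') ?S id"
    using V(4) VS by auto
  have 1: "?r (hom_induced p ?S {} ?S (?Sp - K) id c) = hom_induced p ?S {} ?S (?Sp - L) id c"
    by (rule hom_induced_id_compose[OF cont(1) _ cont(1) KL]) auto
  have 2: "?r (hom_induced p (top_of_set V) (V - L) ?S (?Sp - K) id v)
      = hom_induced p (top_of_set V) (V - L) ?S (?Sp - L) id v"
    by (rule hom_induced_id_compose[OF cont(2) _ cont(1) KL]) (use V K VS in auto)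
  have 3: "?r (hom_induced p (top_of_set V') (V' - L') ?S (?Sp - K) id v')
      = hom_induced p (top_of_set V') (V' - L') ?S (?Sp - L) id v'"
    by (rule hom_induced_id_compose[OF cont(3) _ cont(1) KL]) (use V K in auto)
  have 4: "hom_induced p (top_of_set V') V' ?S (?Sp - L) id
      (hom_induced p (top_of_set V') (V' - L') (top_of_set V') V' id v')
      = hom_induced p (top_of_set V') (V' - L') ?S (?Sp - L) id v'"
    by (rule hom_induced_id_compose[OF _ _ cont(3)]) (use V K in auto)
  have 5: "hom_induced p (top_of_set V') (V' - L') (top_of_set V') V' id v'
      = \<one>\<^bsub>relative_homology_group p (top_of_set V') V'\<^esub>"
    using trivial_relative_homology_group_topspace[of p "top_of_set V'"]
      hom_induced_carrier[of p "top_of_set V'" "V' - L'" "top_of_set V'" V' id v']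
    unfolding trivial_group_def topspace_euclidean_subtopology by (metis singletonD)
  have 6: "hom_induced p (top_of_set V') V' ?S (?Sp - L) id \<one>\<^bsub>relative_homology_group p (top_of_set V') V'\<^esub>
      = \<one>\<^bsub>?RL\<^esub>"
    by (rule hom_one[OF hom_induced_hom]) auto
  have "hom_induced p ?S {} ?S (?Sp - L) id c
      = hom_induced p (top_of_set V) (V - L) ?S (?Sp - L) id v \<otimes>\<^bsub>?RL\<^esub> \<one>\<^bsub>?RL\<^esub>"
    unfolding 1[symmetric] x mult_hom_induced[OF hom_induced_carrier hom_induced_carrier] 2 3
    unfolding 4[symmetric] 5 6 ..
  also have "\<dots> = hom_induced p (top_of_set V) (V - L) ?S (?Sp - L) id v"
    by (rule monoid.r_one[OF group.is_monoid[OF group_relative_homology_group] hom_induced_carrier])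
  finally show ?thesis by (rule sym)
qed

text \<open>Decomposing the image of one odd class \<open>c\<close> gives parts \<open>w1\<close>
  and \<open>w2\<close>, each of which represents the same \<open>c\<close> on its own piece. All
  three degrees are thus read off from one class, and parity of a product in an infinite cyclic
  group is an exclusive or.\<close>

lemma odd_degree_Un:
  fixes f :: "'a::euclidean_space \<Rightarrow> 'b::euclidean_space"
  assumes dim: "DIM('a) = Suc DIM('b)" "DIM('b) \<ge> 2"
    and iz: "isolates_zeros f U1 K1" "isolates_zeros f U2 K2" and disj: "U1 \<inter> U2 = {}"
  shows "odd_degree f (U1 \<union> U2) (K1 \<union> K2) \<longleftrightarrow> (odd_degree f U1 K1 \<noteq> odd_degree f U2 K2)"
proof -
  let ?p = "int DIM('b)"
  let ?Sp = "sphere (0::'a) 1"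
  let ?S = "top_of_set ?Sp"
  let ?T = "relative_homology_group ?p euclidean (- {0::'b})"
  let ?U = "U1 \<union> U2" and ?K = "K1 \<union> K2"
  note D1 = isolates_zerosD[OF iz(1)] and D2 = isolates_zerosD[OF iz(2)]
  have "continuous_on ?U f"
    using D1 D2 by (intro continuous_on_Un_local_open) (auto intro: openin_subset_trans openin_Un)
  then have iz12: "isolates_zeros f ?U ?K"
    using D1 D2 by (auto simp: isolates_zeros_def openin_Un)
  note D = isolates_zerosD[OF iz12]
  have HZ: "homology_group ?p ?S \<cong> integer_group"
    by (rule homology_group_sphere) (use dim in auto)
  obtain c where c: "c \<in> carrier (homology_group ?p ?S)" "\<not> even_in (homology_group ?p ?S) c"
    using ex_odd_in[OF HZ group_relative_homology_group] by blast
  let ?x = "hom_induced ?p ?S {} ?S (?Sp - ?K) id c"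
  let ?R = "relative_homology_group ?p ?S (?Sp - ?K)"
  let ?U1 = "relative_homology_group ?p (top_of_set U1) (U1 - K1)"
  let ?U2 = "relative_homology_group ?p (top_of_set U2) (U2 - K2)"
  let ?j1 = "hom_induced ?p (top_of_set U1) (U1 - K1) (top_of_set ?U) (?U - ?K) id"
  let ?j2 = "hom_induced ?p (top_of_set U2) (U2 - K2) (top_of_set ?U) (?U - ?K) id"
  let ?i = "hom_induced ?p (top_of_set ?U) (?U - ?K) ?S (?Sp - ?K) id"
  let ?G = "relative_homology_group ?p (top_of_set ?U) (?U - ?K)"
  have "closedin ?S K1" "closedin ?S K2"
    using D1 D2 by (meson closed_subset order.trans)+
  note dec = disjoint_zeros_decomposition[OF D1(1) D2(1) disj this D1(3) D2(3), of ?x ?p]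
  have st: "subtopology ?S U1 = top_of_set U1" "subtopology ?S U2 = top_of_set U2" "topspace ?S = ?Sp"
    using D1(4) D2(4) by (auto simp: subtopology_subtopology inf_absorb2)
  obtain w1 w2 where w: "w1 \<in> carrier ?U1" "w2 \<in> carrier ?U2"
    and x: "?x = hom_induced ?p (top_of_set U1) (U1 - K1) ?S (?Sp - ?K) id w1
         \<otimes>\<^bsub>?R\<^esub> hom_induced ?p (top_of_set U2) (U2 - K2) ?S (?Sp - ?K) id w2"
    by (rule dec[unfolded st, OF hom_induced_carrier])
  have sub: "U1 - K1 \<subseteq> ?Sp - ?K" "U2 - K2 \<subseteq> ?Sp - ?K"
    using D1 D2 disj by auto
  have ij: "?i (?j1 w1) = hom_induced ?p (top_of_set U1) (U1 - K1) ?S (?Sp - ?K) id w1"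
     "?i (?j2 w2) = hom_induced ?p (top_of_set U2) (U2 - K2) ?S (?Sp - ?K) id w2"
    by (rule hom_induced_id_compose; use D1 D2 sub in auto)+
  let ?w = "?j1 w1 \<otimes>\<^bsub>?G\<^esub> ?j2 w2"
  have wG: "?w \<in> carrier ?G"
    by (intro m_closed_relative_homology_group hom_induced_carrier)
  have "?i ?w = ?x"
    unfolding x ij[symmetric] by (intro mult_hom_induced hom_induced_carrier)
  note eq = odd_degree_eq[OF dim iz12 c wG this]
  have wc1: "hom_induced ?p (top_of_set U1) (U1 - K1) ?S (?Sp - K1) id w1 = hom_induced ?p ?S {} ?S (?Sp - K1) id c"
    by (rule restrict_class_to_part[OF disj D1(3) D2(3,4) refl D1(4) x])
  \<comment> \<open>Exchanging the summands lets the restriction argument be applied to the second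
    piece as well.\<close>
  have x': "?x = hom_induced ?p (top_of_set U2) (U2 - K2) ?S (?Sp - ?K) id w2
         \<otimes>\<^bsub>?R\<^esub> hom_induced ?p (top_of_set U1) (U1 - K1) ?S (?Sp - ?K) id w1"
    unfolding x by (intro comm_group.axioms(1)[THEN comm_monoid.m_comm] abelian_relative_homology_group hom_induced_carrier)
  have wc2: "hom_induced ?p (top_of_set U2) (U2 - K2) ?S (?Sp - K2) id w2 = hom_induced ?p ?S {} ?S (?Sp - K2) id c"
    by (rule restrict_class_to_part[OF _ D2(3) D1(3,4) Un_commute D2(4) x']) (use disj in auto)
  note eq1 = odd_degree_eq[OF dim iz(1) c w(1) wc1] and eq2 = odd_degree_eq[OF dim iz(2) c w(2) wc2]
  have "hom_induced ?p (top_of_set ?U) (?U - ?K) euclidean (- {0}) f ?w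
     = hom_induced ?p (top_of_set ?U) (?U - ?K) euclidean (- {0}) f (?j1 w1) \<otimes>\<^bsub>?T\<^esub>
       hom_induced ?p (top_of_set ?U) (?U - ?K) euclidean (- {0}) f (?j2 w2)"
    by (intro mult_hom_induced hom_induced_carrier)
  also have "hom_induced ?p (top_of_set ?U) (?U - ?K) euclidean (- {0}) f (?j1 w1)
     = hom_induced ?p (top_of_set U1) (U1 - K1) euclidean (- {0}) f w1"
    by (rule hom_induced_id_compose) (use D sub in auto)
  also have "hom_induced ?p (top_of_set ?U) (?U - ?K) euclidean (- {0}) f (?j2 w2)
     = hom_induced ?p (top_of_set U2) (U2 - K2) euclidean (- {0}) f w2"
    by (rule hom_induced_id_compose) (use D sub in auto)
  finally show ?thesis
    unfolding eq eq1 eq2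
    using even_in_mult[OF relative_homology_group_punctured_UNIV[OF dim(2)] group_relative_homology_group
        hom_induced_carrier hom_induced_carrier] by metis
qed

section \<open>Homotopy invariance, behaviour under symmetries, and finite sets of zeros\<close>

lemma odd_degree_cong:
  assumes "\<And>y. y \<in> U \<Longrightarrow> f y = g y"
  shows "odd_degree f U K = odd_degree g U K"
proof -
  have "hom_induced p (top_of_set U) (U - K) euclidean (- {0}) f
      = hom_induced p (top_of_set U) (U - K) euclidean (- {0}) g" for p
    by (rule hom_induced_eq) (use assms in auto)
  then show ?thesis by (simp only: odd_degree_def)
qed

text \<open>With one \<open>K\<close> for all stages, \<open>H\<close> is a homotopy of maps of
  pairs. The classes \<open>c\<close> and \<open>w\<close> in the definition of the degree do not
  involve the map and remain the same.\<close>

lemma odd_degree_homotopy: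
  fixes H :: "real \<times> 'a::euclidean_space \<Rightarrow> 'b::euclidean_space"
  assumes cont: "continuous_on ({0..1} \<times> U) H"
    and nz: "\<And>t y. t \<in> {0..1} \<Longrightarrow> y \<in> U - K \<Longrightarrow> H (t, y) \<noteq> 0"
  shows "odd_degree (\<lambda>y. H (0, y)) U K = odd_degree (\<lambda>y. H (1, y)) U K"
proof -
  have "homotopic_with (\<lambda>h. h \<in> U - K \<rightarrow> - {0}) (top_of_set U) euclidean
      (\<lambda>y. H (0, y)) (\<lambda>y. H (1, y))"
    unfolding homotopic_with_def
  proof (intro exI conjI ballI allI)
    show "continuous_map (prod_topology (top_of_set {0..1}) (top_of_set U)) euclidean H"
      using cont by (simp add: continuous_map_iff_continuous flip: subtopology_Times)
  qed (use nz in auto)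
  from homology_homotopy_axiom[OF this, of "int DIM('b)"] show ?thesis
    by (simp only: odd_degree_def)
qed

text \<open>Negation is a homeomorphism of the pair formed by the target space and the complement of
  0, hence acts as an automorphism on its homology. A possible sign does not affect parity.\<close>

lemma odd_degree_uminus:
  fixes f :: "'a::euclidean_space \<Rightarrow> 'b::euclidean_space"
  assumes dim: "DIM('a) = Suc DIM('b)" "DIM('b) \<ge> 2" and iz: "isolates_zeros f U K"
  shows "odd_degree (\<lambda>y. - f y) U K = odd_degree f U K"
proof -
  let ?p = "int DIM('b)"
  let ?T = "relative_homology_group ?p euclidean (- {0::'b})"
  let ?m = "hom_induced ?p euclidean (- {0::'b}) euclidean (- {0}) uminus"
  note D = isolates_zerosD[OF iz]
  have cm: "continuous_map euclidean euclidean (uminus :: 'b \<Rightarrow> 'b)"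
    by (auto intro!: continuous_intros)
  then have "homeomorphic_map euclidean euclidean (uminus :: 'b \<Rightarrow> 'b)"
    unfolding homeomorphic_map_maps homeomorphic_maps_def by (intro exI[of _ uminus]) auto
  then have m: "?m \<in> iso ?T ?T"
  proof (rule homeomorphic_map_relative_homology_iso)
    show "uminus ` (- {0::'b}) = - {0}"
    proof (intro equalityI subsetI)
      fix y :: 'b assume "y \<in> - {0}"
      then show "y \<in> uminus ` (- {0})" by (intro image_eqI[of _ _ "- y"]) auto
    qed auto
  qed auto
  have izm: "isolates_zeros (\<lambda>y. - f y) U K"
    using iz by (auto simp: isolates_zeros_def intro!: continuous_intros)
  obtain c w where c: "c \<in> carrier (homology_group ?p (top_of_set (sphere (0::'a) 1)))"
    "\<not> even_in (homology_group ?p (top_of_set (sphere 0 1))) c"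
    and w: "w \<in> carrier (relative_homology_group ?p (top_of_set U) (U - K))"
    and wc: "hom_induced ?p (top_of_set U) (U - K) (top_of_set (sphere 0 1)) (sphere 0 1 - K) id w
          = hom_induced ?p (top_of_set (sphere 0 1)) {} (top_of_set (sphere 0 1)) (sphere 0 1 - K) id c"
    using odd_degree_representative[OF dim iz] by blast
  let ?f = "hom_induced ?p (top_of_set U) (U - K) euclidean (- {0}) f"
  have "?m (?f w) = hom_induced ?p (top_of_set U) (U - K) euclidean (- {0}) (uminus \<circ> f) w"
    by (rule hom_induced_compose'[OF D(7,8) cm]) auto
  also have "uminus \<circ> f = (\<lambda>y. - f y)" by auto
  finally have "even_in ?T (hom_induced ?p (top_of_set U) (U - K) euclidean (- {0}) (\<lambda>y. - f y) w)
      \<longleftrightarrow> even_in ?T (?f w)"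
    using even_in_iso[OF m group_relative_homology_group hom_induced_carrier] by metis
  then show ?thesis
    using odd_degree_eq[OF dim iz c w wc] odd_degree_eq[OF dim izm c w wc] by blast
qed

text \<open>A homeomorphism of the sphere takes odd classes to odd classes. If \<open>c\<close> is
  used for the image domain, then its image under \<open>T\<close> is an equally good class for
  \<open>U\<close> and \<open>K\<close>.\<close>

lemma odd_degree_involution:
  fixes f :: "'a::euclidean_space \<Rightarrow> 'b::euclidean_space"
  assumes dim: "DIM('a) = Suc DIM('b)" "DIM('b) \<ge> 2" and iz: "isolates_zeros f U K"
    and T: "continuous_on (sphere 0 1) T" "T ` sphere 0 1 \<subseteq> sphere 0 1"
      "\<And>y. y \<in> sphere 0 1 \<Longrightarrow> T (T y) = y"
  shows "odd_degree (f \<circ> T) (T ` U) (T ` K) = odd_degree f U K"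
    and "isolates_zeros (f \<circ> T) (T ` U) (T ` K)"
proof -
  let ?p = "int DIM('b)"
  let ?Sp = "sphere (0::'a) 1"
  let ?S = "top_of_set ?Sp"
  let ?V = "T ` U" and ?L = "T ` K"
  note D = isolates_zerosD[OF iz]
  have US: "?V \<subseteq> ?Sp" using T D(4) by auto
  have KS: "K \<subseteq> ?Sp" using D by auto
  have img: "T ` A = {y \<in> ?Sp. T y \<in> A}" if "A \<subseteq> ?Sp" for A
  proof (intro equalityI subsetI)
    fix y assume "y \<in> {y \<in> ?Sp. T y \<in> A}"
    then show "y \<in> T ` A" using T(3)[of y] by (metis (mono_tags, lifting) imageI mem_Collect_eq)
  next
    fix y assume "y \<in> T ` A"
    then obtain a where a: "a \<in> A" "y = T a" by blast
    then have "a \<in> ?Sp" using that by blast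
    then have "T a \<in> ?Sp" "T (T a) = a" using T(2,3) by blast+
    then have "y \<in> ?Sp" "T y = a" using a by simp_all
    then show "y \<in> {y \<in> ?Sp. T y \<in> A}" using a by simp
  qed
  have hm: "homeomorphic_maps ?S ?S T T"
    using T unfolding homeomorphic_maps_def by auto
  then have homeo: "homeomorphic_map ?S ?S T"
    using homeomorphic_map_maps by blast
  have opV: "openin ?S ?V"
    using homeomorphic_map_openness[OF homeo, of U] D(1,4)
    by (metis topspace_euclidean_subtopology)
  have "compact K"
    using D(2) KS by (meson bounded_sphere bounded_subset compact_eq_bounded_closed)
  then have clL: "closed ?L"
    using T(1) KS by (meson compact_continuous_image compact_imp_closed continuous_on_subset)
  have TV: "T y \<in> U - K" if "y \<in> ?V - ?L" for y
    using that img[OF D(4)] img[OF KS] by auto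
  have cTV: "continuous_on ?V T" using T(1) US by (rule continuous_on_subset)
  have TU: "T ` ?V \<subseteq> U" using img[OF D(4)] by auto
  show iz': "isolates_zeros (f \<circ> T) ?V ?L"
    unfolding isolates_zeros_def
  proof (intro conjI ballI)
    show "continuous_on ?V (f \<circ> T)"
      using cTV D(5) TU by (intro continuous_on_compose) (auto intro: continuous_on_subset)
    show "(f \<circ> T) y \<noteq> 0" if "y \<in> ?V - ?L" for y
      using TV[OF that] D(6) by auto
  qed (use opV clL D in auto)
  obtain c w where c: "c \<in> carrier (homology_group ?p ?S)" "\<not> even_in (homology_group ?p ?S) c"
    and w: "w \<in> carrier (relative_homology_group ?p (top_of_set ?V) (?V - ?L))"
    and wc: "hom_induced ?p (top_of_set ?V) (?V - ?L) ?S (?Sp - ?L) id w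
          = hom_induced ?p ?S {} ?S (?Sp - ?L) id c"
    using odd_degree_representative[OF dim iz'] by blast
  let ?c = "hom_induced ?p ?S {} ?S {} T c"
  let ?w = "hom_induced ?p (top_of_set ?V) (?V - ?L) (top_of_set U) (U - K) T w"
  have "hom_induced ?p ?S {} ?S {} T \<in> iso (homology_group ?p ?S) (homology_group ?p ?S)"
    by (rule homeomorphic_map_homology_iso[OF homeo])
  then have oddc: "\<not> even_in (homology_group ?p ?S) ?c"
    using even_in_iso[OF _ group_relative_homology_group c(1)] c(2) by blast
  have cS: "continuous_map ?S ?S T" "continuous_map ?S ?S id" using T by auto
  have cV: "continuous_map (top_of_set ?V) (top_of_set U) T" using cTV TU by auto
  have cUS: "continuous_map (top_of_set U) ?S id" using D(4) by auto
  have cVS: "continuous_map (top_of_set ?V) ?S id" using US by auto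
  have TVf: "T \<in> ?V - ?L \<rightarrow> U - K" using TV by auto
  have TSf: "T \<in> ?Sp - ?L \<rightarrow> ?Sp - K" using img[OF KS] T(2) by auto
  have "hom_induced ?p (top_of_set U) (U - K) ?S (?Sp - K) id ?w
      = hom_induced ?p (top_of_set ?V) (?V - ?L) ?S (?Sp - K) (id \<circ> T) w"
    by (rule hom_induced_compose'[OF cV TVf cUS]) (use D(4) in auto)
  also have "id \<circ> T = T \<circ> id" by simp
  also have "hom_induced ?p (top_of_set ?V) (?V - ?L) ?S (?Sp - K) (T \<circ> id) w
      = hom_induced ?p ?S (?Sp - ?L) ?S (?Sp - K) T (hom_induced ?p (top_of_set ?V) (?V - ?L) ?S (?Sp - ?L) id w)"
    by (rule hom_induced_compose'[symmetric, OF cVS _ cS(1) TSf]) (use US in auto)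
  also have "\<dots> = hom_induced ?p ?S {} ?S (?Sp - K) (T \<circ> id) c"
    unfolding wc by (rule hom_induced_compose'[OF cS(2) _ cS(1) TSf]) auto
  also have "T \<circ> id = id \<circ> T" by simp
  also have "hom_induced ?p ?S {} ?S (?Sp - K) (id \<circ> T) c = hom_induced ?p ?S {} ?S (?Sp - K) id ?c"
    by (rule hom_induced_compose'[symmetric, OF cS(1) _ cS(2)]) auto
  finally have wc2: "hom_induced ?p (top_of_set U) (U - K) ?S (?Sp - K) id ?w
      = hom_induced ?p ?S {} ?S (?Sp - K) id ?c" .
  have fw: "hom_induced ?p (top_of_set U) (U - K) euclidean (- {0}) f ?w
      = hom_induced ?p (top_of_set ?V) (?V - ?L) euclidean (- {0}) (f \<circ> T) w"
    by (rule hom_induced_compose'[OF cV TVf D(7,8)])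
  show "odd_degree (f \<circ> T) ?V ?L = odd_degree f U K"
    unfolding odd_degree_eq[OF dim iz hom_induced_carrier oddc hom_induced_carrier wc2]
      odd_degree_eq[OF dim iz' c w wc] fw ..
qed

text \<open>On the image of \<open>U\<close> the map \<open>f\<close> coincides with the negative of
  \<open>f \<circ> T\<close>, which also supplies its continuity there.\<close>

lemma odd_degree_antisymmetric:
  fixes f :: "'a::euclidean_space \<Rightarrow> 'b::euclidean_space"
  assumes dim: "DIM('a) = Suc DIM('b)" "DIM('b) \<ge> 2" and iz: "isolates_zeros f U K"
    and T: "continuous_on (sphere 0 1) T" "T ` sphere 0 1 \<subseteq> sphere 0 1"
      "\<And>y. y \<in> sphere 0 1 \<Longrightarrow> T (T y) = y"
    and fT: "\<And>y. y \<in> U \<Longrightarrow> f (T y) = - f y"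
  shows "odd_degree f (T ` U) (T ` K) = odd_degree f U K"
    and "isolates_zeros f (T ` U) (T ` K)"
proof -
  have eq: "f y = - (f \<circ> T) y" if "y \<in> T ` U" for y
    using that fT T(3) isolates_zerosD(4)[OF iz] by auto
  note inv = odd_degree_involution[OF dim iz T]
  have "odd_degree f (T ` U) (T ` K) = odd_degree (\<lambda>y. - (f \<circ> T) y) (T ` U) (T ` K)"
    by (rule odd_degree_cong) (rule eq)
  also have "\<dots> = odd_degree (f \<circ> T) (T ` U) (T ` K)"
    by (rule odd_degree_uminus[OF dim inv(2)])
  finally show "odd_degree f (T ` U) (T ` K) = odd_degree f U K"
    using inv(1) by simp
  have "continuous_on (T ` U) (\<lambda>y. - (f \<circ> T) y)"
    by (intro continuous_on_minus isolates_zerosD(5)[OF inv(2)])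
  then have "continuous_on (T ` U) f"
    by (rule continuous_on_eq) (simp add: eq)
  then show "isolates_zeros f (T ` U) (T ` K)"
    using inv(2) eq unfolding isolates_zeros_def by auto
qed

text \<open>Excision reduces the claim to the empty domain. This is the disjoint union of two copies
  of itself, so its parity equals the exclusive or of that parity with itself.\<close>

lemma odd_degree_empty:
  fixes f :: "'a::euclidean_space \<Rightarrow> 'b::euclidean_space"
  assumes dim: "DIM('a) = Suc DIM('b)" "DIM('b) \<ge> 2" and iz: "isolates_zeros f U {}"
  shows "\<not> odd_degree f U {}"
proof -
  have iz0: "isolates_zeros f {} {}" by (simp add: isolates_zeros_def)
  have "odd_degree f {} {} = odd_degree f U {}"
    by (rule odd_degree_subset[OF dim iz iz0]) (use isolates_zerosD[OF iz] in auto)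
  then show ?thesis
    using odd_degree_Un[OF dim iz0 iz0] by auto
qed

text \<open>Disjoint open neighbourhoods of the new point and of the old ones make the degree
  additive. Excision then enlarges the domains again to \<open>U - (K - {q})\<close>, a form that
  depends on no choice of neighbourhoods and therefore suits the induction.\<close>

lemma odd_degree_finite:
  fixes f :: "'a::euclidean_space \<Rightarrow> 'b::euclidean_space"
  assumes dim: "DIM('a) = Suc DIM('b)" "DIM('b) \<ge> 2" and "finite K" and iz: "isolates_zeros f U K"
  shows "odd_degree f U K \<longleftrightarrow> odd (card {q \<in> K. odd_degree f (U - (K - {q})) {q}})"
  using assms(3,4)
proof (induction K arbitrary: U)
  case empty
  then show ?case using odd_degree_empty[OF dim] by simp
next
  case (insert q K)
  note D = isolates_zerosD[OF insert.prems]
  have op: "openin (top_of_set (sphere 0 1)) (V - C)" if "openin (top_of_set (sphere 0 1)) V" "closed C" for V C :: "'a set"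
    using that by (simp add: Diff_eq openin_Int_open open_Compl)
  have "closed {q}" "closed K" "{q} \<inter> K = {}"
    using insert by (auto simp: finite_imp_closed)
  then obtain A B where AB: "open A" "open B" "q \<in> A" "K \<subseteq> B" "A \<inter> B = {}"
    by (metis insert_subset separation_normal)
  have sub: "isolates_zeros f (U \<inter> A) {q}" "isolates_zeros f (U \<inter> B) K"
    "isolates_zeros f ((U \<inter> A) \<union> (U \<inter> B)) ({q} \<union> K)"
  proof -
    have op: "openin (top_of_set (sphere 0 1)) (U \<inter> A)" "openin (top_of_set (sphere 0 1)) (U \<inter> B)"
      using D(1) AB by (simp_all add: openin_Int_open)
    show "isolates_zeros f (U \<inter> A) {q}" "isolates_zeros f (U \<inter> B) K"
      "isolates_zeros f ((U \<inter> A) \<union> (U \<inter> B)) ({q} \<union> K)"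
      using op D AB \<open>closed K\<close>
      by (auto simp: isolates_zeros_def openin_Un intro: continuous_on_subset)
  qed
  have 1: "odd_degree f U (insert q K) = odd_degree f ((U \<inter> A) \<union> (U \<inter> B)) ({q} \<union> K)"
    by (rule odd_degree_subset[OF dim insert.prems sub(3), symmetric]) (use D in auto)
  have "isolates_zeros f (U - K) {q}"
    using D op[OF D(1) \<open>closed K\<close>] insert.hyps(2)
    by (auto simp: isolates_zeros_def intro: continuous_on_subset)
  then have 2: "odd_degree f (U \<inter> A) {q} = odd_degree f (U - K) {q}"
    by (rule odd_degree_subset[OF dim _ sub(1)]) (use D AB in auto)
  have 3: "odd_degree f (U \<inter> B - (K - {r})) {r} = odd_degree f (U - (insert q K - {r})) {r}" if "r \<in> K" for r
  proof (rule odd_degree_subset[OF dim])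
    have cl: "closed (K - {r})" "closed (insert q K - {r})"
      using insert.hyps by (auto intro: finite_imp_closed)
    show "isolates_zeros f (U - (insert q K - {r})) {r}"
      using D op[OF D(1) cl(2)] that by (auto simp: isolates_zeros_def intro: continuous_on_subset)
    show "isolates_zeros f (U \<inter> B - (K - {r})) {r}"
      using isolates_zerosD[OF sub(2)] op[OF _ cl(1)] that
      by (auto simp: isolates_zeros_def intro: continuous_on_subset)
  qed (use D AB in auto)
  have "odd_degree f (U \<inter> B) K = odd (card {r \<in> K. odd_degree f (U \<inter> B - (K - {r})) {r}})"
    by (rule insert.IH[OF sub(2)])
  also have "{r \<in> K. odd_degree f (U \<inter> B - (K - {r})) {r}} = {r \<in> K. odd_degree f (U - (insert q K - {r})) {r}}"
    using 3 by blast
  finally have 4: "odd_degree f (U \<inter> B) K = odd (card {r \<in> K. odd_degree f (U - (insert q K - {r})) {r}})" .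
  have eq: "{r \<in> insert q K. odd_degree f (U - (insert q K - {r})) {r}}
     = (if odd_degree f (U - K) {q} then {q} else {}) \<union> {r \<in> K. odd_degree f (U - (insert q K - {r})) {r}}"
    using insert.hyps(2) by (auto simp: insert_Diff_if)
  have "card {r \<in> insert q K. odd_degree f (U - (insert q K - {r})) {r}}
     = (if odd_degree f (U - K) {q} then 1 else 0) + card {r \<in> K. odd_degree f (U - (insert q K - {r})) {r}}"
    unfolding eq using insert.hyps by (subst card_Un_disjoint) auto
  then show ?case
    unfolding 1 using odd_degree_Un[OF dim sub(1,2)] AB 2 4 by auto
qed

text \<open>Excision in \<open>\<real>\<^sup>n\<close>, the chart, and excision on the sphere
  compose to an isomorphism from the punctured ball pair to the sphere relative to the complement of
  the point. An odd class of the sphere thus corresponds to an odd class of the ball, on which the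
  degree of the normalised map is already known.\<close>

lemma odd_degree_at_point:
  fixes f :: "'a::euclidean_space \<Rightarrow> real^'n" and g :: "real^'n \<Rightarrow> 'a"
  assumes dim: "DIM('a) = Suc CARD('n)" "CARD('n) \<ge> 2" and iz: "isolates_zeros f V {g 0}"
    and W: "openin (top_of_set (sphere 0 1)) W" and g: "homeomorphic_map euclidean (top_of_set W) g"
    and gV: "g ` cball 0 1 \<subseteq> V"
  shows "odd_degree f V {g 0} \<longleftrightarrow> odd (sphere_degree (\<lambda>u. f (g u) /\<^sub>R norm (f (g u))))"
proof -
  let ?p = "int CARD('n)"
  let ?Sp = "sphere (0::'a) 1"
  let ?S = "top_of_set ?Sp"
  let ?D = "cball (0::real^'n) 1"
  let ?q = "g 0"
  let ?GD = "relative_homology_group ?p (top_of_set ?D) (?D - {0})"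
  let ?GS = "relative_homology_group ?p ?S (?Sp - {?q})"
  have dim': "DIM('a) = Suc DIM(real^'n)" "DIM(real^'n) \<ge> 2" using dim by auto
  note D = isolates_zerosD[OF iz]
  have WS: "W \<subseteq> ?Sp" using W openin_imp_subset by blast
  have gim: "g ` UNIV = W" and inj: "inj g"
    using g by (auto simp: homeomorphic_eq_everything_map)
  have cg: "continuous_map euclidean (top_of_set W) g"
    using g by (simp add: homeomorphic_imp_continuous_map)
  have gne: "g u \<noteq> g 0" if "u \<noteq> 0" for u using inj that by (metis injD)
  have i1: "hom_induced ?p (top_of_set ?D) (?D - {0}) euclidean (- {0}) id
      \<in> iso ?GD (relative_homology_group ?p euclidean (- {0}))"
  proof -
    have "euclidean closure_of (- ?D) \<subseteq> euclidean interior_of (- {0})"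
    proof -
      have "closure (- ?D) \<subseteq> - ball 0 1"
        by (rule closure_minimal) auto
      also have "\<dots> \<subseteq> interior (- {0})"
        by (subst interior_open) auto
      finally show ?thesis
        by simp
    qed
    moreover have "UNIV - - ?D = ?D" "- {0} - - ?D = ?D - {0}" by auto
    ultimately show ?thesis
      using homology_excision_axiom[of euclidean "- ?D" "- {0}" UNIV ?p] by simp
  qed
  have i2: "hom_induced ?p euclidean (- {0}) (top_of_set W) (W - {?q}) g
      \<in> iso (relative_homology_group ?p euclidean (- {0})) (relative_homology_group ?p (top_of_set W) (W - {?q}))"
    by (rule homeomorphic_map_relative_homology_iso[OF g])
       (use gim inj in \<open>auto simp: Compl_eq_Diff_UNIV image_set_diff\<close>)
  have i3: "hom_induced ?p (top_of_set W) (W - {?q}) ?S (?Sp - {?q}) id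
      \<in> iso (relative_homology_group ?p (top_of_set W) (W - {?q})) ?GS"
    using gim by (intro iso_inclusion_sphere[OF W]) auto
  have gf: "g \<in> - {0} \<rightarrow> W - {?q}" "g \<in> ?D - {0} \<rightarrow> W - {?q}"
    using gim gne by auto
  have cgD: "continuous_map (top_of_set ?D) (top_of_set W) g"
    by (rule continuous_map_from_subtopology[OF cg])
  have cgDS: "continuous_map (top_of_set ?D) ?S g"
    using cgD WS by auto
  let ?k = "hom_induced ?p (top_of_set ?D) (?D - {0}) ?S (?Sp - {?q}) g"
  have ki: "?k = hom_induced ?p (top_of_set W) (W - {?q}) ?S (?Sp - {?q}) id \<circ>
      (hom_induced ?p euclidean (- {0}) (top_of_set W) (W - {?q}) g \<circ>
       hom_induced ?p (top_of_set ?D) (?D - {0}) euclidean (- {0}) id)"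
  proof -
    have "hom_induced ?p (top_of_set ?D) (?D - {0}) (top_of_set W) (W - {?q}) (g \<circ> id)
      = hom_induced ?p euclidean (- {0}) (top_of_set W) (W - {?q}) g \<circ>
        hom_induced ?p (top_of_set ?D) (?D - {0}) euclidean (- {0}) id"
      by (rule hom_induced_compose) (use cg gf in auto)
    moreover have "hom_induced ?p (top_of_set ?D) (?D - {0}) ?S (?Sp - {?q}) (id \<circ> g)
      = hom_induced ?p (top_of_set W) (W - {?q}) ?S (?Sp - {?q}) id \<circ>
        hom_induced ?p (top_of_set ?D) (?D - {0}) (top_of_set W) (W - {?q}) g"
      by (rule hom_induced_compose[OF cgD gf(2)]) (use WS in auto)
    ultimately show ?thesis by (simp only: o_id id_o)
  qed
  have k: "?k \<in> iso ?GD ?GS"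
    unfolding ki by (rule iso_set_trans[OF iso_set_trans[OF i1 i2] i3])
  have qS: "?q \<in> ?Sp" using D by auto
  have HZ: "homology_group ?p ?S \<cong> integer_group"
    by (rule homology_group_sphere) (use dim in auto)
  obtain c where c: "c \<in> carrier (homology_group ?p ?S)" "\<not> even_in (homology_group ?p ?S) c"
    using ex_odd_in[OF HZ group_relative_homology_group] by blast
  let ?rc = "hom_induced ?p ?S {} ?S (?Sp - {?q}) id c"
  have "hom_induced ?p ?S {} ?S (?Sp - {?q}) id \<in> iso (homology_group ?p ?S) ?GS"
    by (rule iso_sphere_relative_point[OF qS]) (use dim in auto)
  from even_in_iso[OF this group_relative_homology_group c(1)] c(2)
  have rc: "\<not> even_in ?GS ?rc" by blast
  obtain w0 where w0: "w0 \<in> carrier ?GD" "?k w0 = ?rc"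
    using iso_obtain_preimage[OF k hom_induced_carrier] by metis
  have odd0: "\<not> even_in ?GD w0"
    using even_in_iso[OF k group_relative_homology_group w0(1)] w0(2) rc by simp
  \<comment> \<open>The class is pushed directly from the ball into \<open>V\<close>, because the
    full chart domain \<open>W\<close> need not be contained in \<open>V\<close>.\<close>
  let ?w = "hom_induced ?p (top_of_set ?D) (?D - {0}) (top_of_set V) (V - {?q}) g w0"
  have cgDV: "continuous_map (top_of_set ?D) (top_of_set V) g"
    using cgD gV by auto
  have gfV: "g \<in> ?D - {0} \<rightarrow> V - {?q}"
    using gV gne by auto
  have "hom_induced ?p (top_of_set V) (V - {?q}) ?S (?Sp - {?q}) id ?w
      = hom_induced ?p (top_of_set ?D) (?D - {0}) ?S (?Sp - {?q}) (id \<circ> g) w0"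
    by (rule hom_induced_compose'[OF cgDV gfV]) (use D(4) in auto)
  then have wc: "hom_induced ?p (top_of_set V) (V - {?q}) ?S (?Sp - {?q}) id ?w = ?rc"
    using w0(2) by (simp only: id_o)
  have fw: "hom_induced ?p (top_of_set V) (V - {?q}) euclidean (- {0}) f ?w
      = hom_induced ?p (top_of_set ?D) (?D - {0}) euclidean (- {0}) (f \<circ> g) w0"
    by (rule hom_induced_compose'[OF cgDV gfV D(7,8)])
  have "odd_degree f V {?q} \<longleftrightarrow> \<not> even_in (relative_homology_group ?p euclidean (- {0::real^'n}))
          (hom_induced ?p (top_of_set ?D) (?D - {0}) euclidean (- {0}) (f \<circ> g) w0)"
    using odd_degree_eq[OF dim' iz, unfolded DIM_cart DIM_real mult_1_right,
        OF c hom_induced_carrier wc] unfolding fw .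
  also have "\<dots> \<longleftrightarrow> odd (sphere_degree (\<lambda>u. (f \<circ> g) u /\<^sub>R norm ((f \<circ> g) u)))"
  proof (subst even_in_normalised_map)
    show "continuous_on ?D (f \<circ> g)"
      using continuous_map_compose[OF cgDV D(7)] by simp
    show "u = 0" if u: "u \<in> ?D" "(f \<circ> g) u = 0" for u
    proof -
      have "g u \<in> V" using u(1) gV by blast
      then have "g u = g 0" using D(6) u(2) by auto
      then show ?thesis using gne by blast
    qed
  qed (use dim w0 odd0 in auto)
  finally show ?thesis by simp
qed

section \<open>Oriented charts\<close>

lemma bij_coord_number:
  "bij_betw (coord_number :: 'k::finite + 'm::finite \<Rightarrow> nat) UNIV {..<CARD('k) + CARD('m)}"
proof -
  have k: "inj (to_nat_on (UNIV :: 'k set))" "\<And>i. to_nat_on (UNIV :: 'k set) i < CARD('k)"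
    using to_nat_on_finite[of "UNIV :: 'k set"] by (auto simp: bij_betw_def)
  have m: "inj (to_nat_on (UNIV :: 'm set))" "\<And>i. to_nat_on (UNIV :: 'm set) i < CARD('m)"
    using to_nat_on_finite[of "UNIV :: 'm set"] by (auto simp: bij_betw_def)
  have inj: "inj (coord_number :: 'k + 'm \<Rightarrow> nat)"
  proof (rule injI)
    fix s t :: "'k + 'm" assume "coord_number s = coord_number t"
    then show "s = t"
      using k m by (auto simp: coord_number_def inj_def split: sum.splits)
        (metis not_add_less1)+
  qed
  have "range (coord_number :: 'k + 'm \<Rightarrow> nat) \<subseteq> {..<CARD('k) + CARD('m)}"
    using k m by (auto simp: coord_number_def trans_less_add1 split: sum.splits)
  moreover have "card (range (coord_number :: 'k + 'm \<Rightarrow> nat)) = card {..<CARD('k) + CARD('m)}"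
    using inj by (simp add: card_image)
  ultimately have "range (coord_number :: 'k + 'm \<Rightarrow> nat) = {..<CARD('k) + CARD('m)}"
    by (intro card_subset_eq) auto
  then show ?thesis using inj by (simp add: bij_betw_def)
qed

text \<open>This names the columns of the bordered matrix: \<open>c0\<close> is the one holding the
  normal vector, and \<open>\<kappa> i\<close> the one holding the image of the i-th axis. Later
  arguments need no enumeration.\<close>

lemma coord_number_columns:
  assumes "CARD('k::finite) + CARD('m::finite) = CARD('n::finite) + 1"
  obtains c0 :: "'k::finite + 'm::finite" and \<kappa> :: "'n::finite \<Rightarrow> 'k::finite + 'm::finite"
  where "coord_number c0 = 0" "bij_betw \<kappa> UNIV (UNIV - {c0})"
    "\<And>i. coord_number (\<kappa> i) \<noteq> 0" "\<And>i. from_nat_into UNIV (coord_number (\<kappa> i) - 1) = i"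
proof -
  let ?cn = "coord_number :: 'k + 'm \<Rightarrow> nat"
  have bij: "bij_betw ?cn UNIV {..<CARD('n) + 1}"
    using bij_coord_number[where 'k='k and 'm='m] assms by simp
  then have inj: "inj ?cn" and im: "range ?cn = {..<CARD('n) + 1}"
    by (auto simp: bij_betw_def)
  have n: "inj (to_nat_on (UNIV :: 'n set))" "range (to_nat_on (UNIV :: 'n set)) = {..<CARD('n)}"
    using to_nat_on_finite[of "UNIV :: 'n set"] by (auto simp: bij_betw_def)
  then have lt: "to_nat_on UNIV i < CARD('n)" for i :: 'n by auto
  have "0 \<in> range ?cn" unfolding im by simp
  then obtain c0 where c0: "?cn c0 = 0" by (metis imageE)
  have "\<exists>c. ?cn c = Suc (to_nat_on UNIV i)" for i :: 'n
  proof -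
    have "Suc (to_nat_on UNIV i) \<in> range ?cn" unfolding im using lt by simp
    then show ?thesis by (metis imageE)
  qed
  then obtain \<kappa> :: "'n \<Rightarrow> 'k + 'm" where \<kappa>: "\<And>i. ?cn (\<kappa> i) = Suc (to_nat_on UNIV i)"
    by metis
  have "inj \<kappa>"
    using n(1) \<kappa> by (metis injI injD nat.inject)
  moreover have "range \<kappa> = UNIV - {c0}"
  proof (intro equalityI subsetI)
    fix c assume c: "c \<in> UNIV - {c0}"
    then have "?cn c \<noteq> 0" using inj c0 by (metis DiffD2 injD singletonI)
    then obtain j where j: "?cn c = Suc j" using not0_implies_Suc by blast
    then have "j < CARD('n)" using im by (metis lessThan_iff rangeI Suc_eq_plus1 Suc_less_eq)
    then obtain i :: 'n where "j = to_nat_on UNIV i" using n(2) by (metis imageE lessThan_iff)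
    then have "c = \<kappa> i" using \<kappa> j inj by (metis injD)
    then show "c \<in> range \<kappa>" by blast
  next
    fix c assume "c \<in> range \<kappa>"
    then show "c \<in> UNIV - {c0}" using \<kappa> c0 by auto
  qed
  ultimately show ?thesis
    using that[OF c0, of \<kappa>] \<kappa> by (simp add: bij_betw_def)
qed

lemma pair_coord_eq_iff: "pair_coord p = pair_coord q \<longleftrightarrow> p = q"
proof
  assume eq: "pair_coord p = pair_coord q"
  have "fst p $ i = fst q $ i" for i using fun_cong[OF eq, of "Inl i"] by (simp add: pair_coord_def)
  moreover have "snd p $ j = snd q $ j" for j using fun_cong[OF eq, of "Inr j"] by (simp add: pair_coord_def)
  ultimately show "p = q" by (simp add: prod_eq_iff vec_eq_iff)
qed simp

lemma bordered_matrix_mult: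
  fixes L :: "real^'n \<Rightarrow> (real^'k) \<times> (real^'m)"
  assumes L: "linear L" and c0: "coord_number c0 = 0" and bij: "bij_betw \<kappa> UNIV (UNIV - {c0})"
    and \<kappa>: "\<And>i. coord_number (\<kappa> i) \<noteq> 0" "\<And>i. from_nat_into UNIV (coord_number (\<kappa> i) - 1) = i"
  shows "bordered_matrix \<gamma> L *v y = (\<chi> r. pair_coord (y $ c0 *\<^sub>R (\<gamma>, 0) + L (\<chi> i. y $ \<kappa> i)) r)"
proof -
  have pc: "pair_coord (p + q) r = pair_coord p r + pair_coord q r"
    "pair_coord (s *\<^sub>R p) r = s * pair_coord p r" for p q :: "(real^'k) \<times> (real^'m)" and r s
    by (cases r; simp add: pair_coord_def)+
  have "linear (\<lambda>p::(real^'k) \<times> (real^'m). pair_coord p r)" for r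
    by (rule linearI) (simp_all add: pc)
  note pcsum = linear_sum[OF this]
  have v: "v = (\<Sum>i\<in>UNIV. v $ i *\<^sub>R axis i 1)" for v :: "real^'n"
    by (simp add: vec_eq_iff axis_def if_distrib cong: if_cong)
  have Lv: "L v = (\<Sum>i\<in>UNIV. v $ i *\<^sub>R L (axis i 1))" for v
    by (subst v) (simp add: linear_sum[OF L] linear_cmul[OF L])
  have "(bordered_matrix \<gamma> L *v y) $ r = pair_coord (y $ c0 *\<^sub>R (\<gamma>, 0) + L (\<chi> i. y $ \<kappa> i)) r" for r
  proof -
    have "(bordered_matrix \<gamma> L *v y) $ r = (\<Sum>c\<in>UNIV. bordered_matrix \<gamma> L $ r $ c * y $ c)"
      by (simp add: matrix_vector_mult_def)
    also have "\<dots> = bordered_matrix \<gamma> L $ r $ c0 * y $ c0 + (\<Sum>c\<in>UNIV - {c0}. bordered_matrix \<gamma> L $ r $ c * y $ c)"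
      by (simp add: sum.remove)
    also have "(\<Sum>c\<in>UNIV - {c0}. bordered_matrix \<gamma> L $ r $ c * y $ c)
        = (\<Sum>i\<in>UNIV. bordered_matrix \<gamma> L $ r $ \<kappa> i * y $ \<kappa> i)"
      by (rule sum.reindex_bij_betw[OF bij, symmetric])
    also have "\<dots> = (\<Sum>i\<in>UNIV. y $ \<kappa> i * pair_coord (L (axis i 1)) r)"
    proof (rule sum.cong)
      fix i
      have "bordered_matrix \<gamma> L $ r $ \<kappa> i = pair_coord (L (axis i 1)) r"
        by (simp only: bordered_matrix_def vec_lambda_beta \<kappa>(2) if_not_P[OF \<kappa>(1)])
      then show "bordered_matrix \<gamma> L $ r $ \<kappa> i * y $ \<kappa> i = y $ \<kappa> i * pair_coord (L (axis i 1)) r"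
        by simp
    qed simp
    also have "\<dots> = pair_coord (L (\<chi> i. y $ \<kappa> i)) r"
      by (subst Lv) (simp add: pcsum pc)
    also have "bordered_matrix \<gamma> L $ r $ c0 * y $ c0 = pair_coord (y $ c0 *\<^sub>R (\<gamma>, 0)) r"
      unfolding pc(2) using c0 by (simp add: bordered_matrix_def)
    finally show ?thesis by (simp add: pc)
  qed
  then show ?thesis by (simp add: vec_eq_iff)
qed

text \<open>The normal is orthogonal to the range of \<open>L\<close>. A kernel vector of the
  bordered matrix therefore has normal coefficient 0, and what remains is a kernel vector of
  \<open>L\<close>.\<close>

lemma det_bordered_matrix_neq_0_iff:
  fixes L :: "real^'n \<Rightarrow> (real^'k) \<times> (real^'m)"
  assumes card: "CARD('k) + CARD('m) = CARD('n) + 1"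
    and L: "linear L" "\<And>u. \<gamma> \<bullet> fst (L u) = 0" and \<gamma>: "norm \<gamma> = 1"
  shows "det (bordered_matrix \<gamma> L) \<noteq> 0 \<longleftrightarrow> inj L"
proof -
  obtain c0 :: "'k + 'm" and \<kappa> :: "'n \<Rightarrow> 'k + 'm"
    where c0: "coord_number c0 = 0" and bij: "bij_betw \<kappa> UNIV (UNIV - {c0})"
    and \<kappa>: "\<And>i. coord_number (\<kappa> i) \<noteq> 0" "\<And>i. from_nat_into UNIV (coord_number (\<kappa> i) - 1) = i"
    using coord_number_columns[OF card] by metis
  note mult = bordered_matrix_mult[OF L(1) c0 bij \<kappa>]
  have zero: "bordered_matrix \<gamma> L *v y = 0 \<longleftrightarrow> y $ c0 *\<^sub>R (\<gamma>, 0) + L (\<chi> i. y $ \<kappa> i) = 0" for y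
  proof -
    have "pair_coord (0 :: (real^'k) \<times> (real^'m)) = (\<lambda>r. 0)"
      by (auto simp: pair_coord_def fun_eq_iff split: sum.splits)
    then show ?thesis
      unfolding mult using pair_coord_eq_iff[of "y $ c0 *\<^sub>R (\<gamma>, 0) + L (\<chi> i. y $ \<kappa> i)" 0]
      by (simp add: vec_eq_iff fun_eq_iff)
  qed
  have det: "det (bordered_matrix \<gamma> L) \<noteq> 0 \<longleftrightarrow> (\<forall>y. bordered_matrix \<gamma> L *v y = 0 \<longrightarrow> y = 0)"
    by (metis invertible_det_nz invertible_left_inverse matrix_left_invertible_ker)
  have c0n: "\<kappa> i \<noteq> c0" for i using bij by (auto simp: bij_betw_def)
  show ?thesis
  proof
    assume d: "det (bordered_matrix \<gamma> L) \<noteq> 0"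
    show "inj L"
      unfolding linear_injective_0[OF L(1)]
    proof (intro allI impI)
      fix u assume u: "L u = 0"
      define y where "y = (\<chi> c. if c = c0 then 0 else u $ inv_into UNIV \<kappa> c)"
      have yu: "(\<chi> i. y $ \<kappa> i) = u"
        using bij c0n by (simp add: y_def vec_eq_iff bij_betw_def)
      have "y $ c0 = 0" by (simp add: y_def)
      then have "bordered_matrix \<gamma> L *v y = 0"
        unfolding zero using u yu by (simp add: zero_prod_def)
      then have "y = 0" using d det by blast
      then show "u = 0" using yu by (simp add: vec_eq_iff)
    qed
  next
    assume i: "inj L"
    show "det (bordered_matrix \<gamma> L) \<noteq> 0"
      unfolding det zero
    proof (intro allI impI)
      fix y assume y: "y $ c0 *\<^sub>R (\<gamma>, 0) + L (\<chi> i. y $ \<kappa> i) = 0"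
      then have "\<gamma> \<bullet> fst (y $ c0 *\<^sub>R (\<gamma>, 0) + L (\<chi> i. y $ \<kappa> i)) = 0" by simp
      moreover have "\<gamma> \<noteq> 0" using \<gamma> by auto
      ultimately have y0: "y $ c0 = 0" using \<gamma> by (simp add: inner_add_right L(2) norm_eq_1)
      then have "(\<chi> i. y $ \<kappa> i) = 0"
        using y i unfolding linear_injective_0[OF L(1)] by (simp flip: zero_prod_def)
      then have "y $ \<kappa> i = 0" for i by (simp add: vec_eq_iff)
      moreover have "c = c0 \<or> c \<in> range \<kappa>" for c using bij by (auto simp: bij_betw_def)
      ultimately show "y = 0" using y0 by (metis imageE vec_eq_iff zero_index)
    qed
  qed
qed

text \<open>Precomposition with the reflection multiplies the bordered matrix on the right by a
  diagonal matrix with a single entry -1. This is the means of correcting a wrong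
  orientation.\<close>

lemma det_bordered_matrix_reflect:
  fixes L :: "real^'n \<Rightarrow> (real^'k) \<times> (real^'m)"
  assumes card: "CARD('k) + CARD('m) = CARD('n) + 1" and L: "linear L"
  shows "det (bordered_matrix \<gamma> (L \<circ> (\<lambda>u. \<chi> i. if i = i0 then - u $ i else u $ i))) = - det (bordered_matrix \<gamma> L)"
proof -
  obtain c0 :: "'k + 'm" and \<kappa> :: "'n \<Rightarrow> 'k + 'm"
    where c0: "coord_number c0 = 0" and bij: "bij_betw \<kappa> UNIV (UNIV - {c0})"
    and \<kappa>: "\<And>i. coord_number (\<kappa> i) \<noteq> 0" "\<And>i. from_nat_into UNIV (coord_number (\<kappa> i) - 1) = i"
    using coord_number_columns[OF card] by metis
  let ?R = "\<lambda>u::real^'n. \<chi> i. if i = i0 then - u $ i else u $ i"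
  define D :: "real^('k + 'm)^('k + 'm)" where
    "D = (\<chi> r c. if r = c then (if c = \<kappa> i0 then -1 else 1) else 0)"
  have linR: "linear (L \<circ> ?R)"
    by (rule linear_compose[OF _ L]) (auto intro!: linearI simp: vec_eq_iff)
  have c0n: "\<kappa> i \<noteq> c0" for i using bij by (auto simp: bij_betw_def)
  have inj: "\<kappa> i = \<kappa> j \<longleftrightarrow> i = j" for i j using bij by (auto simp: bij_betw_def inj_def)
  have Dy: "(D *v y) $ c = (if c = \<kappa> i0 then - y $ c else y $ c)" for y c
    by (simp add: D_def matrix_vector_mult_def if_distrib[where f = "\<lambda>x. x * _"] cong: if_cong)
  have "bordered_matrix \<gamma> (L \<circ> ?R) *v y = (bordered_matrix \<gamma> L ** D) *v y" for y
  proof -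
    have "?R (\<chi> i. y $ \<kappa> i) = (\<chi> i. (D *v y) $ \<kappa> i)"
      by (simp add: vec_eq_iff Dy inj)
    moreover have "y $ c0 = (D *v y) $ c0" using c0n[of i0] by (simp add: Dy)
    ultimately show ?thesis
      unfolding matrix_vector_mul_assoc[symmetric] bordered_matrix_mult[OF linR c0 bij \<kappa>]
        bordered_matrix_mult[OF L c0 bij \<kappa>] by simp
  qed
  then have "bordered_matrix \<gamma> (L \<circ> ?R) = bordered_matrix \<gamma> L ** D"
    by (simp add: matrix_eq)
  moreover have "det D = -1"
  proof -
    have "det D = (\<Prod>i\<in>UNIV. D $ i $ i)"
      by (rule det_diagonal) (simp add: D_def)
    also have "\<dots> = -1" by (simp add: D_def)
    finally show ?thesis .
  qed
  ultimately show ?thesis by (simp add: det_mul)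
qed

lemma ex_oriented_tangent_iso:
  fixes \<gamma> :: "real^'k"
  assumes card: "CARD('k) + CARD('m) = CARD('n) + 1" and \<gamma>: "norm \<gamma> = 1"
  obtains L :: "real^'n \<Rightarrow> (real^'k) \<times> (real^'m)" where "oriented_tangent_iso \<gamma> L"
proof -
  let ?T = "{z :: (real^'k) \<times> (real^'m). (\<gamma>, 0) \<bullet> z = 0}"
  have dimT: "dim ?T = CARD('n)"
    using card \<gamma> by (subst dim_hyperplane) (auto simp: zero_prod_def)
  obtain L where L: "linear L" "L ` (UNIV :: (real^'n) set) = ?T" "inj L"
    using subspace_isomorphism[of "UNIV :: (real^'n) set" ?T] dimT subspace_hyperplane subspace_UNIV
    by (metis DIM_cart DIM_real dim_UNIV mult.right_neutral)
  have Lg: "\<gamma> \<bullet> fst (L u) = 0" for u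
    using L(2) by (auto simp: inner_prod_def)
  have d: "det (bordered_matrix \<gamma> L) \<noteq> 0"
    using det_bordered_matrix_neq_0_iff[OF card L(1) Lg \<gamma>] L(3) by simp
  show ?thesis
  proof (cases "det (bordered_matrix \<gamma> L) > 0")
    case True
    then show ?thesis using that[of L] L(1) Lg by (simp add: oriented_tangent_iso_def)
  next
    case False
    \<comment> \<open>\<open>undefined\<close> is merely some coordinate; any reflection reverses
      the sign of the determinant.\<close>
    let ?R = "\<lambda>u::real^'n. \<chi> i. if i = undefined then - u $ i else u $ i"
    have "linear (L \<circ> ?R)"
      by (rule linear_compose[OF _ L(1)]) (auto intro!: linearI simp: vec_eq_iff)
    moreover have "det (bordered_matrix \<gamma> (L \<circ> ?R)) > 0"
      using False d by (simp only: det_bordered_matrix_reflect[OF card L(1)])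
    ultimately show ?thesis using that[of "L \<circ> ?R"] Lg by (simp add: oriented_tangent_iso_def)
  qed
qed

section \<open>Oriented charts as homeomorphisms onto open hemispheres\<close>

lemma disc_chart_scale: "linear L \<Longrightarrow> disc_chart p L r u = disc_chart p L 1 (r *\<^sub>R u)"
  by (simp add: disc_chart_def linear_cmul)

lemma oriented_tangent_isoD:
  fixes L :: "real^'n \<Rightarrow> (real^'k) \<times> (real^'m)"
  assumes card: "CARD('k) + CARD('m) = CARD('n) + 1" and \<gamma>: "norm \<gamma> = 1" and L: "oriented_tangent_iso \<gamma> L"
  shows "linear L" "\<gamma> \<bullet> fst (L u) = 0" "inj L" "range L = {z. \<gamma> \<bullet> fst z = 0}"
proof -
  show lin: "linear L" and tan: "\<gamma> \<bullet> fst (L u) = 0" for u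
    using L by (auto simp: oriented_tangent_iso_def)
  have "det (bordered_matrix \<gamma> L) \<noteq> 0"
    using L by (simp add: oriented_tangent_iso_def)
  then show inj: "inj L"
    using det_bordered_matrix_neq_0_iff[OF card lin tan \<gamma>] by simp
  let ?T = "{z :: (real^'k) \<times> (real^'m). (\<gamma>, 0) \<bullet> z = 0}"
  have dimT: "dim ?T = CARD('n)"
    using card \<gamma> by (subst dim_hyperplane) (auto simp: zero_prod_def)
  have "dim (range L) = dim (UNIV :: (real^'n) set)"
    by (rule dim_image_eq[OF lin]) (use inj in auto)
  then have "range L = ?T"
    using dimT tan by (intro subspace_dim_equal linear_subspace_image lin subspace_hyperplane)
      (auto simp: dim_UNIV inner_prod_def)
  then show "range L = {z. \<gamma> \<bullet> fst z = 0}"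
    by (simp add: inner_prod_def)
qed

lemma continuous_on_disc_chart:
  fixes L :: "real^'n \<Rightarrow> (real^'k) \<times> (real^'m)"
  assumes L: "linear L" "\<And>u. \<gamma> \<bullet> fst (L u) = 0" and \<gamma>: "norm \<gamma> = 1"
  shows "continuous_on S (disc_chart (\<gamma>, x) L r)"
    and "norm (fst (disc_chart (\<gamma>, x) L r u)) = 1"
proof -
  have nz: "\<gamma> + r *\<^sub>R fst (L u) \<noteq> 0" for u
  proof
    assume "\<gamma> + r *\<^sub>R fst (L u) = 0"
    then have "\<gamma> \<bullet> (\<gamma> + r *\<^sub>R fst (L u)) = 0" by simp
    then show False using L(2) \<gamma> by (simp add: inner_add_right norm_eq_1)
  qed
  have "continuous_on S L" using L(1) by (simp add: linear_continuous_on linear_conv_bounded_linear)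
  then show "continuous_on S (disc_chart (\<gamma>, x) L r)"
    unfolding disc_chart_def using nz by (intro continuous_intros) auto
  show "norm (fst (disc_chart (\<gamma>, x) L r u)) = 1"
    using nz by (simp add: disc_chart_def norm_sgn)
qed

text \<open>Before normalisation the first component ranges over the affine hyperplane tangent to
  the sphere at \<open>\<gamma>\<close>, whose vectors have inner product 1 with
  \<open>\<gamma>\<close>. Central projection identifies that hyperplane with the open half sphere,
  so the chart is a homeomorphism globally and not only near the centre.\<close>

lemma homeomorphic_map_sgn_disc_chart:
  fixes L :: "real^'n \<Rightarrow> (real^'k) \<times> (real^'m)"
  assumes card: "CARD('k) + CARD('m) = CARD('n) + 1" and \<gamma>: "norm \<gamma> = 1"
    and L: "oriented_tangent_iso \<gamma> L" and r: "r > 0"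
  shows "homeomorphic_map euclidean (top_of_set {y \<in> sphere 0 1. fst y \<bullet> \<gamma> > 0})
           (\<lambda>u. sgn (disc_chart (\<gamma>, x) L r u))"
proof -
  note LD = oriented_tangent_isoD[OF card \<gamma> L]
  let ?D = "disc_chart (\<gamma>, x) L r"
  let ?W = "{y :: (real^'k) \<times> (real^'m). y \<in> sphere 0 1 \<and> fst y \<bullet> \<gamma> > 0}"
  obtain L' where L': "linear L'" "\<And>u. L' (L u) = u"
    using linear_injective_left_inverse[OF LD(1,3)] by (metis comp_apply id_apply)
  have LL': "L (L' z) = z" if "\<gamma> \<bullet> fst z = 0" for z
  proof -
    have "z \<in> range L" using that LD(4) by simp
    then show ?thesis using L'(2) by (metis imageE)
  qed
  \<comment> \<open>Dividing \<open>fst y\<close> by its inner product with \<open>\<gamma>\<close>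
    returns it to the tangent hyperplane; dividing \<open>snd y\<close> by
    \<open>norm (fst y)\<close> undoes the normalisation by \<open>sgn\<close>.\<close>
  let ?h = "\<lambda>y :: (real^'k) \<times> (real^'m). inverse r *\<^sub>R L' (fst y /\<^sub>R (fst y \<bullet> \<gamma>) - \<gamma>, snd y /\<^sub>R norm (fst y) - x)"
  note cD = continuous_on_disc_chart[OF LD(1,2) \<gamma>]
  have Dnz: "?D u \<noteq> 0" for u using cD(2)[of x r u] by auto
  have in1: "(\<gamma> + r *\<^sub>R fst (L u)) \<bullet> \<gamma> = 1" for u
  proof -
    have "\<gamma> \<bullet> (\<gamma> + r *\<^sub>R fst (L u)) = 1"
      using LD(2)[of u] \<gamma> by (simp add: inner_add_right norm_eq_1)
    then show ?thesis by (simp only: inner_commute)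
  qed
  have nz: "\<gamma> + r *\<^sub>R fst (L u) \<noteq> 0" for u using in1[of u] by auto
  define c where "c u = inverse (norm (?D u)) * inverse (norm (\<gamma> + r *\<^sub>R fst (L u)))" for u
  have c: "c u > 0" for u using Dnz nz by (simp add: c_def)
  have fsD: "fst (sgn (?D u)) = c u *\<^sub>R (\<gamma> + r *\<^sub>R fst (L u))"
    "snd (sgn (?D u)) = inverse (norm (?D u)) *\<^sub>R (x + r *\<^sub>R snd (L u))" for u
    by (simp_all add: sgn_div_norm c_def disc_chart_def)
  have "homeomorphic_maps euclidean (top_of_set ?W) (\<lambda>u. sgn (?D u)) ?h"
    unfolding homeomorphic_maps_def
  proof (intro conjI ballI)
    have "continuous_on UNIV (\<lambda>u. sgn (?D u))"
      using cD(1)[of UNIV x r] Dnz by (intro continuous_intros) auto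
    moreover have "sgn (?D u) \<in> ?W" for u
    proof -
      have "fst (sgn (?D u)) \<bullet> \<gamma> = c u"
        unfolding fsD inner_scaleR_left in1 by simp
      then show ?thesis using c[of u] Dnz[of u] by (simp add: norm_sgn)
    qed
    ultimately show "continuous_map euclidean (top_of_set ?W) (\<lambda>u. sgn (?D u))"
      by (intro continuous_map_into_subtopology) auto
    have "continuous_on A L'" for A
      using L'(1) by (simp add: linear_continuous_on linear_conv_bounded_linear)
    then have "continuous_on ?W (L' \<circ> (\<lambda>y. (fst y /\<^sub>R (fst y \<bullet> \<gamma>) - \<gamma>, snd y /\<^sub>R norm (fst y) - x)))"
      by (intro continuous_on_compose continuous_intros) auto
    then have "continuous_on ?W ?h"
      by (intro continuous_on_scaleR continuous_on_const) (simp add: o_def)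
    then show "continuous_map (top_of_set ?W) euclidean ?h"
      by simp
    fix u
    have "fst (sgn (?D u)) \<bullet> \<gamma> = c u"
      unfolding fsD inner_scaleR_left in1 by simp
    then have 1: "fst (sgn (?D u)) /\<^sub>R (fst (sgn (?D u)) \<bullet> \<gamma>) = \<gamma> + r *\<^sub>R fst (L u)"
      using c[of u] by (simp add: fsD(1))
    have "norm (fst (sgn (?D u))) = inverse (norm (?D u))"
      using nz[of u] by (simp add: fsD(1) c_def)
    then have 2: "snd (sgn (?D u)) /\<^sub>R norm (fst (sgn (?D u))) = x + r *\<^sub>R snd (L u)"
      using Dnz[of u] by (simp add: fsD(2))
    show "?h (sgn (?D u)) = u"
    proof -
      have "(\<gamma> + r *\<^sub>R fst (L u) - \<gamma>, x + r *\<^sub>R snd (L u) - x) = r *\<^sub>R L u"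
        by (simp add: prod_eq_iff)
      then show ?thesis unfolding 1 2 using r by (simp add: linear_cmul[OF L'(1)] L'(2))
    qed
  next
    fix y assume "y \<in> topspace (top_of_set ?W)"
    then have y: "norm y = 1" "fst y \<bullet> \<gamma> > 0" by auto
    let ?z = "(fst y /\<^sub>R (fst y \<bullet> \<gamma>) - \<gamma>, snd y /\<^sub>R norm (fst y) - x)"
    have fy: "fst y \<noteq> 0" using y by auto
    have "\<gamma> \<bullet> fst ?z = 0"
      using y \<gamma> by (simp add: inner_diff_right inner_commute norm_eq_1)
    then have "r *\<^sub>R L (?h y) = ?z"
      using r by (simp add: linear_cmul[OF LD(1)] LL')
    then have rL: "r *\<^sub>R fst (L (?h y)) = fst ?z" "r *\<^sub>R snd (L (?h y)) = snd ?z"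
      by (metis fst_scaleR, metis snd_scaleR)
    have "?D (?h y) = (sgn (fst y /\<^sub>R (fst y \<bullet> \<gamma>)), snd y /\<^sub>R norm (fst y))"
      unfolding disc_chart_def fst_conv snd_conv rL by simp
    also have "sgn (fst y /\<^sub>R (fst y \<bullet> \<gamma>)) = fst y /\<^sub>R norm (fst y)"
      using y by (simp add: sgn_scaleR) (simp add: sgn_div_norm)
    also have "(fst y /\<^sub>R norm (fst y), snd y /\<^sub>R norm (fst y)) = y /\<^sub>R norm (fst y)"
      by (simp add: prod_eq_iff)
    finally have "sgn (?D (?h y)) = sgn y"
      using fy by (simp add: sgn_scaleR)
    then show "sgn (?D (?h y)) = y"
      using y by (simp add: sgn_div_norm)
  qed
  then show ?thesis
    using homeomorphic_map_maps by blast
qed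

lemma sphere_degree_cong:
  assumes "\<And>u. u \<in> sphere 0 1 \<Longrightarrow> g u = h u"
  shows "sphere_degree g = sphere_degree h"
  unfolding sphere_degree_def
proof (rule Brouwer_degree2_eq)
  fix s assume s: "s \<in> topspace (nsphere (CARD('a) - 1))"
  have "continuous_map (nsphere (CARD('a) - 1)) (top_of_set (sphere 0 1)) (vec_of_seq :: _ \<Rightarrow> real^'a)"
    using homeomorphic_maps_vec_of_seq[where 'n='a] by (simp add: homeomorphic_maps_def)
  then have "(vec_of_seq s :: real^'a) \<in> sphere 0 1"
    using continuous_map_funspace s by fastforce
  then show "seq_of_vec (g (vec_of_seq s)) = seq_of_vec (h (vec_of_seq s))"
    using assms by simp
qed

section \<open>Parity of the local degree\<close>

lemma bounded_bilinear_matrix_vector_mult: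
  "bounded_bilinear ((*v) :: real^'k^'n \<Rightarrow> real^'k \<Rightarrow> real^'n)"
proof -
  have "bilinear ((*v) :: real^'k^'n \<Rightarrow> real^'k \<Rightarrow> real^'n)"
    unfolding bilinear_def
    by (auto intro!: linearI simp: matrix_vector_mult_add_rdistrib matrix_vector_right_distrib
        matrix_vector_mult_scaleR scaleR_matrix_vector_assoc)
  then show ?thesis by (simp add: bilinear_conv_bounded_bilinear)
qed

lemmas continuous_on_matrix_vector_mult [continuous_intros] =
  bounded_bilinear.continuous_on[OF bounded_bilinear_matrix_vector_mult]

lemma tilde_eq: "tilde a (\<gamma>, x) = a x *v \<gamma>"
  by (simp add: tilde_def matrix_mult_sum scalar_mult_eq_scaleR)

text \<open>A kernel vector lists the coefficients of a vanishing combination of distinct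
  independent columns. Independence enters the argument only through this consequence.\<close>

lemma frames_injective:
  fixes A :: "real^'k^'n"
  assumes "A \<in> frames" "A *v \<gamma> = 0"
  shows "\<gamma> = 0"
proof -
  have inj: "inj (\<lambda>i. column i A)" and ind: "independent (columns A)"
    using assms(1) by (auto simp: frames_def)
  have cols: "columns A = range (\<lambda>i. column i A)" by (auto simp: columns_def)
  let ?u = "\<lambda>v. \<gamma> $ inv_into UNIV (\<lambda>i. column i A) v"
  have "(\<Sum>v\<in>columns A. ?u v *\<^sub>R v) = (\<Sum>i\<in>UNIV. \<gamma> $ i *\<^sub>R column i A)"
    unfolding cols by (subst sum.reindex[OF inj]) (simp add: inv_f_f[OF inj])
  also have "\<dots> = 0"
    using assms(2) by (simp add: matrix_mult_sum scalar_mult_eq_scaleR)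
  finally have "?u (column i A) = 0" for i
    using ind by (intro independentD[where s="columns A" and t="columns A" and u="?u"]) (auto simp: cols)
  then show ?thesis by (simp add: vec_eq_iff inv_f_f[OF inj])
qed

text \<open>For \<open>norm \<gamma> = 1\<close> every positive multiple of
  \<open>(\<gamma>, x)\<close> has second component divided by the norm of the first equal to
  \<open>x\<close>. The formula is thus the positively homogeneous extension of
  \<open>A x *v \<gamma>\<close>, and its restriction to the unit sphere has the zeros of the
  original map without the embedding being inverted.\<close>

definition sphere_form :: "(real^'m \<Rightarrow> real^'k^'n) \<Rightarrow> (real^'k) \<times> (real^'m) \<Rightarrow> real^'n" where
  "sphere_form A y = A (snd y /\<^sub>R norm (fst y)) *v fst y"

lemma sphere_form_scale:
  assumes "c > 0"
  shows "sphere_form A (c *\<^sub>R y) = c *\<^sub>R sphere_form A y"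
proof -
  have "snd (c *\<^sub>R y) /\<^sub>R norm (fst (c *\<^sub>R y)) = snd y /\<^sub>R norm (fst y)"
    using assms by simp
  then show ?thesis by (simp only: sphere_form_def fst_scaleR matrix_vector_mult_scaleR)
qed

lemma sphere_form_sgn: "sphere_form A (sgn y) = sphere_form A y /\<^sub>R norm y"
proof (cases "y = 0")
  case True
  then show ?thesis by (simp add: sphere_form_def)
next
  case False
  then show ?thesis by (simp only: sgn_div_norm, intro sphere_form_scale) simp
qed

lemma sphere_form_unit: "norm (fst p) = 1 \<Longrightarrow> sphere_form A p = A (snd p) *v fst p"
  by (simp add: sphere_form_def)

lemma sphere_form_uminus: "sphere_form A (- fst y, snd y) = - sphere_form A y"
  using linear_neg[OF matrix_vector_mul_linear] by (simp add: sphere_form_def)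

lemma continuous_on_sphere_form:
  assumes "continuous_on UNIV A"
  shows "continuous_on {y. fst y \<noteq> 0} (sphere_form A)"
  unfolding sphere_form_def
  by (intro continuous_intros continuous_on_compose2[OF assms]) auto

lemma inj_on_sgn_unit: "inj_on sgn {p :: (real^'k) \<times> (real^'m). norm (fst p) = 1}"
proof (rule inj_onI)
  have rec: "p = sgn p /\<^sub>R norm (fst (sgn p))" if "norm (fst p) = 1" for p :: "(real^'k) \<times> (real^'m)"
  proof -
    have "p \<noteq> 0" using that by auto
    then show ?thesis using that by (simp add: sgn_div_norm)
  qed
  fix p q :: "(real^'k) \<times> (real^'m)"
  assume "p \<in> {p. norm (fst p) = 1}" "q \<in> {p. norm (fst p) = 1}" "sgn p = sgn q"
  then show "p = q" using rec[of p] rec[of q] by simp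
qed

text \<open>Extending \<open>a\<close> to the whole space removes the boundary of the ball from the
  problem. Injectivity outside the open unit ball ensures that the extension has no zeros beyond
  those of \<open>a\<close>, and none on the boundary sphere.\<close>

locale clamped_family =
  fixes a A :: "real^'m \<Rightarrow> real^'k^'n"
  assumes card: "CARD('k) + CARD('m) = CARD('n) + 1" and n2: "CARD('n) \<ge> 2"
    and contA: "continuous_on UNIV A"
    and Aa: "\<And>x. norm x \<le> 1 \<Longrightarrow> A x = a x"
    and outside: "\<And>x \<gamma>. norm x \<ge> 1 \<Longrightarrow> A x *v \<gamma> = 0 \<Longrightarrow> \<gamma> = 0"
begin

lemma dims: "DIM((real^'k) \<times> (real^'m)) = Suc DIM(real^'n)" "DIM(real^'n) \<ge> 2"
  "DIM((real^'k) \<times> (real^'m)) = Suc CARD('n)"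
  using card n2 by auto

lemma tilde_zeros_iff: "p \<in> tilde_zeros a \<longleftrightarrow> norm (fst p) = 1 \<and> norm (snd p) \<le> 1 \<and> sphere_form A p = 0"
  by (cases p) (auto simp: tilde_zeros_def tilde_eq sphere_form_unit Aa)

lemma sphere_form_eq_0_iff:
  assumes "y \<in> sphere 0 1" "fst y \<noteq> 0"
  shows "sphere_form A y = 0 \<longleftrightarrow> y \<in> sgn ` tilde_zeros a"
proof
  assume 0: "sphere_form A y = 0"
  let ?p = "y /\<^sub>R norm (fst y)"
  have p0: "sphere_form A ?p = 0" using 0 assms by (simp add: sphere_form_scale)
  have n1: "norm (fst ?p) = 1" using assms by simp
  have "norm (snd ?p) \<le> 1"
  proof (rule ccontr)
    assume "\<not> norm (snd ?p) \<le> 1"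
    then have "fst ?p = 0"
      using p0 n1 outside[of "snd ?p" "fst ?p"] by (simp add: sphere_form_unit)
    then show False using n1 by simp
  qed
  then have "?p \<in> tilde_zeros a" using p0 n1 tilde_zeros_iff by blast
  moreover have "y = sgn ?p"
    using assms by (simp add: sgn_scaleR) (simp add: sgn_div_norm)
  ultimately show "y \<in> sgn ` tilde_zeros a" by blast
next
  assume "y \<in> sgn ` tilde_zeros a"
  then show "sphere_form A y = 0"
    by (auto simp: tilde_zeros_iff sphere_form_sgn)
qed

lemma sgn_tilde_zeros:
  assumes "p \<in> tilde_zeros a"
  shows "sgn p \<in> sphere 0 1" "fst (sgn p) \<noteq> 0" "sphere_form A (sgn p) = 0" "norm (snd p) < 1"
proof -
  have p: "norm (fst p) = 1" "norm (snd p) \<le> 1" "sphere_form A p = 0"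
    using assms tilde_zeros_iff by auto
  then have "p \<noteq> 0" "fst p \<noteq> 0" by auto
  then show "sgn p \<in> sphere 0 1" "fst (sgn p) \<noteq> 0" "sphere_form A (sgn p) = 0"
    using p by (auto simp: norm_sgn sphere_form_sgn) (simp add: sgn_div_norm)
  show "norm (snd p) < 1"
    using p outside[of "snd p" "fst p"] \<open>fst p \<noteq> 0\<close> by (force simp: sphere_form_unit)
qed

text \<open>The largest available domain in which \<open>sgn p\<close> is the only zero; choosing it
  canonically keeps neighbourhoods out of the statements.\<close>

definition domain_at :: "(real^'k) \<times> (real^'m) \<Rightarrow> ((real^'k) \<times> (real^'m)) set" where
  "domain_at p = {y \<in> sphere 0 1. fst y \<noteq> 0} - (sgn ` tilde_zeros a - {sgn p})"

lemma openin_fst_neq: "openin (top_of_set (sphere 0 1)) {y :: (real^'k) \<times> (real^'m). y \<in> sphere 0 1 \<and> fst y \<noteq> 0}"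
proof -
  have "open {y :: (real^'k) \<times> (real^'m). fst y \<noteq> 0}"
    by (intro open_Collect_neq continuous_intros)
  moreover have "{y :: (real^'k) \<times> (real^'m). y \<in> sphere 0 1 \<and> fst y \<noteq> 0} = sphere 0 1 \<inter> {y. fst y \<noteq> 0}" by auto
  ultimately show ?thesis by (simp add: openin_open_Int)
qed

lemma isolates_zeros_domain_at:
  assumes fin: "finite (tilde_zeros a)" and p: "p \<in> tilde_zeros a"
  shows "isolates_zeros (sphere_form A) (domain_at p) {sgn p}"
  unfolding isolates_zeros_def
proof (intro conjI ballI)
  have "closed (sgn ` tilde_zeros a - {sgn p})" using fin by (intro finite_imp_closed) auto
  then show "openin (top_of_set (sphere 0 1)) (domain_at p)"
    unfolding domain_at_def using openin_Int_open[OF openin_fst_neq open_Compl]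
    by (simp only: Diff_eq)
  show "continuous_on (domain_at p) (sphere_form A)"
    by (rule continuous_on_subset[OF continuous_on_sphere_form[OF contA]]) (auto simp: domain_at_def)
  show "sphere_form A y \<noteq> 0" if "y \<in> domain_at p - {sgn p}" for y
    using that sphere_form_eq_0_iff[of y] by (auto simp: domain_at_def)
qed (use sgn_tilde_zeros[OF p] in \<open>auto simp: domain_at_def\<close>)

text \<open>As \<open>local_degree\<close> is a choice, the parity is established for every value
  that admissible \<open>L\<close> and \<open>r\<close> can produce, and one such value is shown to
  exist. The chart followed by \<open>sgn\<close> parametrises part of the sphere; the positive
  factor introduced by \<open>sgn\<close> cancels when the map is normalised.\<close>

lemma odd_local_degree:
  assumes fin: "finite (tilde_zeros a)" and p: "p \<in> tilde_zeros a"
  shows "odd (local_degree (tilde a) p) \<longleftrightarrow> odd_degree (sphere_form A) (domain_at p) {sgn p}"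
proof -
  obtain \<gamma> x where px: "p = (\<gamma>, x)" by fastforce
  have \<gamma>: "norm \<gamma> = 1" and x: "norm x < 1"
    using p tilde_zeros_iff[of p] sgn_tilde_zeros(4)[OF p] px by auto
  define P where "P d \<longleftrightarrow> (\<exists>L r. oriented_tangent_iso (fst p) L \<and> r > 0 \<and>
        disc_chart p L r ` cball 0 1 \<subseteq> sphere 0 1 \<times> cball 0 1 \<and>
        (\<forall>u\<in>cball 0 1. tilde a (disc_chart p L r u) = 0 \<longrightarrow> u = 0) \<and>
        d = sphere_degree (\<lambda>u::real^'n. tilde a (disc_chart p L r u) /\<^sub>R norm (tilde a (disc_chart p L r u))))" for d
  have parity: "odd d \<longleftrightarrow> odd_degree (sphere_form A) (domain_at p) {sgn p}" if Pd: "P d" for d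
  proof -
    obtain L :: "real^'n \<Rightarrow> (real^'k) \<times> (real^'m)" and r where L: "oriented_tangent_iso \<gamma> L" and r: "r > 0"
      and img: "disc_chart p L r ` cball 0 1 \<subseteq> sphere 0 1 \<times> cball 0 1"
      and only: "\<And>u. u \<in> cball 0 1 \<Longrightarrow> tilde a (disc_chart p L r u) = 0 \<Longrightarrow> u = 0"
      and d: "d = sphere_degree (\<lambda>u::real^'n. tilde a (disc_chart p L r u) /\<^sub>R norm (tilde a (disc_chart p L r u)))"
      using Pd unfolding P_def px fst_conv by blast
    let ?D = "disc_chart p L r"
    let ?g = "\<lambda>u. sgn (?D u)"
    let ?W = "{y :: (real^'k) \<times> (real^'m). y \<in> sphere 0 1 \<and> fst y \<bullet> \<gamma> > 0}"
    note LD = oriented_tangent_isoD[OF card \<gamma> L]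
    have g: "homeomorphic_map euclidean (top_of_set ?W) ?g"
      unfolding px by (rule homeomorphic_map_sgn_disc_chart[OF card \<gamma> L r])
    have "open {y :: (real^'k) \<times> (real^'m). fst y \<bullet> \<gamma> > 0}"
      by (intro open_Collect_less continuous_intros)
    moreover have "?W = sphere 0 1 \<inter> {y. fst y \<bullet> \<gamma> > 0}" by auto
    ultimately have W: "openin (top_of_set (sphere 0 1)) ?W" by (simp add: openin_open_Int)
    have D0: "?D 0 = p"
      using \<gamma> by (simp add: px disc_chart_def linear_0[OF LD(1)] sgn_div_norm)
    have D1: "norm (fst (?D u)) = 1" for u
      unfolding px by (rule continuous_on_disc_chart(2)[OF LD(1,2) \<gamma>])
    have form: "sphere_form A (?D u) = tilde a (?D u)" if "u \<in> cball 0 1" for u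
    proof -
      have "?D u \<in> sphere 0 1 \<times> cball 0 1" using img that by blast
      then have "norm (snd (?D u)) \<le> 1" by (simp add: mem_Times_iff)
      then show ?thesis
        using D1[of u] by (simp add: sphere_form_unit Aa) (metis prod.collapse tilde_eq)
    qed
    have Dne: "?D u \<noteq> 0" for u using D1[of u] by auto
    have "?g u \<in> domain_at p" if u: "u \<in> cball 0 1" for u
    proof -
      have s: "?g u \<in> sphere 0 1" "fst (?g u) \<noteq> 0"
        using D1[of u] Dne[of u] by (auto simp: norm_sgn) (auto simp: sgn_div_norm)
      moreover have "?g u = sgn p" if "?g u \<in> sgn ` tilde_zeros a"
      proof -
        have "sphere_form A (?g u) = 0" using that s sphere_form_eq_0_iff by blast
        then have "tilde a (?D u) = 0"
          using form[OF u] Dne[of u] by (simp add: sphere_form_sgn)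
        then show ?thesis using only[OF u] D0 by simp
      qed
      ultimately show ?thesis by (auto simp: domain_at_def)
    qed
    then have gV: "?g ` cball 0 1 \<subseteq> domain_at p" by blast
    have iz: "isolates_zeros (sphere_form A) (domain_at p) {?g 0}"
      using isolates_zeros_domain_at[OF fin p] D0 by simp
    have "odd_degree (sphere_form A) (domain_at p) {sgn p} \<longleftrightarrow>
        odd (sphere_degree (\<lambda>u. sphere_form A (?g u) /\<^sub>R norm (sphere_form A (?g u))))"
      using odd_degree_at_point[OF dims(3) n2 iz W g gV] D0 by simp
    also have "sphere_degree (\<lambda>u. sphere_form A (?g u) /\<^sub>R norm (sphere_form A (?g u))) = d"
      unfolding d
    proof (rule sphere_degree_cong)
      fix u :: "real^'n" assume "u \<in> sphere 0 1"
      then have "sphere_form A (?g u) = tilde a (?D u) /\<^sub>R norm (?D u)"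
        using form[of u] by (simp add: sphere_form_sgn)
      then show "sphere_form A (?g u) /\<^sub>R norm (sphere_form A (?g u)) = tilde a (?D u) /\<^sub>R norm (tilde a (?D u))"
        using Dne[of u] by simp
    qed
    finally show ?thesis by simp
  qed
  have "\<exists>d. P d"
  proof -
    obtain L :: "real^'n \<Rightarrow> (real^'k) \<times> (real^'m)" where L: "oriented_tangent_iso \<gamma> L"
      using ex_oriented_tangent_iso[OF card \<gamma>] by blast
    note LD = oriented_tangent_isoD[OF card \<gamma> L]
    let ?F = "disc_chart p L 1"
    have F0: "?F 0 = p"
      using \<gamma> by (simp add: px disc_chart_def linear_0[OF LD(1)] sgn_div_norm)
    have F1: "norm (fst (?F u)) = 1" for u
      unfolding px by (rule continuous_on_disc_chart(2)[OF LD(1,2) \<gamma>])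
    have "isCont ?F 0"
      using continuous_on_disc_chart(1)[OF LD(1,2) \<gamma>, of UNIV x 1]
      by (simp add: px continuous_on_eq_continuous_at)
    moreover have "open ({q. norm (snd q) < 1} - (tilde_zeros a - {p}))"
      using fin by (intro open_Diff finite_imp_closed open_Collect_less continuous_intros) auto
    moreover have "p \<in> {q. norm (snd q) < 1} - (tilde_zeros a - {p})" using x px by simp
    ultimately have "\<forall>\<^sub>F u in at 0. ?F u \<in> {q. norm (snd q) < 1} - (tilde_zeros a - {p})"
      unfolding isCont_def F0 by (rule topological_tendstoD)
    then obtain e where e0: "e > 0"
      and e1: "\<And>u. u \<noteq> 0 \<Longrightarrow> norm u < e \<Longrightarrow> ?F u \<in> {q. norm (snd q) < 1} - (tilde_zeros a - {p})"
      unfolding eventually_at by auto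
    have e2: "?F u \<in> {q. norm (snd q) < 1} - (tilde_zeros a - {p})" if "norm u < e" for u
      using e1[of u] that F0 px x by (cases "u = 0") auto
    note e = e0 e2
    \<comment> \<open>Half of \<open>e\<close> makes the closed unit ball of parameters land
      strictly inside the region controlled by \<open>e\<close>.\<close>
    let ?r = "e / 2"
    let ?D = "disc_chart p L ?r"
    have DF: "?D u = ?F (?r *\<^sub>R u)" for u by (rule disc_chart_scale[OF LD(1)])
    have small: "norm (?r *\<^sub>R u) < e" if "u \<in> cball 0 1" for u :: "real^'n"
    proof -
      have "norm (?r *\<^sub>R u) \<le> ?r" using that e(1) by (simp add: mult_left_le)
      then show ?thesis using e(1) by linarith
    qed
    have img: "?D u \<in> sphere 0 1 \<times> cball 0 1" if "u \<in> cball 0 1" for u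
      using e(2)[OF small[OF that]] F1[of "?r *\<^sub>R u"] unfolding DF by (simp add: mem_Times_iff)
    have only: "u = 0" if u: "u \<in> cball 0 1" "tilde a (?D u) = 0" for u
    proof -
      have "?D u \<in> tilde_zeros a" using u img by (simp add: tilde_zeros_def)
      then have "?D u = p" using e(2)[OF small[OF u(1)]] unfolding DF by blast
      then have "sgn (?D u) = sgn (?D 0)"
        unfolding DF by (simp add: F0)
      \<comment> \<open>Injectivity of the whole chart turns uniqueness of the zero \<open>p\<close>
        into uniqueness of its parameter.\<close>
      moreover have "inj (\<lambda>u. sgn (?D u))"
        using homeomorphic_map_sgn_disc_chart[OF card \<gamma> L, of ?r x] e(1) px
        by (auto simp: homeomorphic_eq_everything_map)
      ultimately show ?thesis by (metis injD)
    qed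
    have "?D ` cball 0 1 \<subseteq> sphere 0 1 \<times> cball 0 1" using img by blast
    moreover have "oriented_tangent_iso (fst p) L" using L px by simp
    moreover have "?r > 0" using e(1) by simp
    ultimately show ?thesis
      unfolding P_def using only by blast
  qed
  then have "P (local_degree (tilde a) p)"
    unfolding local_degree_def P_def[symmetric] by (rule someI_ex)
  then show ?thesis by (rule parity)
qed

end

section \<open>Degree modulo 2 over a half space\<close>

definition hemisphere :: "real^'k \<Rightarrow> ((real^'k) \<times> (real^'m)) set" where
  "hemisphere e = {y \<in> sphere 0 1. fst y \<bullet> e > 0}"

definition hemisphere_parity :: "real^'k \<Rightarrow> (real^'m \<Rightarrow> real^'k^'n) \<Rightarrow> bool" where
  "hemisphere_parity e A = odd_degree (sphere_form A) (hemisphere e) {y \<in> hemisphere e. sphere_form A y = 0}"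

lemma openin_hemisphere: "openin (top_of_set (sphere 0 1)) (hemisphere e :: ((real^'k) \<times> (real^'m)) set)"
proof -
  have "open {y :: (real^'k) \<times> (real^'m). fst y \<bullet> e > 0}"
    by (intro open_Collect_less continuous_intros)
  moreover have "hemisphere e = sphere 0 1 \<inter> {y. fst y \<bullet> e > 0}" by (auto simp: hemisphere_def)
  ultimately show ?thesis by (metis openin_open_Int)
qed

text \<open>The set is the projection along the compact interval of a closed subset of a compact
  set. The half space is taken closed here; that no zero lies on its boundary is a separate matter,
  and the two facts together give an isolating set for the whole family.\<close>

lemma compact_family_zeros:
  fixes F :: "real \<times> (real^'m) \<Rightarrow> real^'k^'n"
  assumes F: "continuous_on ({0..1} \<times> UNIV) F"
  shows "compact {y \<in> sphere 0 1. 0 \<le> fst y \<bullet> e \<and> norm (snd y) \<le> norm (fst y) \<and>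
           (\<exists>t\<in>{0..1}. sphere_form (\<lambda>x. F (t, x)) y = 0)}" (is "compact ?K")
proof -
  let ?C = "sphere 0 1 \<inter> ({y :: (real^'k) \<times> (real^'m). 0 \<le> fst y \<bullet> e} \<inter> {y. norm (snd y) \<le> norm (fst y)})"
  let ?g = "\<lambda>(t, y). sphere_form (\<lambda>x. F (t, x)) y"
  have "compact ?C"
    by (intro compact_Int_closed closed_Int closed_Collect_le continuous_intros) auto
  then have cC: "compact ({0..1::real} \<times> ?C)"
    by (intro compact_Times) auto
  \<comment> \<open>If \<open>fst y\<close> vanished, the inequality between the norms would force
    \<open>y = 0\<close>, which is not on the sphere.\<close>
  have nz: "fst y \<noteq> 0" if "y \<in> ?C" for y
    using that by (cases y) auto
  have "continuous_on ({0..1} \<times> ?C) ?g"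
    unfolding sphere_form_def case_prod_unfold
    by (intro continuous_intros continuous_on_compose2[OF F]) (use nz in force)+
  then have "closed (({0..1} \<times> ?C) \<inter> ?g -` {0})"
    using cC by (intro continuous_closed_preimage compact_imp_closed) auto
  from compact_Int_closed[OF cC this] have "compact (({0..1} \<times> ?C) \<inter> ?g -` {0})"
    by (simp only: Int_left_absorb)
  then have "compact (snd ` (({0..1} \<times> ?C) \<inter> ?g -` {0}))"
    by (intro compact_continuous_image continuous_intros)
  also have "snd ` (({0..1} \<times> ?C) \<inter> ?g -` {0}) = ?K"
  proof (intro equalityI subsetI)
    fix y assume "y \<in> ?K"
    then obtain t where "t \<in> {0..1}" "sphere_form (\<lambda>x. F (t, x)) y = 0" "y \<in> ?C" by auto
    then show "y \<in> snd ` (({0..1} \<times> ?C) \<inter> ?g -` {0})"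
      by (intro image_eqI[of _ _ "(t, y)"]) auto
  qed auto
  finally show ?thesis .
qed

text \<open>One predicate for the two ways a zero could leave the open half space over the open
  ball: through the boundary of the ball, or through the hyperplane orthogonal to
  \<open>e\<close>.\<close>

definition nonsingular_along :: "real^'k \<Rightarrow> (real^'m \<Rightarrow> real^'k^'n) \<Rightarrow> bool" where
  "nonsingular_along e A \<longleftrightarrow> (\<forall>x \<gamma>. A x *v \<gamma> = 0 \<longrightarrow> norm x \<ge> 1 \<or> \<gamma> \<bullet> e = 0 \<longrightarrow> \<gamma> = 0)"

lemma family_zeros:
  assumes "nonsingular_along e A" "y \<in> sphere 0 1" "sphere_form A y = 0" "fst y \<noteq> 0"
  shows "norm (snd y) \<le> norm (fst y)" "fst y \<bullet> e \<noteq> 0"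
proof -
  have *: "A (snd y /\<^sub>R norm (fst y)) *v fst y = 0" using assms by (simp add: sphere_form_def)
  then have "\<not> norm (snd y /\<^sub>R norm (fst y)) \<ge> 1"
    using assms unfolding nonsingular_along_def by blast
  then show "norm (snd y) \<le> norm (fst y)"
    using assms(4) by (simp add: field_simps)
  show "fst y \<bullet> e \<noteq> 0"
    using * assms unfolding nonsingular_along_def by blast
qed

text \<open>The zeros of all stages together form a compact set inside the open hemisphere, since no
  stage has a zero on the bounding hyperplane. This set isolates the zeros of every stage
  simultaneously.\<close>

lemma hemisphere_parity_homotopy:
  fixes F :: "real \<times> (real^'m) \<Rightarrow> real^'k^'n"
  assumes card: "CARD('k) + CARD('m) = CARD('n) + 1" "CARD('n) \<ge> 2"
    and F: "continuous_on ({0..1} \<times> UNIV) F"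
    and ns: "\<And>t. t \<in> {0..1} \<Longrightarrow> nonsingular_along e (\<lambda>x. F (t, x))"
  shows "hemisphere_parity e (\<lambda>x. F (0, x)) = hemisphere_parity e (\<lambda>x. F (1, x))"
    and "isolates_zeros (sphere_form (\<lambda>x. F (0, x))) (hemisphere e) {y \<in> hemisphere e. sphere_form (\<lambda>x. F (0, x)) y = 0}"
proof -
  have dims: "DIM((real^'k) \<times> (real^'m)) = Suc DIM(real^'n)" "DIM(real^'n) \<ge> 2"
    using card by auto
  define K where "K = {y :: (real^'k) \<times> (real^'m). y \<in> sphere 0 1 \<and> 0 \<le> fst y \<bullet> e \<and> norm (snd y) \<le> norm (fst y) \<and>
           (\<exists>t\<in>{0..1}. sphere_form (\<lambda>x. F (t, x)) y = 0)}"
  let ?U = "hemisphere e :: ((real^'k) \<times> (real^'m)) set"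
  let ?Z = "\<lambda>t. {y \<in> ?U. sphere_form (\<lambda>x. F (t, x)) y = 0}"
  have clK: "closed K" unfolding K_def using compact_family_zeros[OF F] by (rule compact_imp_closed)
  have KU: "K \<subseteq> ?U"
  proof
    fix y assume "y \<in> K"
    then obtain t where y: "y \<in> sphere 0 1" "0 \<le> fst y \<bullet> e" "norm (snd y) \<le> norm (fst y)"
      and t: "t \<in> {0..1}" "sphere_form (\<lambda>x. F (t, x)) y = 0" by (auto simp: K_def)
    have "fst y \<noteq> 0" using y by (cases y) auto
    then have "fst y \<bullet> e \<noteq> 0" using family_zeros(2)[OF ns[OF t(1)] y(1) t(2)] by blast
    then show "y \<in> ?U" using y by (simp add: hemisphere_def)
  qed
  have U0: "fst y \<noteq> 0" if "y \<in> ?U" for y using that by (auto simp: hemisphere_def)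
  have inK: "y \<in> K" if "y \<in> ?U" "t \<in> {0..1}" "sphere_form (\<lambda>x. F (t, x)) y = 0" for t y
    using that family_zeros(1)[OF ns[OF that(2)], of y] U0[of y] by (auto simp: K_def hemisphere_def)
  have Ft: "continuous_on UNIV (\<lambda>x. F (t, x))" if "t \<in> {0..1}" for t
    by (intro continuous_intros continuous_on_compose2[OF F]) (use that in auto)
  have cont: "continuous_on ?U (sphere_form (\<lambda>x. F (t, x)))" if "t \<in> {0..1}" for t
    by (rule continuous_on_subset[OF continuous_on_sphere_form[OF Ft[OF that]]]) (use U0 in auto)
  have izK: "isolates_zeros (sphere_form (\<lambda>x. F (t, x))) ?U K" if "t \<in> {0..1}" for t
    unfolding isolates_zeros_def using openin_hemisphere clK KU cont[OF that] inK[OF _ that] by blast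
  have izZ: "isolates_zeros (sphere_form (\<lambda>x. F (t, x))) ?U (?Z t)" if t: "t \<in> {0..1}" for t
  proof -
    have "closed (?Z t)"
    proof -
      have "?Z t = K \<inter> (sphere_form (\<lambda>x. F (t, x))) -` {0}"
        using inK[OF _ t] KU by auto
      moreover have "closed (K \<inter> (sphere_form (\<lambda>x. F (t, x))) -` {0})"
        using clK cont[OF t] KU by (intro continuous_closed_preimage) (auto intro: continuous_on_subset)
      ultimately show ?thesis by simp
    qed
    then show ?thesis
      unfolding isolates_zeros_def using openin_hemisphere cont[OF t] by blast
  qed
  have eqK: "hemisphere_parity e (\<lambda>x. F (t, x)) = odd_degree (sphere_form (\<lambda>x. F (t, x))) ?U K" if t: "t \<in> {0..1}" for t
    unfolding hemisphere_parity_def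
    by (rule odd_degree_subset[OF dims izK[OF t] izZ[OF t]]) (use inK[OF _ t] in auto)
  show "isolates_zeros (sphere_form (\<lambda>x. F (0, x))) ?U (?Z 0)" by (rule izZ) simp
  have "odd_degree (\<lambda>y. (\<lambda>(t, y). sphere_form (\<lambda>x. F (t, x)) y) (0, y)) ?U K =
        odd_degree (\<lambda>y. (\<lambda>(t, y). sphere_form (\<lambda>x. F (t, x)) y) (1, y)) ?U K"
  proof (rule odd_degree_homotopy)
    show "continuous_on ({0..1} \<times> ?U) (\<lambda>(t, y). sphere_form (\<lambda>x. F (t, x)) y)"
      unfolding sphere_form_def case_prod_unfold
      by (intro continuous_intros continuous_on_compose2[OF F]) (use U0 in force)+
    show "(case (t, y) of (t, y) \<Rightarrow> sphere_form (\<lambda>x. F (t, x)) y) \<noteq> 0" if "t \<in> {0..1}" "y \<in> ?U - K" for t y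
      using that inK[of y t] by auto
  qed
  then show "hemisphere_parity e (\<lambda>x. F (0, x)) = hemisphere_parity e (\<lambda>x. F (1, x))"
    using eqK[of 0] eqK[of 1] by simp
qed

text \<open>The constant homotopy specialises the compactness argument made for families.\<close>

lemma isolates_zeros_hemisphere:
  fixes A :: "real^'m \<Rightarrow> real^'k^'n"
  assumes card: "CARD('k) + CARD('m) = CARD('n) + 1" "CARD('n) \<ge> 2"
    and A: "continuous_on UNIV A" and ns: "nonsingular_along e A"
  shows "isolates_zeros (sphere_form A) (hemisphere e) {y \<in> hemisphere e. sphere_form A y = 0}"
proof -
  have "continuous_on ({0..1::real} \<times> UNIV) (\<lambda>(t, x). A x)"
    unfolding case_prod_unfold by (intro continuous_on_compose2[OF A] continuous_intros) auto
  from hemisphere_parity_homotopy(2)[OF card this, of e] ns show ?thesis by simp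
qed

section \<open>The antipodal map in the first factor and independence of the half space\<close>

definition flip :: "(real^'k) \<times> (real^'m) \<Rightarrow> (real^'k) \<times> (real^'m)" where
  "flip y = (- fst y, snd y)"

lemma norm_flip [simp]: "norm (flip y) = norm y"
  by (cases y) (simp add: flip_def norm_Pair)

lemma sphere_form_flip: "sphere_form A (flip y) = - sphere_form A y"
  by (simp add: flip_def sphere_form_uminus)

lemma fst_flip [simp]: "fst (flip y) = - fst y" and snd_flip [simp]: "snd (flip y) = snd y"
  by (simp_all add: flip_def)

lemma flip_flip [simp]: "flip (flip y) = y"
  by (simp add: prod_eq_iff)

lemma continuous_on_flip: "continuous_on S flip"
  unfolding flip_def by (intro continuous_intros)

lemma image_flip: "flip ` S = {y. flip y \<in> S}"
  by (force simp: image_iff)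

lemma sgn_flip: "sgn (flip y) = flip (sgn y)"
  by (simp add: sgn_div_norm prod_eq_iff)

lemma odd_degree_flip:
  fixes A :: "real^'m \<Rightarrow> real^'k^'n"
  assumes card: "CARD('k) + CARD('m) = CARD('n) + 1" "CARD('n) \<ge> 2"
    and iz: "isolates_zeros (sphere_form A) U K"
  shows "odd_degree (sphere_form A) (flip ` U) (flip ` K) = odd_degree (sphere_form A) U K"
    "isolates_zeros (sphere_form A) (flip ` U) (flip ` K)"
proof -
  have dims: "DIM((real^'k) \<times> (real^'m)) = Suc DIM(real^'n)" "DIM(real^'n) \<ge> 2"
    using card by auto
  have "flip ` sphere 0 1 \<subseteq> (sphere 0 1 :: ((real^'k) \<times> (real^'m)) set)"
    by (auto simp: image_iff)
  note * = odd_degree_antisymmetric[OF dims iz continuous_on_flip this]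
  show "odd_degree (sphere_form A) (flip ` U) (flip ` K) = odd_degree (sphere_form A) U K"
    "isolates_zeros (sphere_form A) (flip ` U) (flip ` K)"
    by (rule *; simp add: sphere_form_flip)+
qed

lemma hemisphere_parity_independent:
  fixes A :: "real^'m \<Rightarrow> real^'k^'n"
  assumes card: "CARD('k) + CARD('m) = CARD('n) + 1" "CARD('n) \<ge> 2"
    and A: "continuous_on UNIV A" and ns: "nonsingular_along e A" "nonsingular_along e' A"
  shows "hemisphere_parity e A = hemisphere_parity e' A"
proof -
  have dims: "DIM((real^'k) \<times> (real^'m)) = Suc DIM(real^'n)" "DIM(real^'n) \<ge> 2"
    using card by auto
  let ?f = "sphere_form A"
  let ?Z = "\<lambda>U. {y \<in> U. ?f y = 0}"
  let ?U = "\<lambda>d d'. hemisphere d \<inter> hemisphere d' :: ((real^'k) \<times> (real^'m)) set"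
  have neg: "nonsingular_along (- d) A" if "nonsingular_along d A" for d
    using that by (simp add: nonsingular_along_def)
  have iz: "isolates_zeros ?f (?U d d') (?Z (?U d d'))"
    if d: "nonsingular_along d A" "nonsingular_along d' A" for d d'
  proof -
    note 1 = isolates_zerosD[OF isolates_zeros_hemisphere[OF card A d(1)]]
    note 2 = isolates_zerosD[OF isolates_zeros_hemisphere[OF card A d(2)]]
    have "?Z (?U d d') = ?Z (hemisphere d) \<inter> ?Z (hemisphere d')" by auto
    then have "closed (?Z (?U d d'))" using 1(2) 2(2) by (simp only: closed_Int)
    then show ?thesis
      using 1 2 by (auto simp: isolates_zeros_def intro: continuous_on_subset)
  qed
  have split: "hemisphere_parity d A \<longleftrightarrow>
      (odd_degree ?f (?U d d') (?Z (?U d d')) \<noteq> odd_degree ?f (?U d (- d')) (?Z (?U d (- d'))))"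
    if d: "nonsingular_along d A" "nonsingular_along d' A" for d d'
  proof -
    have disj: "?U d d' \<inter> ?U d (- d') = {}" by (auto simp: hemisphere_def)
    let ?V = "?U d d' \<union> ?U d (- d')" and ?L = "?Z (?U d d') \<union> ?Z (?U d (- d'))"
    \<comment> \<open>The two lunes miss the part of the hemisphere orthogonal to \<open>d'\<close>,
      but nonsingularity along \<open>d'\<close> forbids zeros there.\<close>
    have cover: "y \<in> ?V" if "y \<in> hemisphere d" "?f y = 0" for y
    proof -
      have "fst y \<noteq> 0" "y \<in> sphere 0 1" using that by (auto simp: hemisphere_def)
      then have "fst y \<bullet> d' \<noteq> 0" using family_zeros(2)[OF d(2)] that by blast
      then show ?thesis using that by (auto simp: hemisphere_def)
    qed
    have izd: "isolates_zeros ?f (hemisphere d) (?Z (hemisphere d))"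
      by (rule isolates_zeros_hemisphere[OF card A d(1)])
    have izV: "isolates_zeros ?f ?V ?L"
      using isolates_zerosD[OF iz[OF d]] isolates_zerosD[OF iz[OF d(1) neg[OF d(2)]]] isolates_zerosD[OF izd]
      by (auto simp: isolates_zeros_def openin_Un intro: continuous_on_subset)
    have "hemisphere_parity d A = odd_degree ?f ?V ?L"
      unfolding hemisphere_parity_def
      by (rule odd_degree_subset[OF dims izd izV, symmetric]) (use cover in auto)
    also have "\<dots> \<longleftrightarrow> (odd_degree ?f (?U d d') (?Z (?U d d')) \<noteq> odd_degree ?f (?U d (- d')) (?Z (?U d (- d'))))"
      by (rule odd_degree_Un[OF dims iz[OF d] iz[OF d(1) neg[OF d(2)]] disj])
    finally show ?thesis .
  qed
  have "flip ` ?U e (- e') = ?U e' (- e)"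
    unfolding image_flip by (auto simp: hemisphere_def)
  moreover have "flip ` ?Z (?U e (- e')) = ?Z (?U e' (- e))"
    unfolding image_flip by (auto simp: hemisphere_def sphere_form_flip)
  ultimately have "odd_degree ?f (?U e' (- e)) (?Z (?U e' (- e))) = odd_degree ?f (?U e (- e')) (?Z (?U e (- e')))"
    using odd_degree_flip(1)[OF card iz[OF ns(1) neg[OF ns(2)]]] by simp
  then show ?thesis
    using split[OF ns] split[OF ns(2,1)] by (simp add: Int_commute)
qed

context clamped_family
begin

lemma flip_tilde_zeros: "flip p \<in> tilde_zeros a \<longleftrightarrow> p \<in> tilde_zeros a"
  by (simp add: tilde_zeros_iff sphere_form_flip)

lemma odd_local_degree_flip:
  assumes fin: "finite (tilde_zeros a)" and p: "p \<in> tilde_zeros a"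
  shows "odd (local_degree (tilde a) (flip p)) \<longleftrightarrow> odd (local_degree (tilde a) p)"
proof -
  have mem: "flip y \<in> sgn ` tilde_zeros a \<longleftrightarrow> y \<in> sgn ` tilde_zeros a" for y
    by (metis (no_types, lifting) flip_flip flip_tilde_zeros image_iff sgn_flip)
  have eq: "flip y = sgn p \<longleftrightarrow> y = flip (sgn p)" for y
    by (metis flip_flip)
  have "flip ` domain_at p = domain_at (flip p)"
    unfolding image_flip domain_at_def sgn_flip by (auto simp: mem eq)
  moreover have "flip ` {sgn p} = {sgn (flip p)}" by (simp add: sgn_flip)
  ultimately show ?thesis
    using odd_degree_flip(1)[OF card n2 isolates_zeros_domain_at[OF fin p]]
      odd_local_degree[OF fin p] odd_local_degree[OF fin] flip_tilde_zeros p by metis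
qed

text \<open>The zeros in the open half space form one particular half \<open>P\<close>, and the
  degree over the half space counts its members of odd local degree. Any other half arises by
  flipping some members of \<open>P\<close>, which preserves the parity of their local
  degrees.\<close>

lemma odd_sum_local_degrees:
  assumes fin: "finite (tilde_zeros a)" and ns: "nonsingular_along e A" and half: "half_of_zeros a Z"
  shows "odd (\<Sum>p\<in>Z. local_degree (tilde a) p) \<longleftrightarrow> hemisphere_parity e A"
proof -
  let ?f = "sphere_form A"
  let ?H = "hemisphere e :: ((real^'k) \<times> (real^'m)) set"
  define K where "K = {y \<in> ?H. ?f y = 0}"
  let ?odd = "\<lambda>p. odd (local_degree (tilde a) p)"
  define P where "P = {p \<in> tilde_zeros a. fst p \<bullet> e > 0}"
  have fe: "fst p \<bullet> e \<noteq> 0" if "p \<in> tilde_zeros a" for p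
  proof
    assume "fst p \<bullet> e = 0"
    moreover have "A (snd p) *v fst p = 0" "norm (fst p) = 1"
      using that by (auto simp: tilde_zeros_iff sphere_form_unit)
    ultimately have "fst p = 0" using ns unfolding nonsingular_along_def by blast
    then show False using \<open>norm (fst p) = 1\<close> by simp
  qed
  have pos: "fst (sgn p) \<bullet> e > 0 \<longleftrightarrow> fst p \<bullet> e > 0" if "p \<in> tilde_zeros a" for p
  proof -
    have "p \<noteq> 0" using that by (auto simp: tilde_zeros_iff)
    then show ?thesis by (simp add: sgn_div_norm zero_less_mult_iff)
  qed
  have H0: "fst y \<noteq> 0" "y \<in> sphere 0 1" if "y \<in> ?H" for y using that by (auto simp: hemisphere_def)
  have KP: "K = sgn ` P"
  proof (intro equalityI subsetI)
    fix y assume y: "y \<in> K"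
    then have "y \<in> sgn ` tilde_zeros a" using sphere_form_eq_0_iff[of y] H0 unfolding K_def by blast
    then obtain p where p: "p \<in> tilde_zeros a" "y = sgn p" by blast
    then have "p \<in> P" using y pos[of p] by (simp add: P_def K_def hemisphere_def)
    then show "y \<in> sgn ` P" using p by blast
  next
    fix y assume "y \<in> sgn ` P"
    then show "y \<in> K" using sgn_tilde_zeros pos by (auto simp: P_def K_def hemisphere_def)
  qed
  have finP: "finite P" using fin by (simp add: P_def)
  note izH = isolates_zeros_hemisphere[OF card n2 contA ns, folded K_def]
  have at: "odd_degree ?f (?H - (K - {sgn p})) {sgn p} \<longleftrightarrow> ?odd p" if p: "p \<in> P" for p
  proof -
    have pt: "p \<in> tilde_zeros a" using p by (simp add: P_def)
    have pK: "sgn p \<in> K" "sgn p \<in> ?H" using p KP unfolding K_def by blast+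
    have sub: "?H - (K - {sgn p}) \<subseteq> domain_at p"
      unfolding domain_at_def K_def using H0 sgn_tilde_zeros(3) by blast
    have "closed (K - {sgn p})" using KP finP by (intro finite_imp_closed) auto
    then have "openin (top_of_set (sphere 0 1)) (?H - (K - {sgn p}))"
      using openin_Int_open[OF openin_hemisphere open_Compl] by (simp only: Diff_eq)
    then have "isolates_zeros ?f (?H - (K - {sgn p})) {sgn p}"
      using pK sub isolates_zerosD[OF isolates_zeros_domain_at[OF fin pt]]
      unfolding isolates_zeros_def by (blast intro: continuous_on_subset)
    from odd_degree_subset[OF dims(1,2) isolates_zeros_domain_at[OF fin pt] this sub]
    show ?thesis
      using odd_local_degree[OF fin pt] isolates_zerosD(6)[OF isolates_zeros_domain_at[OF fin pt]] by blast
  qed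
  have injP: "inj_on sgn P"
    by (rule inj_on_subset[OF inj_on_sgn_unit]) (auto simp: P_def tilde_zeros_iff)
  have "hemisphere_parity e A \<longleftrightarrow> odd (card {q \<in> K. odd_degree ?f (?H - (K - {q})) {q}})"
    unfolding hemisphere_parity_def K_def[symmetric]
    by (rule odd_degree_finite[OF dims(1,2) _ izH]) (use KP finP in simp)
  also have "{q \<in> K. odd_degree ?f (?H - (K - {q})) {q}} = sgn ` {p \<in> P. ?odd p}"
  proof (intro equalityI subsetI)
    fix q assume "q \<in> {q \<in> K. odd_degree ?f (?H - (K - {q})) {q}}"
    then have q: "q \<in> K" "odd_degree ?f (?H - (K - {q})) {q}" by auto
    from q(1) obtain p where p: "p \<in> P" "q = sgn p" unfolding KP by blast
    then have "?odd p" using at q(2) by simp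
    then show "q \<in> sgn ` {p \<in> P. ?odd p}" using p by blast
  next
    fix q assume "q \<in> sgn ` {p \<in> P. ?odd p}"
    then obtain p where p: "p \<in> P" "?odd p" "q = sgn p" by blast
    then have "q \<in> K" unfolding KP by blast
    then show "q \<in> {q \<in> K. odd_degree ?f (?H - (K - {q})) {q}}" using p at by simp
  qed
  also have "card (sgn ` {p \<in> P. ?odd p}) = card {p \<in> P. ?odd p}"
    by (rule card_image) (rule inj_on_subset[OF injP], auto)
  also have "card {p \<in> P. ?odd p} = card {p \<in> Z. ?odd p}"
  proof (rule bij_betw_same_card)
    have Zflip: "p \<in> Z \<longleftrightarrow> flip p \<notin> Z" if "p \<in> tilde_zeros a" for p
    proof (cases p)
      case (Pair \<gamma> x)
      then show ?thesis using half that by (auto simp: half_of_zeros_def flip_def)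
    qed
    have Zt: "Z \<subseteq> tilde_zeros a" using half by (simp add: half_of_zeros_def)
    \<comment> \<open>Each pair of opposite zeros meets \<open>P\<close> once and \<open>Z\<close>
      once; \<open>?s\<close> and \<open>?t\<close> select the representative in \<open>Z\<close>
      and in \<open>P\<close>.\<close>
    let ?s = "\<lambda>p. if p \<in> Z then p else flip p" and ?t = "\<lambda>p. if fst p \<bullet> e > 0 then p else flip p"
    show "bij_betw ?s {p \<in> P. ?odd p} {p \<in> Z. ?odd p}"
    proof (rule bij_betw_byWitness[where f' = ?t])
      show "\<forall>p\<in>{p \<in> P. ?odd p}. ?t (?s p) = p"
        by (auto simp: P_def)
      show "\<forall>p\<in>{p \<in> Z. ?odd p}. ?s (?t p) = p"
        using Zflip Zt by auto
      show "?s ` {p \<in> P. ?odd p} \<subseteq> {p \<in> Z. ?odd p}"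
        using Zflip odd_local_degree_flip[OF fin] by (auto simp: P_def)
      show "?t ` {p \<in> Z. ?odd p} \<subseteq> {p \<in> P. ?odd p}"
      proof
        fix q assume "q \<in> ?t ` {p \<in> Z. ?odd p}"
        then obtain p where p: "p \<in> Z" "?odd p" "q = ?t p" by blast
        then have pt: "p \<in> tilde_zeros a" using Zt by blast
        show "q \<in> {p \<in> P. ?odd p}"
          using p pt fe[OF pt] flip_tilde_zeros[of p] odd_local_degree_flip[OF fin pt]
          by (auto simp: P_def)
      qed
    qed
  qed
  also have "odd (card {p \<in> Z. ?odd p}) \<longleftrightarrow> odd (\<Sum>p\<in>Z. local_degree (tilde a) p)"
  proof -
    have "finite Z" using half fin by (auto simp: half_of_zeros_def intro: finite_subset)
    then show ?thesis by (simp add: even_sum_iff)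
  qed
  finally show ?thesis by blast
qed

end

section \<open>General position\<close>

text \<open>The ambient space of \<open>W\<close> may be larger than the target. Reparametrising
  \<open>W\<close> by a proper subspace of the target itself reduces the claim to images of
  negligible sets between spaces of equal dimension.\<close>

lemma negligible_differentiable_image_subspace:
  fixes f :: "'a::euclidean_space \<Rightarrow> 'b::euclidean_space"
  assumes W: "subspace W" "dim W < DIM('b)" and f: "f differentiable_on W"
  shows "negligible (f ` W)"
proof -
  obtain T :: "'b set" where T: "subspace T" "dim T = dim W"
    using choose_subspace_of_subspace[of "dim W" "UNIV :: 'b set"] W(2) by (auto simp: dim_UNIV)
  obtain h where h: "linear h" "h ` T = W"
    using subspace_isomorphism[OF T(1) W(1) T(2)] by blast
  have "negligible T" using T(2) W(2) by (intro negligible_lowdim) simp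
  moreover have "(\<lambda>x. f (h x)) differentiable_on T"
    using differentiable_on_compose[OF linear_imp_differentiable_on[OF h(1)], of f T] f h(2) by simp
  ultimately have "negligible ((\<lambda>x. f (h x)) ` T)"
    by (rule negligible_differentiable_image_negligible[OF order_refl])
  also have "(\<lambda>x. f (h x)) ` T = f ` W" using h(2) by auto
  finally show ?thesis .
qed

lemma ex_small_notin_negligible:
  fixes N :: "'a::euclidean_space set"
  assumes "negligible N" "\<epsilon> > 0"
  obtains c where "norm c < \<epsilon>" "c \<notin> N"
proof -
  have "\<not> negligible (ball (0::'a) \<epsilon>)"
    using assms(2) by (intro open_not_negligible) auto
  then have "\<not> ball 0 \<epsilon> \<subseteq> N"
    using assms(1) negligible_subset by blast
  then obtain c where "c \<in> ball 0 \<epsilon>" "c \<notin> N" by blast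
  then show ?thesis using that by simp
qed

text \<open>The rank one matrix formed from \<open>c\<close> and the transpose of \<open>u\<close>.
  Adding it changes the action along \<open>u\<close> only, so injectivity already achieved on the
  orthogonal complement survives.\<close>

definition outer :: "real^'n \<Rightarrow> real^'k \<Rightarrow> real^'k^'n" where
  "outer c u = (\<chi> i j. c $ i * u $ j)"

lemma outer_mult: "outer c u *v \<gamma> = (u \<bullet> \<gamma>) *\<^sub>R c"
  by (simp add: outer_def matrix_vector_mult_def vec_eq_iff inner_vec_def sum_distrib_left mult_ac)

lemma ex_outer_bound:
  obtains B where "B > 0" "\<And>c. norm (outer c u :: real^'k^'n) \<le> B * norm c"
proof -
  have "linear (\<lambda>c. outer c u :: real^'k^'n)"
    by (rule linearI) (simp_all add: outer_def vec_eq_iff algebra_simps)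
  then show ?thesis using linear_bounded_pos that by blast
qed

lemma differentiable_on_matrix_vector_mult:
  fixes M :: "'a::real_normed_vector \<Rightarrow> real^'k^'n"
  assumes "M differentiable_on S" "v differentiable_on S"
  shows "(\<lambda>y. M y *v v y) differentiable_on S"
  using assms bounded_bilinear.FDERIV[OF bounded_bilinear_matrix_vector_mult]
  unfolding differentiable_on_def differentiable_def by blast

lemma dim_orthogonal_to_vector:
  fixes E :: "(real^'k) set"
  assumes "subspace E" "u \<in> E" "u \<noteq> 0"
  shows "dim {y \<in> E. u \<bullet> y = 0} + 1 = dim E" "subspace {y \<in> E. u \<bullet> y = 0}"
proof -
  have "dim {y \<in> E. \<forall>x \<in> span {u}. orthogonal x y} + dim (span {u}) = dim E"
    using assms by (intro dim_subspace_orthogonal_to_vectors span_minimal) auto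
  moreover have "{y \<in> E. \<forall>x \<in> span {u}. orthogonal x y} = {y \<in> E. u \<bullet> y = 0}"
    by (auto simp: orthogonal_def span_singleton)
  ultimately show "dim {y \<in> E. u \<bullet> y = 0} + 1 = dim E"
    using assms(3) by (simp add: dim_singleton)
  have "{y \<in> E. u \<bullet> y = 0} = E \<inter> {y. u \<bullet> y = 0}" by auto
  then show "subspace {y \<in> E. u \<bullet> y = 0}"
    using assms(1) by (simp add: subspace_inter subspace_hyperplane)
qed

text \<open>Injectivity is gained one direction \<open>u\<close> at a time. A kernel vector with
  nonzero \<open>u\<close>-component, scaled to make that component 1, expresses \<open>c\<close> as
  a differentiable function of \<open>z\<close> and a vector of the smaller subspace. These
  parameters have dimension at most n - 1, so a small \<open>c\<close> outside the image
  exists.\<close>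

lemma ex_perturbation_injective_on:
  fixes P :: "'a::euclidean_space \<Rightarrow> real^'k^'n"
  assumes P: "P differentiable_on UNIV" and "subspace E" "DIM('a) + dim E \<le> CARD('n)" "\<epsilon> > 0"
  shows "\<exists>C. norm C < \<epsilon> \<and> (\<forall>z. \<forall>\<eta>\<in>E. (P z + C) *v \<eta> = 0 \<longrightarrow> \<eta> = 0)"
  using assms(2-)
proof (induction "dim E" arbitrary: E \<epsilon>)
  case 0
  then have "E \<subseteq> {0}" by (metis dim_eq_0)
  then show ?case using 0 by (intro exI[of _ 0]) auto
next
  case (Suc d)
  have "E \<noteq> {0}" using Suc.hyps(2) by (metis dim_eq_0 nat.distinct(1) order_refl)
  then obtain v where v: "v \<in> E" "v \<noteq> 0" using subspace_0[OF Suc.prems(1)] by blast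
  define u where "u = sgn v"
  have u: "u \<in> E" "norm u = 1"
    using v Suc.prems(1) by (auto simp: u_def sgn_div_norm subspace_scale)
  then have uu: "u \<bullet> u = 1" "u \<noteq> 0" by (auto simp: norm_eq_1)
  let ?E = "{y \<in> E. u \<bullet> y = 0}"
  have dE: "dim ?E = d" and sE: "subspace ?E"
    using dim_orthogonal_to_vector[OF Suc.prems(1) u(1) uu(2)] Suc.hyps(2) by auto
  obtain C' where C': "norm C' < \<epsilon> / 2" "\<And>z \<eta>. \<eta> \<in> ?E \<Longrightarrow> (P z + C') *v \<eta> = 0 \<Longrightarrow> \<eta> = 0"
    using Suc.hyps(1)[OF dE[symmetric] sE, of "\<epsilon> / 2"] Suc.prems(2,3) Suc.hyps(2) dE by auto
  define W :: "('a \<times> (real^'k)) set" where "W = UNIV \<times> ?E"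
  define f :: "'a \<times> (real^'k) \<Rightarrow> real^'n" where "f y = - ((P (fst y) + C') *v (u + snd y))" for y
  have "subspace W" unfolding W_def by (intro subspace_Times subspace_UNIV sE)
  moreover have "dim W < DIM(real^'n)"
    unfolding W_def using Suc.prems(2) Suc.hyps(2) dE
    by (simp add: dim_Times[OF subspace_UNIV sE])
  moreover have "f differentiable_on W"
  proof -
    have "(\<lambda>y::'a \<times> (real^'k). P (fst y)) differentiable_on W"
      by (rule differentiable_on_compose)
         (auto intro!: linear_imp_differentiable_on linear_fst differentiable_on_subset[OF P])
    then have "(\<lambda>y::'a \<times> (real^'k). P (fst y) + C') differentiable_on W"
      by (intro differentiable_on_add differentiable_on_const)
    moreover have "(\<lambda>y::'a \<times> (real^'k). u + snd y) differentiable_on W"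
      by (intro differentiable_on_add differentiable_on_const linear_imp_differentiable_on linear_snd)
    ultimately show ?thesis
      unfolding f_def by (intro differentiable_on_minus differentiable_on_matrix_vector_mult)
  qed
  ultimately have neg: "negligible (f ` W)"
    by (rule negligible_differentiable_image_subspace)
  obtain B where B: "B > 0" "\<And>c. norm (outer c u :: real^'k^'n) \<le> B * norm c"
    using ex_outer_bound[of u] by blast
  \<comment> \<open>The bound keeps the rank one term below half of \<open>\<epsilon>\<close>; the
    other half is spent on \<open>C'\<close>.\<close>
  obtain c where c: "norm c < \<epsilon> / (2 * B)" "c \<notin> f ` W"
    using ex_small_notin_negligible[OF neg, of "\<epsilon> / (2 * B)"] B Suc.prems(3) by auto
  define C where "C = C' + outer c u"
  have "norm (outer c u :: real^'k^'n) < \<epsilon> / 2"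
    using B(2)[of c] c(1) B(1) by (simp add: field_simps)
  then have "norm C < \<epsilon>"
    using C'(1) norm_triangle_ineq[of C' "outer c u"] by (simp add: C_def)
  moreover have "\<eta> = 0" if \<eta>: "\<eta> \<in> E" "(P z + C) *v \<eta> = 0" for z \<eta>
  proof -
    define s where "s = u \<bullet> \<eta>"
    define \<eta>' where "\<eta>' = \<eta> - s *\<^sub>R u"
    have \<eta>': "\<eta>' \<in> ?E"
      using \<eta>(1) u(1) Suc.prems(1) uu(1) by (simp add: \<eta>'_def s_def subspace_diff subspace_scale inner_diff_right)
    have dec: "\<eta> = s *\<^sub>R u + \<eta>'" by (simp add: \<eta>'_def)
    have eq: "(P z + C) *v \<eta> = (P z + C') *v \<eta> + s *\<^sub>R c"
      by (simp add: C_def matrix_vector_mult_add_rdistrib outer_mult s_def)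
    show ?thesis
    proof (cases "s = 0")
      case True
      then show ?thesis using \<eta>(2) eq C'(2)[OF \<eta>'] dec by simp
    next
      case False
      have "(P z + C') *v (u + \<eta>' /\<^sub>R s) + c = ((P z + C') *v \<eta> + s *\<^sub>R c) /\<^sub>R s"
        using False by (simp add: dec matrix_vector_right_distrib matrix_vector_mult_scaleR scaleR_right_distrib)
      also have "\<dots> = 0" using \<eta>(2) eq by simp
      finally have "c = f (z, \<eta>' /\<^sub>R s)" unfolding f_def by (simp add: eq_neg_iff_add_eq_0 add.commute)
      moreover have "(z, \<eta>' /\<^sub>R s) \<in> W"
        using \<eta>' sE by (simp only: W_def mem_Times_iff fst_conv snd_conv UNIV_I subspace_scale simp_thms)
      ultimately show ?thesis using c(2) by blast
    qed
  qed
  ultimately show ?case by blast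
qed

text \<open>For fixed \<open>t\<close>, zeros in the two hyperplanes orthogonal to \<open>e\<close> and \<open>e'\<close> impose
  \<open>2n\<close> conditions on a pair of zeros, but the pairs form a family of dimension \<open>2n - 1\<close> only,
  including the parameter \<open>t\<close>.\<close>

lemma ex_perturbation_alternative:
  fixes P :: "real \<times> (real^'m) \<Rightarrow> real^'k^'n"
  assumes card: "CARD('k) + CARD('m) = CARD('n) + 1"
    and P: "P differentiable_on UNIV" and \<epsilon>: "\<epsilon> > 0"
    and e: "norm e = 1" "norm e' = 1" "e \<bullet> e' = 0"
  shows "\<exists>C. norm C < \<epsilon> \<and> (\<forall>t. (\<forall>x \<gamma>. \<gamma> \<bullet> e = 0 \<longrightarrow> (P (t, x) + C) *v \<gamma> = 0 \<longrightarrow> \<gamma> = 0) \<or>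
      (\<forall>x \<gamma>. \<gamma> \<bullet> e' = 0 \<longrightarrow> (P (t, x) + C) *v \<gamma> = 0 \<longrightarrow> \<gamma> = 0))"
proof -
  let ?E1 = "{y \<in> UNIV. e \<bullet> y = 0}"
  define E where "E = {y \<in> ?E1. e' \<bullet> y = 0}"
  have E_iff: "y \<in> E \<longleftrightarrow> e \<bullet> y = 0 \<and> e' \<bullet> y = 0" for y by (simp add: E_def)
  have ee: "e \<bullet> e = 1" "e' \<bullet> e' = 1" "e' \<bullet> e = 0" "e \<noteq> 0" "e' \<noteq> 0"
    using e by (auto simp: norm_eq_1 inner_commute)
  have d1: "dim ?E1 + 1 = CARD('k)" "subspace ?E1"
    using dim_orthogonal_to_vector[OF subspace_UNIV, of e] ee by (simp_all add: dim_UNIV)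
  have d2: "dim E + 2 = CARD('k)" and sE: "subspace E"
    using dim_orthogonal_to_vector[OF d1(2), of e'] e(3) ee(5) d1(1) unfolding E_def by simp_all
  \<comment> \<open>The parameter \<open>(t, x)\<close> has dimension m + 1 and \<open>E\<close> has
    dimension k - 2, so the dimension hypothesis holds with equality.\<close>
  obtain C' where C': "norm C' < \<epsilon> / 2" "\<And>z \<eta>. \<eta> \<in> E \<Longrightarrow> (P z + C') *v \<eta> = 0 \<Longrightarrow> \<eta> = 0"
    using ex_perturbation_injective_on[OF P sE, of "\<epsilon> / 2"] card d2 \<epsilon> by auto
  define W :: "(real \<times> (real^'m) \<times> (real^'m) \<times> (real^'k) \<times> (real^'k)) set"
    where "W = UNIV \<times> UNIV \<times> UNIV \<times> E \<times> E"
  define f1 :: "real \<times> (real^'m) \<times> (real^'m) \<times> (real^'k) \<times> (real^'k) \<Rightarrow> real^'n"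
    where "f1 y = - ((P (fst y, fst (snd y)) + C') *v (e' + fst (snd (snd (snd y)))))" for y
  define f2 :: "real \<times> (real^'m) \<times> (real^'m) \<times> (real^'k) \<times> (real^'k) \<Rightarrow> real^'n"
    where "f2 y = - ((P (fst y, fst (snd (snd y))) + C') *v (e + snd (snd (snd (snd y)))))" for y
  define f where "f y = (f1 y, f2 y)" for y
  have sub: "subspace W" unfolding W_def by (intro subspace_Times subspace_UNIV sE)
  have dimW: "dim W < DIM((real^'n) \<times> (real^'n))"
    unfolding W_def using card d2
    by (simp add: dim_Times subspace_Times subspace_UNIV sE)
  have diff: "f differentiable_on W"
  proof -
    have "(\<lambda>y. P (g y)) differentiable_on W" if "linear g" for g
      by (rule differentiable_on_compose[OF linear_imp_differentiable_on[OF that]])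
         (rule differentiable_on_subset[OF P], simp)
    then have PD: "(\<lambda>y. P (g y) + C') differentiable_on W" if "linear g" for g
      using that by (intro differentiable_on_add differentiable_on_const)
    have LD: "(\<lambda>y. v + g y) differentiable_on W" if "linear g"
      for v and g :: "real \<times> (real^'m) \<times> (real^'m) \<times> (real^'k) \<times> (real^'k) \<Rightarrow> real^'k"
      using that by (intro differentiable_on_add differentiable_on_const linear_imp_differentiable_on)
    have "f1 differentiable_on W" "f2 differentiable_on W"
      unfolding f1_def f2_def
      by (intro differentiable_on_minus differentiable_on_matrix_vector_mult PD LD; rule linearI; simp)+
    then show ?thesis
      unfolding f_def differentiable_on_def differentiable_def by (blast intro: has_derivative_Pair)
  qed
  have neg: "negligible (f ` W)"
    by (rule negligible_differentiable_image_subspace[OF sub dimW diff])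
  obtain B where B: "B > 0" "\<And>c. norm (outer c e :: real^'k^'n) \<le> B * norm c"
    using ex_outer_bound[of e] by blast
  obtain B' where B': "B' > 0" "\<And>c. norm (outer c e' :: real^'k^'n) \<le> B' * norm c"
    using ex_outer_bound[of e'] by blast
  \<comment> \<open>Both components of \<open>c\<close> are bounded by its norm, so the two rank one
    terms together cost at most \<open>(B + B') * norm c\<close>, less than half of
    \<open>\<epsilon>\<close>.\<close>
  obtain c where c: "norm c < \<epsilon> / (2 * (B + B'))" "c \<notin> f ` W"
    using ex_small_notin_negligible[OF neg, of "\<epsilon> / (2 * (B + B'))"] B(1) B'(1) \<epsilon> by auto
  obtain c' c'' where cc: "c = (c', c'')" by fastforce
  have nc: "norm c' \<le> norm c" "norm c'' \<le> norm c"
    unfolding cc using norm_fst_le norm_snd_le by metis+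
  define C where "C = C' + outer c' e' + outer c'' e"
  have "norm C \<le> norm C' + norm (outer c' e' :: real^'k^'n) + norm (outer c'' e :: real^'k^'n)"
    using norm_triangle_ineq[of "C' + outer c' e'" "outer c'' e"] norm_triangle_ineq[of C' "outer c' e'"]
    unfolding C_def by linarith
  also have "\<dots> \<le> norm C' + B' * norm c + B * norm c"
    using B(2)[of c''] B'(2)[of c'] mult_left_mono[OF nc(1), of B'] mult_left_mono[OF nc(2), of B] B(1) B'(1)
    by linarith
  also have "\<dots> < \<epsilon> / 2 + (B + B') * (\<epsilon> / (2 * (B + B')))"
    using C'(1) mult_strict_left_mono[OF c(1), of "B + B'"] B(1) B'(1) by (simp add: algebra_simps)
  also have "\<dots> = \<epsilon>" using B(1) B'(1) by (simp add: field_simps)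
  finally have "norm C < \<epsilon>" .
  \<comment> \<open>A kernel vector orthogonal to \<open>d\<close> is a multiple of
    \<open>d'\<close> plus a vector of \<open>E\<close>, and the rank one term attached to
    \<open>d\<close> vanishes on it. Its \<open>d'\<close>-component is nonzero by injectivity on
    \<open>E\<close>; dividing by it expresses \<open>c1\<close> through the remaining data. The
    triples cover the two symmetric cases together.\<close>
  have key: "c1 = - ((P z + C') *v (d' + (s' /\<^sub>R (d' \<bullet> \<gamma>)))) \<and> s' /\<^sub>R (d' \<bullet> \<gamma>) \<in> E"
    if \<gamma>: "\<gamma> \<bullet> d = 0" "(P z + C) *v \<gamma> = 0" "\<gamma> \<noteq> 0" and s': "s' = \<gamma> - (d' \<bullet> \<gamma>) *\<^sub>R d'"
      and d: "(d, d', c1) = (e, e', c') \<or> (d, d', c1) = (e', e, c'')" for z \<gamma> s' d d' c1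
  proof -
    let ?s = "d' \<bullet> \<gamma>"
    have E: "s' \<in> E"
      using \<gamma>(1) d ee e(3) by (auto simp: E_iff s' inner_diff_right inner_commute)
    have eq: "(P z + C) *v \<gamma> = (P z + C') *v \<gamma> + ?s *\<^sub>R c1"
      using d \<gamma>(1) by (auto simp: C_def matrix_vector_mult_add_rdistrib outer_mult inner_commute)
    have dec: "\<gamma> = ?s *\<^sub>R d' + s'" by (simp add: s')
    have s: "?s \<noteq> 0"
    proof
      assume "?s = 0"
      then have "s' = \<gamma>" "(P z + C') *v \<gamma> = 0" using eq \<gamma>(2) s' by auto
      then show False using C'(2)[OF E] \<gamma>(3) by simp
    qed
    have "(P z + C') *v (d' + s' /\<^sub>R ?s) + c1 = ((P z + C') *v (?s *\<^sub>R d' + s') + ?s *\<^sub>R c1) /\<^sub>R ?s"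
      using s by (simp add: matrix_vector_right_distrib matrix_vector_mult_scaleR scaleR_right_distrib)
    also have "\<dots> = 0" unfolding dec[symmetric] eq[symmetric] \<gamma>(2) by simp
    finally have "c1 = - ((P z + C') *v (d' + s' /\<^sub>R ?s))"
      by (simp add: eq_neg_iff_add_eq_0 add.commute)
    moreover have "s' /\<^sub>R ?s \<in> E" by (rule subspace_scale[OF sE E])
    ultimately show ?thesis by blast
  qed
  have "(\<forall>x \<gamma>. \<gamma> \<bullet> e = 0 \<longrightarrow> (P (t, x) + C) *v \<gamma> = 0 \<longrightarrow> \<gamma> = 0) \<or>
      (\<forall>x \<gamma>. \<gamma> \<bullet> e' = 0 \<longrightarrow> (P (t, x) + C) *v \<gamma> = 0 \<longrightarrow> \<gamma> = 0)" for t
  proof (rule ccontr)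
    assume "\<not> ?thesis"
    then obtain x \<gamma> x' \<gamma>' where 1: "\<gamma> \<bullet> e = 0" "(P (t, x) + C) *v \<gamma> = 0" "\<gamma> \<noteq> 0"
      and 2: "\<gamma>' \<bullet> e' = 0" "(P (t, x') + C) *v \<gamma>' = 0" "\<gamma>' \<noteq> 0" by blast
    define \<eta> where "\<eta> = (\<gamma> - (e' \<bullet> \<gamma>) *\<^sub>R e') /\<^sub>R (e' \<bullet> \<gamma>)"
    define \<eta>' where "\<eta>' = (\<gamma>' - (e \<bullet> \<gamma>') *\<^sub>R e) /\<^sub>R (e \<bullet> \<gamma>')"
    have k1: "c' = - ((P (t, x) + C') *v (e' + \<eta>))" "\<eta> \<in> E"
      using key[OF 1 refl, of e' c'] unfolding \<eta>_def by blast+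
    have k2: "c'' = - ((P (t, x') + C') *v (e + \<eta>'))" "\<eta>' \<in> E"
      using key[OF 2 refl, of e c''] unfolding \<eta>'_def by blast+
    have "c = f (t, x, x', \<eta>, \<eta>')"
      unfolding cc f_def f1_def f2_def fst_conv snd_conv k1(1)[symmetric] k2(1)[symmetric] ..
    moreover have "(t, x, x', \<eta>, \<eta>') \<in> W"
      unfolding W_def using k1(2) k2(2) by blast
    ultimately show False using c(2) by blast
  qed
  then show ?thesis using \<open>norm C < \<epsilon>\<close> by blast
qed

section \<open>Homotopy invariance\<close>

text \<open>The bound is a minimum over unit vectors and extends by homogeneity. Taking
  \<open>v = 0\<close> imposes no restriction on \<open>\<gamma>\<close>.\<close>

lemma ex_uniform_lower_bound:
  fixes M :: "'a::euclidean_space \<Rightarrow> real^'k^'n"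
  assumes X: "compact X" and M: "continuous_on X M"
    and inj: "\<And>x \<gamma>. x \<in> X \<Longrightarrow> \<gamma> \<bullet> v = 0 \<Longrightarrow> M x *v \<gamma> = 0 \<Longrightarrow> \<gamma> = 0"
  obtains \<delta> where "\<delta> > 0" "\<And>x \<gamma>. x \<in> X \<Longrightarrow> \<gamma> \<bullet> v = 0 \<Longrightarrow> \<delta> * norm \<gamma> \<le> norm (M x *v \<gamma>)"
proof -
  let ?D = "sphere 0 1 \<inter> {\<gamma>. \<gamma> \<bullet> v = 0}"
  have "closed {\<gamma>. \<gamma> \<bullet> v = 0}" by (intro closed_Collect_eq continuous_intros)
  then have cD: "compact (X \<times> ?D)"
    using X by (intro compact_Times compact_Int_closed) auto
  have scale: "\<delta> * norm \<gamma> \<le> norm (M x *v \<gamma>)"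
    if x: "x \<in> X" "\<gamma> \<bullet> v = 0" and lower: "\<And>z. z \<in> X \<times> ?D \<Longrightarrow> \<delta> \<le> norm (M (fst z) *v snd z)" for \<delta> x \<gamma>
  proof (cases "\<gamma> = 0")
    case False
    then have "(x, sgn \<gamma>) \<in> X \<times> ?D" using x by (simp add: norm_sgn) (simp add: sgn_div_norm)
    from lower[OF this] have "\<delta> \<le> norm (M x *v \<gamma>) / norm \<gamma>"
      by (simp add: sgn_div_norm matrix_vector_mult_scaleR divide_inverse mult.commute)
    then show ?thesis using False by (simp add: field_simps)
  qed simp
  show ?thesis
  proof (cases "X \<times> ?D = {}")
    case True
    then show ?thesis using that[of 1] scale[of _ _ 1] by (metis empty_iff zero_less_one)
  next
    case False
    have "continuous_on (X \<times> ?D) (\<lambda>z. norm (M (fst z) *v snd z))"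
      by (intro continuous_intros continuous_on_compose2[OF M]) auto
    then obtain z0 where z0: "z0 \<in> X \<times> ?D"
      "\<And>z. z \<in> X \<times> ?D \<Longrightarrow> norm (M (fst z0) *v snd z0) \<le> norm (M (fst z) *v snd z)"
      using continuous_attains_inf[OF cD False] by blast
    have "M (fst z0) *v snd z0 \<noteq> 0"
      using z0(1) inj[of "fst z0" "snd z0"] by auto
    then show ?thesis
      using that[of "norm (M (fst z0) *v snd z0)"] scale[of _ _ "norm (M (fst z0) *v snd z0)"] z0(2) by simp
  qed
qed

text \<open>Radial projection to the ball. Composing with it repeats the values on the unit sphere
  along rays, so a family of frames on the sphere stays injective everywhere outside.\<close>

definition retract :: "real^'m \<Rightarrow> real^'m" where
  "retract x = x /\<^sub>R max 1 (norm x)"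

lemma continuous_on_retract: "continuous_on S retract"
  unfolding retract_def by (intro continuous_intros) auto

lemma retract_in_cball: "retract x \<in> cball 0 1"
  by (cases "x = 0") (simp_all add: retract_def max_def)

lemma retract_in_sphere: "norm x \<ge> 1 \<Longrightarrow> retract x \<in> sphere 0 1"
  by (cases "x = 0") (auto simp: retract_def max_def)

lemma retract_id: "norm x \<le> 1 \<Longrightarrow> retract x = x"
  by (simp add: retract_def max_def)

lemma continuous_on_comp_retract:
  assumes "continuous_on (cball 0 1) f"
  shows "continuous_on UNIV (f \<circ> retract)"
proof (rule continuous_on_compose[OF continuous_on_retract])
  have "retract ` UNIV \<subseteq> cball 0 1" using retract_in_cball by blast
  then show "continuous_on (retract ` UNIV) f" by (rule continuous_on_subset[OF assms])
qed

lemma smooth_map_on_imp_continuous_on: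
  assumes "smooth_map_on f S" shows "continuous_on S f"
proof -
  obtain U g where U: "S \<subseteq> U" and g: "\<forall>r. C_on r g U" and gf: "\<And>x. x \<in> S \<Longrightarrow> g x = f x"
    using assms by (auto simp: smooth_map_on_def)
  have "continuous_on U g"
    using g[rule_format, of 0] by simp
  then show ?thesis
    using U gf by (metis continuous_on_cong continuous_on_subset)
qed

lemma ex_direction_avoiding:
  fixes Z :: "(real^'k) set"
  assumes "finite Z" "0 \<notin> Z"
  obtains e :: "real^'k" where "norm e = 1" "\<And>\<gamma>. \<gamma> \<in> Z \<Longrightarrow> \<gamma> \<bullet> e \<noteq> 0"
proof -
  have "negligible ((\<Union>\<gamma>\<in>Z. {e. \<gamma> \<bullet> e = 0}) \<union> {0})"
    using assms by (intro negligible_Un negligible_Union negligible_sing)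
      (auto intro!: negligible_hyperplane)
  then obtain e where e: "e \<notin> (\<Union>\<gamma>\<in>Z. {e. \<gamma> \<bullet> e = 0}) \<union> {0}"
    using ex_small_notin_negligible zero_less_one by metis
  then have "norm (sgn e) = 1" "\<And>\<gamma>. \<gamma> \<in> Z \<Longrightarrow> \<gamma> \<bullet> sgn e \<noteq> 0"
    by (auto simp: norm_sgn sgn_div_norm)
  then show ?thesis using that by blast
qed

text \<open>On the linear homotopy from \<open>A\<close> to \<open>B\<close> the perturbation of
  \<open>A x *v \<gamma>\<close> is always smaller than its lower bound, so no zero can appear at a
  forbidden place.\<close>

lemma hemisphere_parity_close:
  fixes A B :: "real^'m \<Rightarrow> real^'k^'n"
  assumes card: "CARD('k) + CARD('m) = CARD('n) + 1" "CARD('n) \<ge> 2"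
    and A: "continuous_on UNIV A" and B: "continuous_on UNIV B"
    and lower: "\<And>x \<gamma>. norm x \<ge> 1 \<or> \<gamma> \<bullet> e = 0 \<Longrightarrow> \<delta> * norm \<gamma> \<le> norm (A x *v \<gamma>)"
    and close: "\<And>x \<gamma>. \<gamma> \<noteq> 0 \<Longrightarrow> norm ((A x - B x) *v \<gamma>) < \<delta> * norm \<gamma>"
  shows "hemisphere_parity e A = hemisphere_parity e B" "nonsingular_along e B"
proof -
  let ?F = "\<lambda>z::real \<times> (real^'m). A (snd z) - fst z *\<^sub>R (A (snd z) - B (snd z))"
  have cont: "continuous_on ({0..1} \<times> UNIV) ?F"
    by (intro continuous_intros continuous_on_compose2[OF A] continuous_on_compose2[OF B]) auto
  have ns: "nonsingular_along e (\<lambda>x. ?F (t, x))" if t: "t \<in> {0..1}" for t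
    unfolding nonsingular_along_def
  proof (intro allI impI, rule ccontr)
    fix x \<gamma> assume 0: "?F (t, x) *v \<gamma> = 0" and x: "norm x \<ge> 1 \<or> \<gamma> \<bullet> e = 0" and \<gamma>: "\<gamma> \<noteq> 0"
    have "?F (t, x) *v \<gamma> = A x *v \<gamma> - t *\<^sub>R ((A x - B x) *v \<gamma>)"
      by (simp only: fst_conv snd_conv matrix_vector_mult_diff_rdistrib scaleR_matrix_vector_assoc[symmetric])
    then have "A x *v \<gamma> = t *\<^sub>R ((A x - B x) *v \<gamma>)"
      using 0 by simp
    then have "norm (A x *v \<gamma>) \<le> norm ((A x - B x) *v \<gamma>)"
      using t by (simp add: mult_left_le_one_le)
    then show False using lower[OF x] close[OF \<gamma>, of x] by linarith
  qed
  show "hemisphere_parity e A = hemisphere_parity e B"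
    using hemisphere_parity_homotopy(1)[OF card cont ns] by simp
  show "nonsingular_along e B" using ns[of 1] by simp
qed

text \<open>Neither direction need be admissible along the whole path. The times at which a
  direction fails form a closed set, so a direction admissible at one time works nearby; agreement
  of the two parities where both are defined glues these pieces together.\<close>

lemma hemisphere_parity_path:
  fixes Q :: "real \<times> (real^'m) \<Rightarrow> real^'k^'n"
  assumes card: "CARD('k) + CARD('m) = CARD('n) + 1" "CARD('n) \<ge> 2"
    and Q: "continuous_on UNIV Q"
    and outside: "\<And>t x \<gamma>. t \<in> {0..1} \<Longrightarrow> norm x = 1 \<Longrightarrow> Q (t, x) *v \<gamma> = 0 \<Longrightarrow> \<gamma> = 0"
    and alt: "\<And>t. t \<in> {0..1} \<Longrightarrow> nonsingular_along e (\<lambda>x. Q (t, retract x)) \<or>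
                    nonsingular_along e' (\<lambda>x. Q (t, retract x))"
    and ends: "nonsingular_along e (\<lambda>x. Q (0, retract x))" "nonsingular_along e (\<lambda>x. Q (1, retract x))"
  shows "hemisphere_parity e (\<lambda>x. Q (0, retract x)) = hemisphere_parity e (\<lambda>x. Q (1, retract x))"
proof -
  let ?Q = "\<lambda>t x. Q (t, retract x)"
  have cQ: "continuous_on UNIV (?Q t)" for t
    by (intro continuous_on_compose2[OF Q] continuous_intros continuous_on_retract) auto
  \<comment> \<open>The preference for \<open>e\<close> is arbitrary: by independence of the
    direction, any admissible one of the two gives the same value.\<close>
  define N where "N t = (if nonsingular_along e (?Q t) then hemisphere_parity e (?Q t) else hemisphere_parity e' (?Q t))" for t
  have N: "N t = hemisphere_parity d (?Q t)" if "d = e \<or> d = e'" "nonsingular_along d (?Q t)" for t d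
  proof (cases "nonsingular_along e (?Q t)")
    case True
    then show ?thesis
      using hemisphere_parity_independent[OF card cQ True that(2)] by (simp add: N_def)
  next
    case False
    then have "d = e'" using that by blast
    then show ?thesis using False by (simp add: N_def)
  qed
  define T where "T d = {t \<in> {0..1}. \<not> nonsingular_along d (?Q t)}" for d
  \<comment> \<open>\<open>T d\<close> is the projection of a compact set of triples
    \<open>(t, x, \<gamma>)\<close> with \<open>\<gamma>\<close> normalised. The assumption over the
    boundary sphere leaves orthogonality to \<open>d\<close> as the only possible reason for
    failure.\<close>
  have clT: "closed (T d)" for d
  proof -
    let ?X = "{0..1::real} \<times> cball (0::real^'m) 1 \<times> (sphere (0::real^'k) 1 \<inter> {\<gamma>. \<gamma> \<bullet> d = 0})"
    let ?g = "\<lambda>z. Q (fst z, fst (snd z)) *v snd (snd z)"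
    have cX: "compact ?X"
      by (intro compact_Times compact_Int_closed closed_Collect_eq continuous_intros) auto
    have "closed (?X \<inter> ?g -` {0})"
      by (intro continuous_closed_preimage compact_imp_closed cX continuous_intros
          continuous_on_compose2[OF Q]) auto
    from compact_Int_closed[OF cX this] have "compact (?X \<inter> ?g -` {0})"
      by (simp only: Int_left_absorb)
    then have "compact (fst ` (?X \<inter> ?g -` {0}))"
      by (intro compact_continuous_image continuous_intros)
    also have "fst ` (?X \<inter> ?g -` {0}) = T d"
    proof (intro equalityI subsetI)
      fix t assume "t \<in> fst ` (?X \<inter> ?g -` {0})"
      then obtain x \<gamma> where t: "t \<in> {0..1}" "norm x \<le> 1" "norm \<gamma> = 1" "\<gamma> \<bullet> d = 0" "Q (t, x) *v \<gamma> = 0"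
        by auto
      then have "\<gamma> \<noteq> 0" "?Q t x *v \<gamma> = 0" by (auto simp: retract_id)
      then show "t \<in> T d" using t unfolding T_def nonsingular_along_def by blast
    next
      fix t assume "t \<in> T d"
      then obtain x \<gamma> where t: "t \<in> {0..1}" "?Q t x *v \<gamma> = 0" "norm x \<ge> 1 \<or> \<gamma> \<bullet> d = 0" "\<gamma> \<noteq> 0"
        unfolding T_def nonsingular_along_def by blast
      have "\<not> norm x \<ge> 1" using outside[OF t(1) _ t(2)] retract_in_sphere[of x] t(4) by auto
      then have "\<gamma> \<bullet> d = 0" using t(3) by blast
      then have "(t, retract x, sgn \<gamma>) \<in> ?X \<inter> ?g -` {0}"
        using t retract_in_cball[of x] by (auto simp: norm_sgn) (auto simp: sgn_div_norm matrix_vector_mult_scaleR)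
      then show "t \<in> fst ` (?X \<inter> ?g -` {0})" by (intro image_eqI[of _ _ "(t, retract x, sgn \<gamma>)"]) auto
    qed
    finally show ?thesis by (rule compact_imp_closed)
  qed
  have "N 0 = N 1"
  proof (rule connected_local_const[where f = N and A = "{0..1}"])
    show "\<forall>t\<in>{0..1}. \<forall>\<^sub>F s in at t within {0..1}. N t = N s"
    proof
      fix t :: real assume t: "t \<in> {0..1}"
      obtain d where d: "d = e \<or> d = e'" "nonsingular_along d (?Q t)" using alt[OF t] by blast
      then have "t \<in> - T d" by (simp add: T_def)
      then obtain r where r: "r > 0" "ball t r \<subseteq> - T d"
        using clT[of d] by (metis open_Compl openE)
      have "N t = N s" if s: "s \<in> {0..1}" "dist s t < r" for s
      proof -
        \<comment> \<open>By convexity the whole segment from \<open>t\<close> to \<open>s\<close>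
          avoids \<open>T d\<close>, so the reparametrised path is a homotopy admissible for the
          single direction \<open>d\<close>.\<close>
        have cc: "closed_segment t s \<subseteq> {0..1} \<inter> ball t r"
          using s t r(1) by (intro closed_segment_subset convex_Int) (auto simp: dist_commute)
        let ?F = "\<lambda>z::real \<times> (real^'m). Q ((1 - fst z) * t + fst z * s, retract (snd z))"
        have ns: "nonsingular_along d (\<lambda>x. ?F (u, x))" if "u \<in> {0..1}" for u
        proof -
          have "(1 - u) * t + u * s \<in> closed_segment t s"
            using that by (auto simp: in_segment)
          then have "(1 - u) * t + u * s \<in> {0..1}" "(1 - u) * t + u * s \<notin> T d"
            using cc r(2) by blast+
          then show ?thesis by (simp add: T_def)
        qed
        have "continuous_on ({0..1} \<times> UNIV) ?F"
          by (intro continuous_on_compose2[OF Q] continuous_intros continuous_on_compose2[OF continuous_on_retract]) auto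
        from hemisphere_parity_homotopy(1)[OF card this ns]
        have "hemisphere_parity d (?Q t) = hemisphere_parity d (?Q s)" by simp
        moreover have "nonsingular_along d (?Q s)" using ns[of 1] by simp
        ultimately show ?thesis using N d by metis
      qed
      then show "\<forall>\<^sub>F s in at t within {0..1}. N t = N s"
        using r(1) unfolding eventually_at by blast
    qed
  qed auto
  then show ?thesis using N ends by metis
qed

text \<open>The homotopy on the sphere and the two given maps define a continuous map on the closed
  lateral surface with both ends of the cylinder; the Dugundji theorem extends it.\<close>

lemma ex_homotopy_extension:
  fixes a b :: "real^'m \<Rightarrow> real^'k^'n"
  assumes a: "continuous_on (cball 0 1) a" and b: "continuous_on (cball 0 1) b"
    and hom: "homotopic_with_canon (\<lambda>_. True) (sphere 0 1) frames a b"
  obtains G :: "real \<times> (real^'m) \<Rightarrow> real^'k^'n" where "continuous_on UNIV G"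
    "\<And>x. x \<in> cball 0 1 \<Longrightarrow> G (0, x) = a x" "\<And>x. x \<in> cball 0 1 \<Longrightarrow> G (1, x) = b x"
    "\<And>t x. t \<in> {0..1} \<Longrightarrow> x \<in> sphere 0 1 \<Longrightarrow> G (t, x) \<in> frames"
proof -
  have "\<exists>h. continuous_on ({0..1::real} \<times> sphere 0 1) h \<and> h \<in> {0..1} \<times> sphere 0 1 \<rightarrow> frames \<and>
      (\<forall>x\<in>sphere 0 1. h (0, x) = a x) \<and> (\<forall>x\<in>sphere 0 1. h (1, x) = b x)"
    using hom by (simp add: homotopic_with)
  then obtain h where h: "continuous_on ({0..1::real} \<times> sphere 0 1) h" "h \<in> {0..1} \<times> sphere 0 1 \<rightarrow> frames"
    "\<And>x. x \<in> sphere 0 1 \<Longrightarrow> h (0, x) = a x" "\<And>x. x \<in> sphere 0 1 \<Longrightarrow> h (1, x) = b x"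
    by blast
  let ?L = "{0::real} \<times> cball (0::real^'m) 1" and ?R = "{1::real} \<times> cball (0::real^'m) 1"
    and ?M = "{0..1::real} \<times> sphere (0::real^'m) 1"
  \<comment> \<open>The values of \<open>h\<close> take precedence on the sphere; on the two rims
    they agree with \<open>a\<close> and \<open>b\<close>.\<close>
  define f where "f z = (if snd z \<in> sphere 0 1 then h z else if fst z = 0 then a (snd z) else b (snd z))" for z
  have "continuous_on ?M f"
    by (rule continuous_on_eq[OF h(1)]) (auto simp: f_def)
  moreover have "continuous_on ?L f"
  proof (rule continuous_on_eq)
    show "continuous_on ?L (\<lambda>z. a (snd z))"
      by (intro continuous_on_compose2[OF a] continuous_intros) auto
  qed (use h(3) in \<open>auto simp: f_def\<close>)
  moreover have "continuous_on ?R f"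
  proof (rule continuous_on_eq)
    show "continuous_on ?R (\<lambda>z. b (snd z))"
      by (intro continuous_on_compose2[OF b] continuous_intros) auto
  qed (use h(4) in \<open>auto simp: f_def\<close>)
  ultimately have "continuous_on (?M \<union> (?L \<union> ?R)) f"
    by (intro continuous_on_closed_Un closed_Un closed_Times) auto
  moreover have "closedin (top_of_set UNIV) (?M \<union> (?L \<union> ?R))"
    by (simp, intro closed_Un closed_Times) auto
  ultimately obtain G where G: "continuous_on UNIV G" "\<And>z. z \<in> ?M \<union> (?L \<union> ?R) \<Longrightarrow> G z = f z"
    using Dugundji[of "UNIV :: (real^'k^'n) set" UNIV "?M \<union> (?L \<union> ?R)" f] by auto
  show ?thesis
  proof (rule that[OF G(1)])
    show "G (0, x) = a x" if "x \<in> cball 0 1" for x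
      using that h(3) by (subst G(2)) (auto simp: f_def)
    show "G (1, x) = b x" if "x \<in> cball 0 1" for x
      using that h(4) by (subst G(2)) (auto simp: f_def)
    show "G (t, x) \<in> frames" if "t \<in> {0..1}" "x \<in> sphere 0 1" for t x
      using that h(2) by (subst G(2)) (auto simp: f_def)
  qed
qed

text \<open>Closeness to \<open>G\<close> is needed in two places only: over the boundary sphere at
  every time, and on the hyperplane orthogonal to \<open>e\<close> at both ends. Lower bounds there
  determine how fine the approximation must be; elsewhere general position does the work.\<close>

lemma hemisphere_parity_homotopic:
  fixes a b :: "real^'m \<Rightarrow> real^'k^'n"
  assumes card: "CARD('k) + CARD('m) = CARD('n) + 1" "CARD('n) \<ge> 2" and k: "CARD('k) > 1"
    and a: "continuous_on (cball 0 1) a" and b: "continuous_on (cball 0 1) b"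
    and hom: "homotopic_with_canon (\<lambda>_. True) (sphere 0 1) frames a b"
    and e: "norm e = 1" "nonsingular_along e (a \<circ> retract)" "nonsingular_along e (b \<circ> retract)"
  shows "hemisphere_parity e (a \<circ> retract) = hemisphere_parity e (b \<circ> retract)"
proof -
  obtain G :: "real \<times> (real^'m) \<Rightarrow> real^'k^'n" where G: "continuous_on UNIV G"
    "\<And>x. x \<in> cball 0 1 \<Longrightarrow> G (0, x) = a x" "\<And>x. x \<in> cball 0 1 \<Longrightarrow> G (1, x) = b x"
    "\<And>t x. t \<in> {0..1} \<Longrightarrow> x \<in> sphere 0 1 \<Longrightarrow> G (t, x) \<in> frames"
    using ex_homotopy_extension[OF a b hom] by blast
  let ?X = "{0..1::real} \<times> sphere (0::real^'m) 1"
  have X: "compact ?X" by (intro compact_Times) auto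
  have contG: "continuous_on S G" for S using G(1) by (rule continuous_on_subset) simp
  \<comment> \<open>Frames are injective on the whole of \<open>\<real>\<^sup>k\<close>, so the
    bound is taken with the vacuous constraint \<open>v = 0\<close>.\<close>
  obtain \<delta>1 where \<delta>1: "\<delta>1 > 0" "\<And>z \<gamma>. z \<in> ?X \<Longrightarrow> \<delta>1 * norm \<gamma> \<le> norm (G z *v \<gamma>)"
  proof (rule ex_uniform_lower_bound[OF X contG, of 0])
    show "\<gamma> = 0" if "z \<in> ?X" "G z *v \<gamma> = 0" for z \<gamma>
      using that G(4) frames_injective by (cases z) auto
  qed (use that in auto)
  have inj_end: "\<gamma> = 0" if "nonsingular_along e (f \<circ> retract)" "x \<in> cball 0 1" "\<gamma> \<bullet> e = 0" "f x *v \<gamma> = 0"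
    for f :: "real^'m \<Rightarrow> real^'k^'n" and x \<gamma>
  proof -
    have "(f \<circ> retract) x *v \<gamma> = 0" using that(2,4) by (simp add: retract_id)
    then show ?thesis using that(1,3) unfolding nonsingular_along_def by blast
  qed
  obtain \<delta>2 where \<delta>2: "\<delta>2 > 0" "\<And>x \<gamma>. x \<in> cball 0 1 \<Longrightarrow> \<gamma> \<bullet> e = 0 \<Longrightarrow> \<delta>2 * norm \<gamma> \<le> norm (a x *v \<gamma>)"
  proof (rule ex_uniform_lower_bound[OF compact_cball a, of e])
    show "\<gamma> = 0" if "x \<in> cball 0 1" "\<gamma> \<bullet> e = 0" "a x *v \<gamma> = 0" for x \<gamma>
      by (rule inj_end[OF e(2) that])
  qed (use that in blast)
  obtain \<delta>3 where \<delta>3: "\<delta>3 > 0" "\<And>x \<gamma>. x \<in> cball 0 1 \<Longrightarrow> \<gamma> \<bullet> e = 0 \<Longrightarrow> \<delta>3 * norm \<gamma> \<le> norm (b x *v \<gamma>)"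
  proof (rule ex_uniform_lower_bound[OF compact_cball b, of e])
    show "\<gamma> = 0" if "x \<in> cball 0 1" "\<gamma> \<bullet> e = 0" "b x *v \<gamma> = 0" for x \<gamma>
      by (rule inj_end[OF e(3) that])
  qed (use that in blast)
  define \<delta> where "\<delta> = min \<delta>1 (min \<delta>2 \<delta>3)"
  have \<delta>: "\<delta> > 0" "\<delta> \<le> \<delta>1" "\<delta> \<le> \<delta>2" "\<delta> \<le> \<delta>3" using \<delta>1 \<delta>2 \<delta>3 by (auto simp: \<delta>_def)
  have weaken: "\<delta> * norm \<gamma> \<le> r" if "d * norm \<gamma> \<le> r" "\<delta> \<le> d" for d r and \<gamma> :: "real^'k"
    using that mult_right_mono[OF that(2), of "norm \<gamma>"] by simp
  obtain K where K: "K > 0" "\<And>(M :: real^'k^'n) \<gamma>. norm (M *v \<gamma>) \<le> norm M * norm \<gamma> * K"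
    using bounded_bilinear.pos_bounded[OF bounded_bilinear_matrix_vector_mult] by blast
  \<comment> \<open>The approximation and the constant \<open>C\<close> each contribute an error
    below \<open>\<epsilon>\<close>, which gives the factor 2; \<open>K\<close> bounds the
    matrix-vector product.\<close>
  define \<epsilon> where "\<epsilon> = \<delta> / (2 * K)"
  have \<epsilon>: "\<epsilon> > 0" using \<delta>(1) K(1) by (simp add: \<epsilon>_def)
  obtain P where P: "polynomial_function P"
    and PG: "\<And>z. z \<in> {0..1} \<times> cball 0 1 \<Longrightarrow> norm (G z - P z) < \<epsilon>"
    using Stone_Weierstrass_polynomial_function[OF _ contG \<epsilon>, of "{0..1} \<times> cball 0 1"]
    by (auto simp: compact_Times)
  \<comment> \<open>A second direction orthogonal to \<open>e\<close> exists because
    \<open>CARD('k) > 1\<close>.\<close>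
  obtain e' where e': "norm e' = 1" "e \<bullet> e' = 0"
  proof -
    obtain y where y: "y \<noteq> 0" "orthogonal e y"
      using orthogonal_to_vector_exists[of e] k by auto
    then show ?thesis using that[of "sgn y"] by (simp add: norm_sgn orthogonal_def sgn_div_norm)
  qed
  obtain C where C: "norm C < \<epsilon>"
    and alt: "\<And>t. (\<forall>x \<gamma>. \<gamma> \<bullet> e = 0 \<longrightarrow> (P (t, x) + C) *v \<gamma> = 0 \<longrightarrow> \<gamma> = 0) \<or>
      (\<forall>x \<gamma>. \<gamma> \<bullet> e' = 0 \<longrightarrow> (P (t, x) + C) *v \<gamma> = 0 \<longrightarrow> \<gamma> = 0)"
    using ex_perturbation_alternative[OF card(1) differentiable_on_polynomial_function[OF P] \<epsilon> e(1) e'] by blast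
  define Q where "Q z = P z + C" for z
  have contQ: "continuous_on UNIV Q"
    unfolding Q_def by (intro continuous_intros continuous_on_polymonial_function P)
  have close: "norm ((G z - Q z) *v \<gamma>) < \<delta> * norm \<gamma>" if "z \<in> {0..1} \<times> cball 0 1" "\<gamma> \<noteq> 0" for z \<gamma>
  proof -
    have "norm (G z - Q z) \<le> norm (G z - P z) + norm C"
      using norm_triangle_ineq4[of "G z - P z" C] by (simp add: Q_def algebra_simps)
    then have "norm (G z - Q z) < 2 * \<epsilon>" using PG[OF that(1)] C by linarith
    then have "norm (G z - Q z) * norm \<gamma> * K < 2 * \<epsilon> * norm \<gamma> * K"
      using that(2) K(1) by simp
    also have "\<dots> = \<delta> * norm \<gamma>" using K(1) by (simp add: \<epsilon>_def)
    finally show ?thesis using K(2)[of "G z - Q z" \<gamma>] by linarith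
  qed
  have outside: "\<gamma> = 0" if "t \<in> {0..1}" "norm x = 1" "Q (t, x) *v \<gamma> = 0" for t x \<gamma>
  proof (rule ccontr)
    assume "\<gamma> \<noteq> 0"
    then have "norm (G (t, x) *v \<gamma>) < \<delta> * norm \<gamma>"
      using close[of "(t, x)" \<gamma>] that by (simp add: matrix_vector_mult_diff_rdistrib)
    then show False
      using weaken[OF \<delta>1(2)[of "(t, x)" \<gamma>] \<delta>(2)] that by simp
  qed
  have end_close: "hemisphere_parity e (f \<circ> retract) = hemisphere_parity e (\<lambda>x. Q (t, retract x))"
      "nonsingular_along e (\<lambda>x. Q (t, retract x))"
    if t: "t \<in> {0..1}" and f: "continuous_on (cball 0 1) f" and Gf: "\<And>x. x \<in> cball 0 1 \<Longrightarrow> G (t, x) = f x"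
      and lower: "\<And>x \<gamma>. x \<in> cball 0 1 \<Longrightarrow> \<gamma> \<bullet> e = 0 \<Longrightarrow> \<delta> * norm \<gamma> \<le> norm (f x *v \<gamma>)" for t f
  proof -
    have c1: "continuous_on UNIV (f \<circ> retract)"
      by (rule continuous_on_comp_retract[OF f])
    have c2: "continuous_on UNIV (\<lambda>x. Q (t, retract x))"
      by (intro continuous_on_compose2[OF contQ] continuous_intros continuous_on_retract) auto
    have l: "\<delta> * norm \<gamma> \<le> norm ((f \<circ> retract) x *v \<gamma>)" if "norm x \<ge> 1 \<or> \<gamma> \<bullet> e = 0" for x \<gamma>
      using that
    proof
      assume "norm x \<ge> 1"
      then have "(t, retract x) \<in> ?X" using retract_in_sphere t by blast
      from weaken[OF \<delta>1(2)[OF this] \<delta>(2)] show ?thesis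
        using Gf[OF retract_in_cball] by simp
    next
      assume "\<gamma> \<bullet> e = 0"
      then show ?thesis using lower[OF retract_in_cball] by simp
    qed
    have cl: "norm (((f \<circ> retract) x - Q (t, retract x)) *v \<gamma>) < \<delta> * norm \<gamma>" if "\<gamma> \<noteq> 0" for x \<gamma>
    proof -
      have "(t, retract x) \<in> {0..1} \<times> cball 0 1" using t retract_in_cball by blast
      from close[OF this that] show ?thesis using Gf[OF retract_in_cball] by simp
    qed
    show "hemisphere_parity e (f \<circ> retract) = hemisphere_parity e (\<lambda>x. Q (t, retract x))"
      "nonsingular_along e (\<lambda>x. Q (t, retract x))"
      by (rule hemisphere_parity_close[OF card c1 c2 l cl]; assumption)+
  qed
  have E0: "hemisphere_parity e (a \<circ> retract) = hemisphere_parity e (\<lambda>x. Q (0, retract x))"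
    "nonsingular_along e (\<lambda>x. Q (0, retract x))"
    by (rule end_close[OF _ a G(2)]; use weaken[OF \<delta>2(2) \<delta>(3)] in simp)+
  have E1: "hemisphere_parity e (b \<circ> retract) = hemisphere_parity e (\<lambda>x. Q (1, retract x))"
    "nonsingular_along e (\<lambda>x. Q (1, retract x))"
    by (rule end_close[OF _ b G(3)]; use weaken[OF \<delta>3(2) \<delta>(4)] in simp)+
  have ns: "nonsingular_along d (\<lambda>x. Q (t, retract x))"
    if t: "t \<in> {0..1}" and d: "\<forall>x \<gamma>. \<gamma> \<bullet> d = 0 \<longrightarrow> (P (t, x) + C) *v \<gamma> = 0 \<longrightarrow> \<gamma> = 0" for t d
    unfolding nonsingular_along_def
  proof (intro allI impI)
    fix x \<gamma> assume 0: "Q (t, retract x) *v \<gamma> = 0" and "norm x \<ge> 1 \<or> \<gamma> \<bullet> d = 0"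
    then show "\<gamma> = 0"
      using outside[OF t _ 0] retract_in_sphere[of x] d by (auto simp: Q_def)
  qed
  have "hemisphere_parity e (\<lambda>x. Q (0, retract x)) = hemisphere_parity e (\<lambda>x. Q (1, retract x))"
  proof (rule hemisphere_parity_path[OF card contQ outside _ E0(2) E1(2)])
    show "nonsingular_along e (\<lambda>x. Q (t, retract x)) \<or> nonsingular_along e' (\<lambda>x. Q (t, retract x))"
      if "t \<in> {0..1}" for t using ns[OF that] alt[of t] by blast
  qed
  then show ?thesis using E0(1) E1(1) by simp
qed

lemma (in clamped_family) nonsingular_along_avoiding:
  assumes "\<And>p. p \<in> tilde_zeros a \<Longrightarrow> fst p \<bullet> e \<noteq> 0"
  shows "nonsingular_along e A"
  unfolding nonsingular_along_def
proof (intro allI impI, rule ccontr)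
  fix x \<gamma> assume 0: "A x *v \<gamma> = 0" and x: "norm x \<ge> 1 \<or> \<gamma> \<bullet> e = 0" and \<gamma>: "\<gamma> \<noteq> 0"
  have "\<not> norm x \<ge> 1" using outside[OF _ 0] \<gamma> by blast
  then have "(sgn \<gamma>, x) \<in> tilde_zeros a" "\<gamma> \<bullet> e = 0"
    using 0 x \<gamma> by (auto simp: tilde_zeros_iff norm_sgn sphere_form_unit)
      (simp add: sgn_div_norm matrix_vector_mult_scaleR)
  then show False using assms[of "(sgn \<gamma>, x)"] by (simp add: sgn_div_norm)
qed

text \<open>Points with \<open>norm x \<ge> 1\<close> are retracted to the unit sphere, where the
  values of \<open>a\<close> are frames.\<close>

lemma admissible_clamped_family:
  fixes a :: "real^'m \<Rightarrow> real^'k^'n"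
  assumes "CARD('k) + CARD('m) = CARD('n) + 1" "CARD('n) \<ge> 2" "admissible \<alpha> a"
  shows "clamped_family a (a \<circ> retract)"
proof
  have "continuous_on (cball 0 1) a"
    using assms(3) smooth_map_on_imp_continuous_on by (auto simp: admissible_def)
  then show "continuous_on UNIV (a \<circ> retract)"
    by (rule continuous_on_comp_retract)
  show "\<gamma> = 0" if "1 \<le> norm x" "(a \<circ> retract) x *v \<gamma> = 0" for x \<gamma>
    using that assms(3) retract_in_sphere[OF that(1)] frames_injective[of "a (retract x)" \<gamma>]
    unfolding admissible_def by (metis comp_apply image_subset_iff)
qed (use assms in \<open>auto simp: retract_id\<close>)

theorem theorem2p6:
  fixes \<alpha> \<beta> :: "real^'m \<Rightarrow> real^'k^'n"
  assumes "CARD('n) > CARD('k)" and "CARD('k) > 1"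
    and "odd (CARD('n) - CARD('k))"
    and "CARD('m) = CARD('n) - CARD('k) + 1"
    and "continuous_on (sphere 0 1) \<alpha>" and "\<alpha> ` sphere 0 1 \<subseteq> frames"
    and "continuous_on (sphere 0 1) \<beta>" and "\<beta> ` sphere 0 1 \<subseteq> frames"
    and "homotopic_with_canon (\<lambda>_. True) (sphere 0 1) frames \<alpha> \<beta>"
    and "is_Lambda \<alpha> l" and "is_Lambda \<beta> l'"
  shows "l = l'"
proof -
  have card: "CARD('k) + CARD('m) = CARD('n) + 1" "CARD('n) \<ge> 2"
    using assms(1,2,4) by auto
  obtain a Z where a: "admissible \<alpha> a" "half_of_zeros a Z"
    and l: "l = (\<Sum>p\<in>Z. local_degree (tilde a) p) mod 2"
    using assms(10) by (auto simp: is_Lambda_def)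
  obtain b Z' where b: "admissible \<beta> b" "half_of_zeros b Z'"
    and l': "l' = (\<Sum>p\<in>Z'. local_degree (tilde b) p) mod 2"
    using assms(11) by (auto simp: is_Lambda_def)
  interpret a: clamped_family a "a \<circ> retract"
    by (rule admissible_clamped_family[OF card a(1)])
  interpret b: clamped_family b "b \<circ> retract"
    by (rule admissible_clamped_family[OF card b(1)])
  have fin: "finite (tilde_zeros a)" "finite (tilde_zeros b)"
    using a(1) b(1) by (auto simp: admissible_def)
  \<comment> \<open>Zeros have unit first component, so the finite set of first components omits 0.
    A single \<open>e\<close> is chosen for \<open>a\<close> and \<open>b\<close> together, since
    the parities of both are compared along the same direction.\<close>
  have "0 \<notin> fst ` (tilde_zeros a \<union> tilde_zeros b)"
    by (auto simp: a.tilde_zeros_iff b.tilde_zeros_iff)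
  then obtain e :: "real^'k" where e: "norm e = 1"
    "\<And>\<gamma>. \<gamma> \<in> fst ` (tilde_zeros a \<union> tilde_zeros b) \<Longrightarrow> \<gamma> \<bullet> e \<noteq> 0"
    using ex_direction_avoiding[of "fst ` (tilde_zeros a \<union> tilde_zeros b)"] fin by blast
  have ns: "nonsingular_along e (a \<circ> retract)" "nonsingular_along e (b \<circ> retract)"
    using e(2) by (auto intro!: a.nonsingular_along_avoiding b.nonsingular_along_avoiding)
  \<comment> \<open>On the sphere \<open>a\<close> is joined to \<open>b\<close> through
    \<open>\<alpha>\<close> and \<open>\<beta>\<close>.\<close>
  have "homotopic_with_canon (\<lambda>_. True) (sphere 0 1) frames a b"
    using a(1) b(1) assms(9) unfolding admissible_def
    by (meson homotopic_with_sym homotopic_with_trans)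
  moreover have "continuous_on (cball 0 1) a" "continuous_on (cball 0 1) b"
    using a(1) b(1) smooth_map_on_imp_continuous_on by (auto simp: admissible_def)
  ultimately have "hemisphere_parity e (a \<circ> retract) = hemisphere_parity e (b \<circ> retract)"
    using hemisphere_parity_homotopic[OF card assms(2) _ _ _ e(1) ns] by blast
  then have "odd (\<Sum>p\<in>Z. local_degree (tilde a) p) \<longleftrightarrow> odd (\<Sum>p\<in>Z'. local_degree (tilde b) p)"
    using a.odd_sum_local_degrees[OF fin(1) ns(1) a(2)] b.odd_sum_local_degrees[OF fin(2) ns(2) b(2)]
    by blast
  then show ?thesis
    unfolding l l' by (simp add: mod2_eq_if)
qed

end
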